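(* Let $T\in(0,\infty)$, let $b:\mathbb R^n\to\mathbb R^n$ and $\sigma:\mathbb R^n\to\mathbb R^{n\times m}$ be continuous, and suppose there are $L_b\in\mathbb R$ and $L_\sigma\ge 0$ such that for all $x,y\in\mathbb R^n$ $$\langle b(x)-b(y),x-y\rangle\le L_b|x-y|^2,\qquad |\sigma(x)-\sigma(y)|_{HS}\le L_\sigma|x-y|.$$ Let $X_0$ be an $\mathbb R^n$-valued $\mathscr F_0$-measurable random variable with $\mathbb E|X_0|^p<\infty$ for some $p\ge4$. Then there exists a constant $C$, independent of $M$ and of $X_0$, such that for every positive integer $M>T$ with $2L_b\tau<1$, where $\tau=T/M$, the backward Euler scheme $\{Y^M_k\}_{k=0}^M$ satisfies $$\mathbb E\sup_{0\le k\le M}|Y^M_k|^p\le C\,(1+\mathbb E|X_0|^p).$$ If, furthermore, $\sup_{0\le k\le M}\mathbb E|b(Y^M_k)|^p<\infty$, then the interpolation process $\{Y^M(t)\}_{t\in[0,T]}$ satisfies $$\mathbb E\sup_{t\in[0,T]}|Y^M(t)|^p\le C\Big(1+\mathbb E|X_0|^p+\sup_{0\le k\le M}\mathbb E|b(Y^M_k)|^p\Big).$$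
   Context: $W$ is an $\mathbb R^m$-valued Wiener process on a filtered probability space $(\Omega,\mathscr F,\{\mathscr F_t\}_{t\ge0},\mathbb P)$ (with respect to this filtration). $|\cdot|$ is the Euclidean norm on $\mathbb R^n$ and $|\cdot|_{HS}$ the Hilbert--Schmidt (Frobenius) norm on $\mathbb R^{n\times m}$. With $\tau=T/M$ and $t_k=k\tau$, the backward Euler scheme is $Y^M_0=X_0$, $Y^M_{k+1}=Y^M_k+b(Y^M_{k+1})\tau+\sigma(Y^M_k)(W_{t_{k+1}}-W_{t_k})$, $k=0,\dots,M-1$ (almost surely uniquely solvable when $L_b\tau<1$). The interpolation process is $$Y^M(t)=Y^M_k+b(Y^M_{k+1})(t-t_k)+\sigma(Y^M_k)(W_t-W_{t_k}),\quad t\in[t_k,t_{k+1}),\ k=0,\dots,M-1,\qquad Y^M(T)=Y^M_M.$$ *)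

theory Defs
  imports "HOL-Probability.Probability"
begin

(* The filtration is indexed by real numbers, but only the indices t \<ge> 0 matter. *)
locale filtered_prob_space = prob_space P for P :: "'w measure" +
  fixes F :: "real \<Rightarrow> 'w measure"
  assumes filtration_subalgebra: "\<And>t. 0 \<le> t \<Longrightarrow> subalgebra P (F t)"
    and filtration_mono: "\<And>s t. 0 \<le> s \<Longrightarrow> s \<le> t \<Longrightarrow> subalgebra (F t) (F s)"

(* Lebesgue density of the centred normal law N(0, v I) on R^m, for v > 0;
   normal_density takes the standard deviation as its second argument. *)
definition gaussian_density :: "real \<Rightarrow> real ^ 'm \<Rightarrow> ennreal" where
  "gaussian_density v x = ennreal (\<Prod>i\<in>UNIV. normal_density 0 (sqrt v) (x $ i))"

locale wiener_process = filtered_prob_space P F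
  for P :: "'w measure" and F :: "real \<Rightarrow> 'w measure" +
  fixes W :: "real \<Rightarrow> 'w \<Rightarrow> real ^ 'm"
  assumes adapted: "\<And>t. 0 \<le> t \<Longrightarrow> W t \<in> borel_measurable (F t)"
    and start_zero: "AE \<omega> in P. W 0 \<omega> = 0"
    and increment_gaussian: "\<And>s t. 0 \<le> s \<Longrightarrow> s < t \<Longrightarrow>
      distributed P lborel (\<lambda>\<omega>. W t \<omega> - W s \<omega>) (gaussian_density (t - s))"
    and increment_indep: "\<And>s t. 0 \<le> s \<Longrightarrow> s < t \<Longrightarrow>
      indep_set (sets (F s))
        {(\<lambda>\<omega>. W t \<omega> - W s \<omega>) -` B \<inter> space P | B. B \<in> sets borel}"
    and continuous_paths: "AE \<omega> in P. continuous_on {0..} (\<lambda>t. W t \<omega>)"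

definition hs_norm :: "real ^ 'm ^ 'n \<Rightarrow> real" where
  "hs_norm A = sqrt (\<Sum>i\<in>UNIV. \<Sum>j\<in>UNIV. (A $ i $ j)\<^sup>2)"

lemma hs_norm_eq_norm: "hs_norm A = norm A"
  by (simp add: hs_norm_def norm_vec_def L2_set_def sum_nonneg)

definition grid :: "real \<Rightarrow> nat \<Rightarrow> nat \<Rightarrow> real" where
  "grid T M k = real k * (T / real M)"

(* A solution of the implicit recursion is a family of random variables that
   satisfies it almost surely. *)
definition backward_euler_scheme ::
  "'w measure \<Rightarrow> (real \<Rightarrow> 'w \<Rightarrow> real ^ 'm) \<Rightarrow> (real ^ 'n \<Rightarrow> real ^ 'n) \<Rightarrow>
    (real ^ 'n \<Rightarrow> real ^ 'm ^ 'n) \<Rightarrow> real \<Rightarrow> nat \<Rightarrow> ('w \<Rightarrow> real ^ 'n) \<Rightarrow>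
    (nat \<Rightarrow> 'w \<Rightarrow> real ^ 'n) \<Rightarrow> bool" where
  "backward_euler_scheme P W b \<sigma> T M X0 Y \<longleftrightarrow>
    (\<forall>k\<le>M. Y k \<in> borel_measurable P) \<and>
    (AE \<omega> in P. Y 0 \<omega> = X0 \<omega> \<and>
      (\<forall>k<M. Y (Suc k) \<omega> = Y k \<omega> + (T / real M) *\<^sub>R b (Y (Suc k) \<omega>)
          + \<sigma> (Y k \<omega>) *v (W (grid T M (Suc k)) \<omega> - W (grid T M k) \<omega>)))"

(* For t in [0, T) the index k = nat \<lfloor>t / (T / M)\<rfloor> is the one with t in [t_k, t_(k+1)). *)
definition interpolation ::
  "(real \<Rightarrow> 'w \<Rightarrow> real ^ 'm) \<Rightarrow> (real ^ 'n \<Rightarrow> real ^ 'n) \<Rightarrow>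
    (real ^ 'n \<Rightarrow> real ^ 'm ^ 'n) \<Rightarrow> real \<Rightarrow> nat \<Rightarrow> (nat \<Rightarrow> 'w \<Rightarrow> real ^ 'n) \<Rightarrow>
    real \<Rightarrow> 'w \<Rightarrow> real ^ 'n" where
  "interpolation W b \<sigma> T M Y t \<omega> =
    (if t = T then Y M \<omega>
     else let k = nat \<lfloor>t / (T / real M)\<rfloor> in
       Y k \<omega> + (t - grid T M k) *\<^sub>R b (Y (Suc k) \<omega>)
         + \<sigma> (Y k \<omega>) *v (W t \<omega> - W (grid T M k) \<omega>))"

lemma interpolation_end: "interpolation W b \<sigma> T M Y T \<omega> = Y M \<omega>"
  by (simp add: interpolation_def)

lemma interpolation_on_subinterval:
  assumes "0 < T" "k < M" "t \<in> {grid T M k..<grid T M (Suc k)}"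
  shows "interpolation W b \<sigma> T M Y t \<omega> =
    Y k \<omega> + (t - grid T M k) *\<^sub>R b (Y (Suc k) \<omega>)
      + \<sigma> (Y k \<omega>) *v (W t \<omega> - W (grid T M k) \<omega>)"
proof -
  define \<tau> where "\<tau> = T / real M"
  have \<tau>: "\<tau> > 0" using assms by (simp add: \<tau>_def)
  have t: "real k * \<tau> \<le> t" "t < (real k + 1) * \<tau>"
    using assms(3) by (simp_all add: grid_def \<tau>_def add.commute)
  have "\<lfloor>t / \<tau>\<rfloor> = int k"
    using t \<tau> by (intro floor_unique) (simp_all add: pos_le_divide_eq pos_divide_less_eq)
  moreover have "t \<noteq> T"
  proof -
    have "(real k + 1) * \<tau> \<le> real M * \<tau>"
      using assms(2) \<tau> by (intro mult_right_mono) auto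
    also have "\<dots> = T" using assms(2) by (simp add: \<tau>_def)
    finally show ?thesis using t by simp
  qed
  ultimately show ?thesis
    by (simp add: interpolation_def \<tau>_def)
qed

end

theory Submission
  imports Defs
begin

text \<open>
  Write \<open>u(y) = (1 + |y|\<^sup>2)\<^bsup>p/4\<^esup>\<close>, so that \<open>u(y)\<^sup>2\<close> is comparable to \<open>1 + |y|\<^sup>p\<close>. Testing the implicit step with
  \<open>Y\<^sub>k\<^sub>+\<^sub>1\<close> and expanding to second order (this needs \<open>p/4 \<ge> 1\<close>) gives the pathwise inequality
  \<open>u\<^sub>k\<^sub>+\<^sub>1 \<le> u\<^sub>k + u\<^sub>k \<langle>g\<^sub>k, \<Delta>W\<^sub>k\<rangle> + u\<^sub>k \<phi>(\<Delta>W\<^sub>k)\<close> with \<open>g\<^sub>k\<close> bounded and \<open>E \<phi>(\<Delta>W\<^sub>k)\<^sup>2 = O(\<tau>\<^sup>2)\<close>. Squaring the summed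
  inequality, Doob's \<open>L\<^sup>2\<close> inequality for the martingale part and the Cauchy-Schwarz inequality for the
  remainder lead to a discrete Gronwall inequality for \<open>E max u\<^sub>j\<^sup>2\<close>. No Burkholder-Davis-Gundy inequality is
  needed because \<open>u\<close> is only the square root of the quantity to be estimated.

  For the interpolation, the recursion turns \<open>(t - t\<^sub>k) b(Y\<^sub>k\<^sub>+\<^sub>1)\<close> into a fraction of
  \<open>Y\<^sub>k\<^sub>+\<^sub>1 - Y\<^sub>k - \<sigma>(Y\<^sub>k) \<Delta>W\<^sub>k\<close>, and \<open>u\<^sub>k |W\<^sub>t - W\<^sub>t\<^sub>k|\<^bsup>p/2\<^esup>\<close> is an \<open>L\<^sup>2\<close> submartingale on \<open>[t\<^sub>k, t\<^sub>k\<^sub>+\<^sub>1]\<close>; the resulting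
  second moments are \<open>O(\<tau>\<^sup>2)\<close>, so they may be summed over \<open>k\<close>.
\<close>

section \<open>Elementary inequalities\<close>

text \<open>The drift \<open>b\<close> may grow arbitrarily fast, so it is never estimated by its
  size: it enters through the one-sided condition, tested against the new value \<open>y'\<close>,
  and through \<open>b 0\<close>. The price is a factor 1 / (1 - (2 L + \<epsilon>) \<tau>) per
  step, which must be 1 + O(\<tau>) uniformly in M. This is the purpose of the margin \<delta>:
  among the integers M with 2 L T < M the smallest is the worst, so 1 - 2 L \<tau> stays away from
  0. The condition M > T gives \<tau> \<le> 1, which absorbs the higher powers of \<tau> coming from
  high moments of the noise. Conditional expectations do not occur. Martingale increments are
  handled by the identity E (h . \<Delta>W) = 0 for integrable h from the past, a consequence of
  independence, and Doob's inequality is stated so that this suffices. Two obstacles concern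
  measurability. A solution of the scheme is not adapted by definition and is first exchanged for an
  adapted one that agrees with it almost surely. The supremum over [0, T] is not shown to be
  measurable; it is bounded almost surely by a measurable function.\<close>

lemma powr_ge_one_plus_mult:
  fixes s x :: real
  assumes "1 \<le> s" "-1 \<le> x"
  shows "1 + s * x \<le> (1 + x) powr s"
proof (cases "1 + s * x \<le> 0")
  case True
  then show ?thesis by (rule order_trans) simp
next
  case False
  \<comment> \<open>Weighted AM-GM for 1 + s x and 1 with weights 1/s and 1 - 1/s: Bernoulli's
    inequality before taking the power s.\<close>
  have "(1 + s * x) powr (1/s) * 1 powr (1 - 1/s) \<le> (1/s) * (1 + s * x) + (1 - 1/s) * 1"
    using assms False by (intro Youngs_inequality_0) auto
  also have "\<dots> = 1 + x" using assms by (simp add: field_simps)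
  finally have "(1 + s * x) powr (1/s) \<le> 1 + x" by simp
  then have "((1 + s * x) powr (1/s)) powr s \<le> (1 + x) powr s"
    using assms by (intro powr_mono2) auto
  then show ?thesis using assms False by (simp add: powr_powr)
qed

text \<open>By convexity of the power function, its tangent at 1 + x lies below the graph at 1. This
  is Bernoulli's inequality at - x / (1 + x), because adding 1 to that number gives 1 / (1 +
  x).\<close>

lemma powr_tangent:
  fixes s x :: real
  assumes "1 \<le> s" "-1 < x"
  shows "(1 + x) powr s \<le> 1 + s * x * ((1 + x) powr s / (1 + x))"
proof -
  let ?P = "(1 + x) powr s"
  have P: "?P > 0" using assms by simp
  have "-1 \<le> - x / (1 + x)" using assms by (simp add: field_simps)
  from powr_ge_one_plus_mult[OF assms(1) this]
  have "1 - s * x / (1 + x) \<le> (1 + - x / (1 + x)) powr s" by simp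
  also have "1 + - x / (1 + x) = 1 / (1 + x)" using assms by (simp add: field_simps)
  also have "(1 / (1 + x)) powr s = 1 / ?P" using assms by (simp add: powr_divide)
  finally have "(1 - s * x / (1 + x)) * ?P \<le> 1 / ?P * ?P"
    using P by (intro mult_right_mono) auto
  then show ?thesis using P by (simp add: algebra_simps)
qed

text \<open>The linear coefficient must be exactly s, since this term later has to average out; the
  quadratic term may be crude. The tangent inequality leaves s x times the deviation of (1 +
  x)^(s-1) from 1, and this deviation is of first order in x by the tangent inequality again if x
  \<ge> 0 and by Bernoulli's inequality if x < 0.\<close>

lemma powr_second_order:
  fixes s x :: real
  assumes s: "1 \<le> s" and x: "-1 \<le> x"
  shows "(1 + x) powr s \<le> 1 + s * x + s\<^sup>2 * x\<^sup>2 * (1 + \<bar>x\<bar>) powr s"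
proof (cases "x = -1")
  case True
  have "1 \<le> (2::real) powr s" using s by (simp add: ge_one_powr_ge_zero)
  then have "s * 1 \<le> s\<^sup>2 * 2 powr s"
    using s unfolding power2_eq_square mult.assoc
    by (intro mult_left_mono) (auto intro: order_trans[OF _ mult_mono[of 1 s 1]])
  then show ?thesis using True by simp
next
  case False
  with x have y: "1 + x > 0" by simp
  let ?P = "(1 + x) powr s"
  have tan: "?P \<le> 1 + s * x * (?P / (1 + x))"
    using powr_tangent[OF s] y by simp
  have ge1: "1 \<le> (1 + \<bar>x\<bar>) powr s" using s by (intro ge_one_powr_ge_zero) auto
  have "s * x * (?P / (1 + x) - 1) \<le> s\<^sup>2 * x\<^sup>2 * (1 + \<bar>x\<bar>) powr s"
  proof (cases "0 \<le> x")
    case True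
    have le: "?P / (1 + x) \<le> ?P" using True by (simp add: divide_le_eq algebra_simps)
    have "?P - 1 \<le> s * x * (?P / (1 + x))" using tan by simp
    also have "\<dots> \<le> s * x * ?P" using le True s by (intro mult_left_mono) auto
    finally have "?P / (1 + x) - 1 \<le> s * x * ?P" using le by simp
    then have "s * x * (?P / (1 + x) - 1) \<le> s * x * (s * x * ?P)"
      using True s by (intro mult_left_mono) auto
    then show ?thesis using True by (simp add: power2_eq_square ac_simps)
  next
    case False
    have "?P \<le> ?P / (1 + x)" using y False by (simp add: le_divide_eq distrib_left mult_nonneg_nonpos)
    moreover have "1 + s * x \<le> ?P" by (rule powr_ge_one_plus_mult[OF s x])
    ultimately have "1 - ?P / (1 + x) \<le> - (s * x)" by simp
    then have "(- (s * x)) * (1 - ?P / (1 + x)) \<le> (- (s * x)) * (- (s * x))"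
      using False s by (intro mult_left_mono) (auto simp: mult_nonneg_nonpos)
    also have "\<dots> = s\<^sup>2 * x\<^sup>2 * 1" by (simp add: power2_eq_square)
    also have "\<dots> \<le> s\<^sup>2 * x\<^sup>2 * (1 + \<bar>x\<bar>) powr s" using ge1 by (intro mult_left_mono) auto
    finally show ?thesis by (simp add: algebra_simps)
  qed
  then show ?thesis using tan by (simp add: algebra_simps)
qed

text \<open>The subgradient inequality for the convex function |.|^r at v. Only the component of v +
  d along v matters: its length relative to v is 1 + x, and Bernoulli's inequality applies to it. It
  yields the submartingale property of powers of Wiener increments.\<close>

lemma norm_add_powr_ge:
  fixes v d :: "'a::real_inner"
  assumes r: "1 \<le> r"
  shows "norm v powr r + r * norm v powr (r - 2) * (v \<bullet> d) \<le> norm (v + d) powr r"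
proof (cases "v = 0")
  case True
  then show ?thesis by simp
next
  case False
  define x where "x = (v \<bullet> d) / (norm v)\<^sup>2"
  have nv: "norm v > 0" using False by simp
  have sp: "norm v powr r * x = norm v powr (r - 2) * (v \<bullet> d)"
    using nv by (simp add: x_def powr_diff)
  have *: "norm v powr r * (1 + r * x) \<le> norm (v + d) powr r"
  proof (cases "-1 \<le> x")
    case True
    have "norm v * (norm v * (1 + x)) = (norm v)\<^sup>2 + v \<bullet> d"
      using nv by (simp add: x_def power2_eq_square field_simps)
    also have "\<dots> = (v + d) \<bullet> v"
      by (simp add: inner_add_left inner_commute[of d] power2_norm_eq_inner)
    also have "\<dots> \<le> norm v * norm (v + d)" using norm_cauchy_schwarz[of "v + d" v] by (simp add: mult.commute)
    finally have le: "norm v * (1 + x) \<le> norm (v + d)" using nv by simp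
    have "norm v powr r * (1 + r * x) \<le> norm v powr r * (1 + x) powr r"
      using powr_ge_one_plus_mult[OF r True] by (intro mult_left_mono) auto
    also have "\<dots> = (norm v * (1 + x)) powr r" using True by (simp add: powr_mult)
    also have "\<dots> \<le> norm (v + d) powr r" using le True r by (intro powr_mono2) auto
    finally show ?thesis .
  next
    case False
    have "r * x \<le> 1 * x" using False r by (intro mult_right_mono_neg) auto
    then have "1 + r * x \<le> 0" using False by linarith
    then have "norm v powr r * (1 + r * x) \<le> 0" by (intro mult_nonneg_nonpos) auto
    then show ?thesis by (rule order_trans) simp
  qed
  have "norm v powr r * (1 + r * x) = norm v powr r + r * (norm v powr r * x)" by (simp add: algebra_simps)
  then show ?thesis using * unfolding sp by (simp only: mult.assoc)
qed

section \<open>Frobenius norm bounds for matrix-vector products\<close>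

lemma norm_matrix_vector_le:
  fixes A :: "real ^ 'm ^ 'n"
  shows "norm (A *v z) \<le> norm A * norm z"
proof -
  have "norm (A *v z) = L2_set (\<lambda>i. \<bar>(A $ i) \<bullet> z\<bar>) UNIV"
    by (simp add: norm_vec_def matrix_vector_mult_def inner_vec_def)
  also have "\<dots> \<le> L2_set (\<lambda>i. norm (A $ i) * norm z) UNIV"
    by (intro L2_set_mono) (auto intro: Cauchy_Schwarz_ineq2)
  also have "\<dots> = norm A * norm z"
    by (simp add: L2_set_left_distrib norm_vec_def[of A])
  finally show ?thesis .
qed

lemma norm_vector_matrix_le:
  fixes A :: "real ^ 'm ^ 'n"
  shows "norm (y v* A) \<le> norm y * norm A"
proof -
  \<comment> \<open>Duality: the row-vector product is tested against itself, which reduces the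
    claim to the bound for \<open>A *v z\<close>.\<close>
  have "(norm (y v* A))\<^sup>2 = y \<bullet> (A *v (y v* A))"
    by (simp add: power2_norm_eq_inner dot_lmul_matrix)
  also have "\<dots> \<le> norm y * norm (A *v (y v* A))" by (rule norm_cauchy_schwarz)
  also have "\<dots> \<le> norm y * (norm A * norm (y v* A))"
    by (intro mult_left_mono norm_matrix_vector_le) auto
  finally have "norm (y v* A) * norm (y v* A) \<le> (norm y * norm A) * norm (y v* A)"
    by (simp add: power2_eq_square mult.assoc)
  then show ?thesis
    by (cases "y v* A = 0") auto
qed

section \<open>Polynomial bounds for the second-order remainder\<close>

lemma power_le_between:
  fixes d :: real
  assumes "0 \<le> d" "i \<le> j" "j \<le> k"
  shows "d ^ j \<le> d ^ i + d ^ k"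
proof (cases "d \<le> 1")
  case True
  have "d ^ j \<le> d ^ i" using assms True by (intro power_decreasing) auto
  then show ?thesis using assms by (simp add: add_increasing2)
next
  case False
  have "d ^ j \<le> d ^ k" using assms False by (intro power_increasing) auto
  then show ?thesis using assms by (simp add: add_increasing)
qed

lemma one_plus_power_le:
  fixes x :: real
  assumes "0 \<le> x"
  shows "(1 + x) ^ n \<le> 2 ^ n * (1 + x ^ n)"
proof -
  have "(1 + x) ^ n \<le> (2 * max 1 x) ^ n" using assms by (intro power_mono) auto
  also have "\<dots> = 2 ^ n * max 1 x ^ n" by (rule power_mult_distrib)
  also have "max 1 x ^ n \<le> 1 + x ^ n" using assms by (cases "x \<le> 1") (auto simp: max_def)
  finally show ?thesis by simp
qed

text \<open>Here d stands for the length of a Wiener increment and the expression K \<tau> + 2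
  \<kappa> d + \<kappa>^2 d^2 for a bound on the relative change of 1 + |y|^2 in one step. The
  right-hand side contains only \<tau> and even powers of d, whose Gaussian moments are explicit and
  at least of order \<tau>.\<close>

lemma quadratic_remainder_bound:
  fixes K \<kappa> :: real
  assumes K: "0 \<le> K" and \<kappa>: "0 \<le> \<kappa>" and n: "1 \<le> n"
  obtains C where "0 \<le> C"
    "\<And>\<tau> d. 0 \<le> \<tau> \<Longrightarrow> \<tau> \<le> 1 \<Longrightarrow> 0 \<le> d \<Longrightarrow>
      (K * \<tau> + 2 * \<kappa> * d + \<kappa>\<^sup>2 * d\<^sup>2)\<^sup>2 * (1 + (K * \<tau> + 2 * \<kappa> * d + \<kappa>\<^sup>2 * d\<^sup>2)) ^ n
        \<le> C * (\<tau> + d\<^sup>2 + d ^ (2 * (n + 2)))"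
proof
  define R where "R = K + 2 * \<kappa> + \<kappa>\<^sup>2"
  have R0: "0 \<le> R" using K \<kappa> by (simp add: R_def)
  \<comment> \<open>The 3 comes from squaring a sum of three terms, (1 + R)^n 2^n from the n-th
    power of 1 + X, and 5 from collecting the products of monomials.\<close>
  let ?C = "3 * R\<^sup>2 * (1 + R) ^ n * 2 ^ n * 5"
  show "0 \<le> ?C" using R0 by simp
  fix \<tau> d :: real assume t: "0 \<le> \<tau>" "\<tau> \<le> 1" and d: "0 \<le> d"
  define X where "X = K * \<tau> + 2 * \<kappa> * d + \<kappa>\<^sup>2 * d\<^sup>2"
  have X0: "0 \<le> X" using K \<kappa> t d by (simp add: X_def)
  have X1: "X \<le> R * (\<tau> + d + d\<^sup>2)"
  proof -
    have "X \<le> R * \<tau> + R * d + R * d\<^sup>2"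
      unfolding X_def using K \<kappa> t d by (intro add_mono mult_right_mono) (auto simp: R_def)
    then show ?thesis by (simp add: algebra_simps)
  qed
  have X2: "1 + X \<le> (1 + R) * (1 + d\<^sup>2)"
  proof -
    have "K * \<tau> \<le> K * (1 + d\<^sup>2)" using K t by (intro mult_left_mono) (auto intro: order_trans)
    moreover have "\<kappa> * (2 * d) \<le> \<kappa> * (1 + d\<^sup>2)"
      using \<kappa> sum_squares_bound[of 1 d] by (intro mult_left_mono) (auto)
    moreover have "\<kappa>\<^sup>2 * d\<^sup>2 \<le> \<kappa>\<^sup>2 * (1 + d\<^sup>2)" by (intro mult_left_mono) auto
    moreover have "0 \<le> \<kappa> * (1 + d\<^sup>2)" using \<kappa> by simp
    moreover have "0 \<le> d\<^sup>2" "0 \<le> \<kappa>\<^sup>2" by simp_all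
    ultimately have "1 + K * \<tau> + \<kappa> * (2 * d) + \<kappa>\<^sup>2 * d\<^sup>2
        \<le> (1 + d\<^sup>2) + K * (1 + d\<^sup>2) + 2 * (\<kappa> * (1 + d\<^sup>2)) + \<kappa>\<^sup>2 * (1 + d\<^sup>2)"
      by linarith
    then show ?thesis unfolding X_def R_def by (simp add: algebra_simps)
  qed
  have "X\<^sup>2 \<le> (R * (\<tau> + d + d\<^sup>2))\<^sup>2" using X0 X1 by (intro power_mono) auto
  also have "\<dots> = R\<^sup>2 * (\<tau> + d + d\<^sup>2)\<^sup>2" by (rule power_mult_distrib)
  also have "(\<tau> + d + d\<^sup>2)\<^sup>2 \<le> 3 * (\<tau>\<^sup>2 + d\<^sup>2 + d ^ 4)"
    using sum_squares_bound[of \<tau> d] sum_squares_bound[of \<tau> "d\<^sup>2"] sum_squares_bound[of d "d\<^sup>2"]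
    by (simp add: power2_eq_square power4_eq_xxxx algebra_simps)
  finally have A: "X\<^sup>2 \<le> 3 * R\<^sup>2 * (\<tau>\<^sup>2 + d\<^sup>2 + d ^ 4)" by (simp add: mult_left_mono distrib_left)
  have "(1 + X) ^ n \<le> ((1 + R) * (1 + d\<^sup>2)) ^ n" using X0 X2 by (intro power_mono) auto
  also have "\<dots> = (1 + R) ^ n * (1 + d\<^sup>2) ^ n" by (rule power_mult_distrib)
  also have "\<dots> \<le> (1 + R) ^ n * (2 ^ n * (1 + (d\<^sup>2) ^ n))"
    using R0 by (intro mult_left_mono one_plus_power_le) auto
  finally have B: "(1 + X) ^ n \<le> (1 + R) ^ n * 2 ^ n * (1 + d ^ (2 * n))"
    by (simp add: power_mult mult.assoc)
  let ?D = "d ^ (2 * (n + 2))"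
  \<comment> \<open>Each pure power of d that occurs has an exponent between 2 and 2 (n + 2), so it
    lies below the sum of the two extreme powers.\<close>
  have C: "(\<tau>\<^sup>2 + d\<^sup>2 + d ^ 4) * (1 + d ^ (2 * n)) \<le> 5 * (\<tau> + d\<^sup>2 + ?D)"
  proof -
    have p1: "d ^ 4 \<le> d\<^sup>2 + ?D" using d by (intro power_le_between) auto
    have p2: "d ^ (2 * n) \<le> d\<^sup>2 + ?D" using d n by (intro power_le_between) auto
    have p3: "d\<^sup>2 * d ^ (2 * n) \<le> d\<^sup>2 + ?D"
      using power_le_between[OF d, of 2 "2 + 2 * n" "2 * (n + 2)"] unfolding power_add[of d 2] by simp
    have p4: "d ^ 4 * d ^ (2 * n) = ?D" unfolding power_add[symmetric] by (rule arg_cong[where f="power d"]) simp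
    have t2: "\<tau>\<^sup>2 \<le> \<tau>" using t by (simp add: power2_eq_square mult_left_le)
    have p5: "\<tau>\<^sup>2 * d ^ (2 * n) \<le> d ^ (2 * n)"
      using t d by (intro mult_left_le_one_le) (auto simp: power_le_one)
    have pos: "0 \<le> ?D" "0 \<le> d\<^sup>2" using d by auto
    have "(\<tau>\<^sup>2 + d\<^sup>2 + d ^ 4) * (1 + d ^ (2 * n))
        = \<tau>\<^sup>2 + d\<^sup>2 + d ^ 4 + \<tau>\<^sup>2 * d ^ (2 * n) + d\<^sup>2 * d ^ (2 * n) + d ^ 4 * d ^ (2 * n)"
      by (simp add: algebra_simps)
    then show ?thesis using p1 p2 p3 p4 t2 p5 pos t by argo
  qed
  have "X\<^sup>2 * (1 + X) ^ n
      \<le> (3 * R\<^sup>2 * (\<tau>\<^sup>2 + d\<^sup>2 + d ^ 4)) * ((1 + R) ^ n * 2 ^ n * (1 + d ^ (2 * n)))"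
    using X0 t d by (intro mult_mono A B) auto
  also have "\<dots> = 3 * R\<^sup>2 * (1 + R) ^ n * 2 ^ n * ((\<tau>\<^sup>2 + d\<^sup>2 + d ^ 4) * (1 + d ^ (2 * n)))"
    by (simp add: ac_simps)
  also have "\<dots> \<le> 3 * R\<^sup>2 * (1 + R) ^ n * 2 ^ n * (5 * (\<tau> + d\<^sup>2 + ?D))"
    using R0 by (intro mult_left_mono C) auto
  finally show "(K * \<tau> + 2 * \<kappa> * d + \<kappa>\<^sup>2 * d\<^sup>2)\<^sup>2 * (1 + (K * \<tau> + 2 * \<kappa> * d + \<kappa>\<^sup>2 * d\<^sup>2)) ^ n
        \<le> ?C * (\<tau> + d\<^sup>2 + ?D)" unfolding X_def by (simp only: mult.assoc)
qed

section \<open>One step of the scheme\<close>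

text \<open>Used with s = p / 4. The added 1 keeps the base away from 0, so that increments can be
  measured relative to it.\<close>

definition lyap :: "real \<Rightarrow> 'a::real_normed_vector \<Rightarrow> real" where
  "lyap s y = (1 + (norm y)\<^sup>2) powr s"

lemma lyap_pos: "0 < lyap s y"
proof -
  have "0 < 1 + (norm y)\<^sup>2" by (rule add_pos_nonneg) auto
  then show ?thesis by (simp add: lyap_def)
qed

text \<open>Growth is measured by the square root of the base of \<open>lyap\<close>, so that it
  cancels exactly when the noise is divided by that base.\<close>

lemma lipschitz_imp_linear_growth:
  fixes \<sigma> :: "'a::real_normed_vector \<Rightarrow> 'b::real_normed_vector"
  assumes lipschitz: "\<And>x y. norm (\<sigma> x - \<sigma> y) \<le> L * norm (x - y)" and L: "0 \<le> L"
  shows "norm (\<sigma> y) \<le> (norm (\<sigma> 0) + L) * sqrt (1 + (norm y)\<^sup>2)"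
proof -
  have "norm (\<sigma> y) \<le> norm (\<sigma> 0) + norm (\<sigma> y - \<sigma> 0)" by (metis add.commute diff_add_cancel norm_triangle_ineq)
  also have "\<dots> \<le> norm (\<sigma> 0) * 1 + L * norm y" using lipschitz[of y 0] by simp
  also have "\<dots> \<le> norm (\<sigma> 0) * sqrt (1 + (norm y)\<^sup>2) + L * sqrt (1 + (norm y)\<^sup>2)"
    using L by (intro add_mono mult_left_mono) (auto intro: real_le_rsqrt)
  finally show ?thesis by (simp add: algebra_simps)
qed

text \<open>Take the inner product of the step with y' itself. Then 2 v . y' is split by Young's
  inequality, and the one-sided condition between y' and 0 bounds b(y') . y'. The parameter
  \<epsilon> is the share of the quadratic term spent on absorbing |b(0)| |y'|.\<close>

lemma implicit_step_energy:
  fixes b :: "'a::real_inner \<Rightarrow> 'a"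
  assumes onesided: "\<And>x y. (b x - b y) \<bullet> (x - y) \<le> L * (norm (x - y))\<^sup>2"
    and \<epsilon>: "0 < \<epsilon>" and \<tau>: "0 \<le> \<tau>"
    and step: "y' = v + \<tau> *\<^sub>R b y'"
  shows "(1 - (2 * L + \<epsilon>) * \<tau>) * (norm y')\<^sup>2 \<le> (norm v)\<^sup>2 + \<tau> * ((norm (b 0))\<^sup>2 / \<epsilon>)"
proof -
  have drift: "b y' \<bullet> y' \<le> L * (norm y')\<^sup>2 + norm (b 0) * norm y'"
    using onesided[of y' 0] norm_cauchy_schwarz[of "b 0" y'] by (simp add: inner_diff_left)
  have young: "2 * (norm (b 0) * norm y') \<le> \<epsilon> * (norm y')\<^sup>2 + (norm (b 0))\<^sup>2 / \<epsilon>"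
  proof -
    have "0 \<le> (\<epsilon> * norm y' - norm (b 0))\<^sup>2" by simp
    then have "2 * (norm (b 0) * norm y') * \<epsilon> \<le> \<epsilon> * (norm y')\<^sup>2 * \<epsilon> + (norm (b 0))\<^sup>2"
      by (simp add: power2_eq_square algebra_simps)
    also have "\<dots> = (\<epsilon> * (norm y')\<^sup>2 + (norm (b 0))\<^sup>2 / \<epsilon>) * \<epsilon>"
      using \<epsilon> by (simp add: field_simps)
    finally show ?thesis using \<epsilon> by simp
  qed
  have "y' \<bullet> y' = v \<bullet> y' + \<tau> * (b y' \<bullet> y')"
    by (subst step) (simp add: inner_add_left inner_scaleR_left)
  then have "(norm y')\<^sup>2 = v \<bullet> y' + \<tau> * (b y' \<bullet> y')" by (simp add: power2_norm_eq_inner)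
  moreover have "2 * (v \<bullet> y') \<le> (norm v)\<^sup>2 + (norm y')\<^sup>2"
    using norm_cauchy_schwarz[of v y'] sum_squares_bound[of "norm v" "norm y'"] by simp
  moreover have "\<tau> * (2 * (b y' \<bullet> y'))
      \<le> \<tau> * (2 * (L * (norm y')\<^sup>2) + (\<epsilon> * (norm y')\<^sup>2 + (norm (b 0))\<^sup>2 / \<epsilon>))"
    using drift young \<tau> by (intro mult_left_mono) auto
  ultimately show ?thesis by (simp add: algebra_simps)
qed

text \<open>The noise enters the bound for the Lyapunov function only through a term linear in \<open>z\<close>, which
  becomes a martingale increment, and a remainder whose second moment is of order \<open>\<tau>\<^sup>2\<close>.\<close>

lemma backward_euler_step:
  fixes b :: "real ^ 'n \<Rightarrow> real ^ 'n" and \<sigma> :: "real ^ 'n \<Rightarrow> real ^ 'm ^ 'n"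
  assumes onesided: "\<And>x y. (b x - b y) \<bullet> (x - y) \<le> L * (norm (x - y))\<^sup>2"
    and lipschitz: "\<And>x y. norm (\<sigma> x - \<sigma> y) \<le> L' * norm (x - y)"
    and L: "0 \<le> L" and L': "0 \<le> L'" and s: "1 \<le> s" and \<delta>: "0 < \<delta>" "\<delta> \<le> 1"
  obtains G B N where "0 \<le> G" "0 \<le> B" "1 \<le> N"
    "\<And>\<tau>. 0 < \<tau> \<Longrightarrow> \<tau> \<le> 1 \<Longrightarrow> \<delta> \<le> 1 - 2 * L * \<tau> \<Longrightarrow>
      \<exists>c. (\<forall>y. norm ((c / (1 + (norm y)\<^sup>2)) *\<^sub>R (y v* \<sigma> y)) \<le> G) \<and>
        (\<forall>y y' z. y' = y + \<tau> *\<^sub>R b y' + \<sigma> y *v z \<longrightarrow>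
          lyap s y' \<le> lyap s y + lyap s y * (((c / (1 + (norm y)\<^sup>2)) *\<^sub>R (y v* \<sigma> y)) \<bullet> z)
            + lyap s y * (B * (\<tau> + (norm z)\<^sup>2 + norm z ^ (2 * N))))"
proof -
  \<comment> \<open>Half of the margin: since \<tau> \<le> 1, the factor q below is still at least
    \<delta> / 2.\<close>
  define \<epsilon> where "\<epsilon> = \<delta> / 2"
  define K where "K = (norm (b 0))\<^sup>2 / \<epsilon>"
  define \<kappa> where "\<kappa> = norm (\<sigma> 0) + L'"
  define A where "A = (2 / \<delta>) powr s"
  define n where "n = nat \<lceil>s\<rceil>"
  have \<epsilon>: "0 < \<epsilon>" using \<delta> by (simp add: \<epsilon>_def)
  have K: "0 \<le> K" using \<epsilon> by (simp add: K_def)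
  have \<kappa>: "0 \<le> \<kappa>" using L' by (simp add: \<kappa>_def)
  have A: "0 \<le> A" by (simp add: A_def)
  have n: "s \<le> real n" "1 \<le> n" using s unfolding n_def by linarith+
  obtain C where C: "0 \<le> C"
    and rem: "\<And>\<tau> d. 0 \<le> \<tau> \<Longrightarrow> \<tau> \<le> 1 \<Longrightarrow> 0 \<le> d \<Longrightarrow>
      (K * \<tau> + 2 * \<kappa> * d + \<kappa>\<^sup>2 * d\<^sup>2)\<^sup>2 * (1 + (K * \<tau> + 2 * \<kappa> * d + \<kappa>\<^sup>2 * d\<^sup>2)) ^ n
        \<le> C * (\<tau> + d\<^sup>2 + d ^ (2 * (n + 2)))"
    using quadratic_remainder_bound[OF K \<kappa> n(2)] by blast
  define G where "G = 2 * s * A * \<kappa>"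
  define C1 where "C1 = s * A * ((2 * L + \<epsilon>) * (2 / \<delta>))"
  \<comment> \<open>\<open>C1\<close> pays for the amplification \<open>a powr s\<close> - 1 due to
    the implicit drift; the other part pays for the non-martingale share of x and for the quadratic
    remainder, both amplified by at most A.\<close>
  define B where "B = C1 + A * (s * (K + \<kappa>\<^sup>2) + s\<^sup>2 * C)"
  have G: "0 \<le> G" using s A \<kappa> by (simp add: G_def)
  have C1: "0 \<le> C1" using s A L \<epsilon> \<delta> by (simp add: C1_def)
  have B: "0 \<le> B" using s A C1 C K by (simp add: B_def)
  have growth: "norm (\<sigma> y) \<le> \<kappa> * sqrt (1 + (norm y)\<^sup>2)" for y
    unfolding \<kappa>_def by (rule lipschitz_imp_linear_growth[OF lipschitz L'])
  show ?thesis
  proof (rule that[OF G B, of "n + 2"])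
    show "1 \<le> n + 2" by simp
  next
    fix \<tau> :: real assume \<tau>: "0 < \<tau>" "\<tau> \<le> 1" "\<delta> \<le> 1 - 2 * L * \<tau>"
    define q where "q = 1 - (2 * L + \<epsilon>) * \<tau>"
    have "\<epsilon> * \<tau> \<le> \<epsilon> * 1" using \<tau> \<epsilon> by (intro mult_left_mono) auto
    then have q: "\<delta> / 2 \<le> q" using \<tau> by (simp add: q_def \<epsilon>_def algebra_simps)
    have q1: "q \<le> 1" using L \<epsilon> \<tau> by (simp add: q_def)
    have q0: "0 < q" using q \<delta> by simp
    define a where "a = 1 / q"
    have a1: "1 \<le> a" using q0 q1 by (simp add: a_def)
    have a2: "a \<le> 2 / \<delta>" using q q0 \<delta> by (simp add: a_def field_simps)
    have as: "0 \<le> a powr s" "a powr s \<le> A"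
      unfolding A_def using a1 a2 s by (auto intro: powr_mono2)
    \<comment> \<open>The amplification has to be 1 + O(\<tau>), not merely bounded, because it is
      compounded over all M steps.\<close>
    have asC: "a powr s \<le> 1 + C1 * \<tau>"
    proof -
      have aeq: "a - 1 = ((2 * L + \<epsilon>) * a) * \<tau>" using q0 by (simp add: a_def q_def field_simps)
      have "a powr s / a \<le> a powr s" using a1 by (simp add: divide_le_eq mult_left_mono[of 1 a "a powr s", simplified])
      have "a powr s \<le> 1 + s * (a - 1) * (a powr s / a)"
        using powr_tangent[OF s, of "a - 1"] a1 by simp
      also have "s * (a - 1) * (a powr s / a) \<le> s * (a - 1) * A"
        using as \<open>a powr s / a \<le> a powr s\<close> a1 s by (intro mult_left_mono) auto
      also have "\<dots> \<le> s * (((2 * L + \<epsilon>) * (2 / \<delta>)) * \<tau>) * A"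
        unfolding aeq using a2 L \<epsilon> \<tau> s A by (intro mult_left_mono mult_right_mono) auto
      finally show ?thesis by (simp add: C1_def ac_simps)
    qed
    \<comment> \<open>The first-order coefficient of the expansion, amplified by the implicit drift.
      It depends on \<tau> through a, which is why c is existential while G, B and N are
      uniform.\<close>
    define c where "c = 2 * s * a powr s"
    have c: "0 \<le> c" "c \<le> 2 * s * A" using as s by (auto simp: c_def)
    show "\<exists>c. (\<forall>y. norm ((c / (1 + (norm y)\<^sup>2)) *\<^sub>R (y v* \<sigma> y)) \<le> G) \<and>
        (\<forall>y y' z. y' = y + \<tau> *\<^sub>R b y' + \<sigma> y *v z \<longrightarrow>
          lyap s y' \<le> lyap s y + lyap s y * (((c / (1 + (norm y)\<^sup>2)) *\<^sub>R (y v* \<sigma> y)) \<bullet> z)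
            + lyap s y * (B * (\<tau> + (norm z)\<^sup>2 + norm z ^ (2 * (n + 2)))))"
    proof (intro exI[of _ c] conjI allI impI)
      fix y :: "real ^ 'n"
      define w where "w = 1 + (norm y)\<^sup>2"
      have w: "1 \<le> w" by (simp add: w_def)
      have yw: "norm y \<le> sqrt w" unfolding w_def by (intro real_le_rsqrt) auto
      have sw: "sqrt w * sqrt w = w" using w by simp
      have "norm (y v* \<sigma> y) \<le> norm y * norm (\<sigma> y)" by (rule norm_vector_matrix_le)
      also have "\<dots> \<le> sqrt w * (\<kappa> * sqrt w)"
        using yw growth[of y] w by (intro mult_mono) (auto simp: w_def)
      also have "\<dots> = \<kappa> * w" using sw by (simp add: ac_simps)
      finally have gn: "norm (y v* \<sigma> y) \<le> \<kappa> * w" .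
      have "norm ((c / w) *\<^sub>R (y v* \<sigma> y)) = c / w * norm (y v* \<sigma> y)" using c w by simp
      also have "\<dots> \<le> c / w * (\<kappa> * w)" using c w gn by (intro mult_left_mono) auto
      also have "\<dots> = c * \<kappa>" using w by simp
      also have "\<dots> \<le> G" unfolding G_def using c \<kappa> by (intro mult_right_mono) auto
      finally show "norm ((c / (1 + (norm y)\<^sup>2)) *\<^sub>R (y v* \<sigma> y)) \<le> G" by (simp only: w_def)
    next
      fix y y' :: "real ^ 'n" and z :: "real ^ 'm"
      assume step: "y' = y + \<tau> *\<^sub>R b y' + \<sigma> y *v z"
      define w where "w = 1 + (norm y)\<^sup>2"
      define w' where "w' = 1 + (norm y')\<^sup>2"
      define \<xi> where "\<xi> = \<sigma> y *v z"
      define d where "d = norm z"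
      define e where "e = (K * \<tau> + (norm \<xi>)\<^sup>2) / w"
      \<comment> \<open>The relative change of the base 1 + |y|^2 before amplification: a part
        linear in the noise and the nonnegative part e of order \<tau> + d^2.\<close>
      define x where "x = 2 * (y \<bullet> \<xi>) / w + e"
      define X where "X = K * \<tau> + 2 * \<kappa> * d + \<kappa>\<^sup>2 * d\<^sup>2"
      have d: "0 \<le> d" by (simp add: d_def)
      have w: "1 \<le> w" by (simp add: w_def)
      have w': "1 \<le> w'" by (simp add: w'_def)
      have yw: "norm y \<le> sqrt w" unfolding w_def by (intro real_le_rsqrt) auto
      have sw: "sqrt w * sqrt w = w" using w by simp
      have \<xi>: "norm \<xi> \<le> \<kappa> * sqrt w * d"
        unfolding \<xi>_def d_def w_def
        by (rule order_trans[OF norm_matrix_vector_le mult_right_mono[OF growth]]) simp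
      have \<xi>2: "(norm \<xi>)\<^sup>2 \<le> \<kappa>\<^sup>2 * d\<^sup>2 * w"
      proof -
        have "(norm \<xi>)\<^sup>2 \<le> (\<kappa> * sqrt w * d)\<^sup>2" using \<xi> by (intro power_mono) auto
        also have "\<dots> = \<kappa>\<^sup>2 * d\<^sup>2 * w" using w by (simp add: power_mult_distrib)
        finally show ?thesis .
      qed
      have yx: "\<bar>y \<bullet> \<xi>\<bar> \<le> \<kappa> * d * w"
      proof -
        have "\<bar>y \<bullet> \<xi>\<bar> \<le> norm y * norm \<xi>" by (rule Cauchy_Schwarz_ineq2)
        also have "\<dots> \<le> sqrt w * (\<kappa> * sqrt w * d)"
          using yw \<xi> w by (intro mult_mono) auto
        also have "\<dots> = \<kappa> * d * (sqrt w * sqrt w)" by (simp only: ac_simps)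
        finally show ?thesis using sw by simp
      qed
      have e: "0 \<le> e" "e \<le> K * \<tau> + \<kappa>\<^sup>2 * d\<^sup>2"
      proof -
        show "0 \<le> e" using K \<tau> w by (simp add: e_def)
        have "K * \<tau> * 1 \<le> K * \<tau> * w" using K \<tau> w by (intro mult_left_mono) auto
        then have "K * \<tau> + (norm \<xi>)\<^sup>2 \<le> (K * \<tau> + \<kappa>\<^sup>2 * d\<^sup>2) * w"
          using \<xi>2 by (simp add: algebra_simps)
        then show "e \<le> K * \<tau> + \<kappa>\<^sup>2 * d\<^sup>2" using w by (simp add: e_def divide_le_eq)
      qed
      have xX: "\<bar>x\<bar> \<le> X"
      proof -
        have "\<bar>2 * (y \<bullet> \<xi>) / w\<bar> \<le> 2 * \<kappa> * d"
          using yx w by (simp add: abs_divide abs_mult divide_le_eq)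
        then show ?thesis unfolding x_def X_def using e by linarith
      qed
      \<comment> \<open>With this choice of x the right-hand side of the energy estimate, plus 1,
        equals w (1 + x). Being nonnegative it also yields x \<ge> -1, as the expansion of the power
        requires.\<close>
      have wx: "w * (1 + x) = 1 + (norm (y + \<xi>))\<^sup>2 + \<tau> * K"
      proof -
        have "w * (1 + x) = w + 2 * (y \<bullet> \<xi>) + (K * \<tau> + (norm \<xi>)\<^sup>2)"
          using w by (simp add: x_def e_def field_simps)
        moreover have "(norm (y + \<xi>))\<^sup>2 = (norm y)\<^sup>2 + 2 * (y \<bullet> \<xi>) + (norm \<xi>)\<^sup>2"
          by (simp add: power2_norm_eq_inner inner_add_left inner_add_right inner_commute)
        ultimately show ?thesis by (simp add: w_def)
      qed
      have x1: "-1 \<le> x"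
      proof -
        have "0 \<le> w * (1 + x)" unfolding wx using K \<tau> by simp
        then show ?thesis using w by (simp add: zero_le_mult_iff)
      qed
      have "q * (norm y')\<^sup>2 \<le> (norm (y + \<xi>))\<^sup>2 + \<tau> * K"
        unfolding q_def K_def
        by (rule implicit_step_energy[OF onesided \<epsilon>]) (use \<tau> step in \<open>auto simp: \<xi>_def algebra_simps\<close>)
      then have "q * w' \<le> w * (1 + x)" unfolding wx w'_def using q1 by (simp add: algebra_simps)
      then have "w' \<le> a * (w * (1 + x))" using q0 by (simp add: a_def field_simps)
      then have "w' powr s \<le> (a * (w * (1 + x))) powr s" using w' s by (intro powr_mono2) auto
      also have "\<dots> = w powr s * (a powr s * (1 + x) powr s)"
        using a1 w x1 by (simp add: powr_mult)
      also have "(1 + x) powr s \<le> 1 + s * x + s\<^sup>2 * (C * (\<tau> + d\<^sup>2 + d ^ (2 * (n + 2))))"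
      proof -
        \<comment> \<open>Passing to the integer exponent n makes the remainder a polynomial in
          d.\<close>
        have "(1 + \<bar>x\<bar>) powr s \<le> (1 + X) powr real n"
          using xX n s by (intro order_trans[OF powr_mono2 powr_mono]) auto
        also have "\<dots> = (1 + X) ^ n" using xX by (subst powr_realpow) auto
        finally have "x\<^sup>2 * (1 + \<bar>x\<bar>) powr s \<le> X\<^sup>2 * (1 + X) ^ n"
          using xX by (intro mult_mono) (auto simp: abs_le_square_iff[symmetric])
        also have "\<dots> \<le> C * (\<tau> + d\<^sup>2 + d ^ (2 * (n + 2)))"
          unfolding X_def using \<tau> d by (intro rem) auto
        finally have "s\<^sup>2 * (x\<^sup>2 * (1 + \<bar>x\<bar>) powr s) \<le> s\<^sup>2 * (C * (\<tau> + d\<^sup>2 + d ^ (2 * (n + 2))))"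
          by (intro mult_left_mono) auto
        then show ?thesis using powr_second_order[OF s x1] by (simp add: mult.assoc)
      qed
      also have "a powr s * (1 + s * x + s\<^sup>2 * (C * (\<tau> + d\<^sup>2 + d ^ (2 * (n + 2)))))
          = a powr s + (c / w) * (y \<bullet> \<xi>) + a powr s * (s * e + s\<^sup>2 * (C * (\<tau> + d\<^sup>2 + d ^ (2 * (n + 2)))))"
        by (simp add: c_def x_def algebra_simps)
      also have "\<dots> \<le> 1 + (c / w) * (y \<bullet> \<xi>) + B * (\<tau> + d\<^sup>2 + d ^ (2 * (n + 2)))"
      proof -
        let ?D = "\<tau> + d\<^sup>2 + d ^ (2 * (n + 2))"
        have D: "\<tau> \<le> ?D" "d\<^sup>2 \<le> ?D" "0 \<le> ?D" using \<tau> d by auto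
        have "e \<le> K * ?D + \<kappa>\<^sup>2 * ?D"
          using e(2) D K by (intro order_trans[OF e(2)] add_mono mult_left_mono) auto
        then have "s * e \<le> s * ((K + \<kappa>\<^sup>2) * ?D)" using s by (intro mult_left_mono) (auto simp: algebra_simps)
        then have "s * e + s\<^sup>2 * (C * ?D) \<le> (s * (K + \<kappa>\<^sup>2) + s\<^sup>2 * C) * ?D" by (simp add: algebra_simps)
        then have "a powr s * (s * e + s\<^sup>2 * (C * ?D)) \<le> A * ((s * (K + \<kappa>\<^sup>2) + s\<^sup>2 * C) * ?D)"
          using as A s e C D by (intro mult_mono) (auto simp del: power_Suc)
        moreover have "a powr s \<le> 1 + C1 * ?D"
          using asC D C1 by (meson add_left_mono mult_left_mono order_trans)
        ultimately show ?thesis by (simp add: B_def algebra_simps)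
      qed
      finally have main: "w' powr s \<le> w powr s * (1 + (c / w) * (y \<bullet> \<xi>) + B * (\<tau> + d\<^sup>2 + d ^ (2 * (n + 2))))"
        using w by (simp add: mult_left_mono)
      have lin: "((c / w) *\<^sub>R (y v* \<sigma> y)) \<bullet> z = (c / w) * (y \<bullet> \<xi>)"
        by (simp add: \<xi>_def dot_lmul_matrix)
      show "lyap s y' \<le> lyap s y + lyap s y * (((c / (1 + (norm y)\<^sup>2)) *\<^sub>R (y v* \<sigma> y)) \<bullet> z)
            + lyap s y * (B * (\<tau> + (norm z)\<^sup>2 + norm z ^ (2 * (n + 2))))"
        unfolding lyap_def w_def[symmetric] w'_def[symmetric] d_def[symmetric] lin
        using main by (simp only: distrib_left[of "w powr s"] mult_1_right)
    qed
  qed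
qed

section \<open>Gaussian increments and independence of the past\<close>

lemma borel_measurable_vec_nth [measurable]: "(\<lambda>x. x $ i) \<in> borel_measurable borel"
  by (intro borel_measurable_continuous_onI continuous_intros)

text \<open>The largest component carries at least the fraction 1/m of the squared norm. This
  reduces moments of the norm to those of one-dimensional normal variables.\<close>

lemma norm_even_power_le_sum:
  fixes v :: "real ^ 'm"
  shows "norm v ^ (2 * k) \<le> real CARD('m) ^ k * (\<Sum>i\<in>UNIV. (v $ i) ^ (2 * k))"
proof -
  obtain i where i: "\<And>j. (v $ j)\<^sup>2 \<le> (v $ i)\<^sup>2"
    using Max_in[of "range (\<lambda>j. (v $ j)\<^sup>2)"] Max_ge[of "range (\<lambda>j. (v $ j)\<^sup>2)"] by fastforce
  have "(norm v)\<^sup>2 = (\<Sum>j\<in>UNIV. (v $ j)\<^sup>2)"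
    by (simp add: norm_vec_def L2_set_def sum_nonneg)
  also have "\<dots> \<le> real CARD('m) * (v $ i)\<^sup>2"
    using sum_bounded_above[of UNIV "\<lambda>j. (v $ j)\<^sup>2" "(v $ i)\<^sup>2"] i by simp
  finally have "((norm v)\<^sup>2) ^ k \<le> (real CARD('m) * (v $ i)\<^sup>2) ^ k" by (intro power_mono) auto
  also have "\<dots> = real CARD('m) ^ k * (v $ i) ^ (2 * k)" by (simp add: power_mult_distrib power_mult)
  also have "(v $ i) ^ (2 * k) \<le> (\<Sum>i\<in>UNIV. (v $ i) ^ (2 * k))"
    by (intro member_le_sum) auto
  finally show ?thesis by (simp add: power_mult mult_left_mono)
qed

text \<open>Marginals of a product density: with g attached to the factor of the i-th basis vector
  the integrand is still a product over the basis, so the integral factorises, and each remaining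
  factor is a normal density of total mass 1.\<close>

lemma nn_integral_gaussian_density_component:
  fixes i :: "'m::finite" and g :: "real \<Rightarrow> ennreal"
  assumes v: "0 < v" and [measurable]: "g \<in> borel_measurable borel"
  shows "(\<integral>\<^sup>+x. gaussian_density v (x :: real ^ 'm) * g (x $ i) \<partial>lborel)
    = (\<integral>\<^sup>+x. ennreal (normal_density 0 (sqrt v) x) * g x \<partial>lborel)"
proof -
  define f :: "(real ^ 'm) \<Rightarrow> real \<Rightarrow> ennreal" where
    "f b x = ennreal (normal_density 0 (sqrt v) x) * (if b = axis i 1 then g x else 1)" for b x
  have Basis: "(Basis :: (real ^ 'm) set) = range (\<lambda>j. axis j 1)" by (auto simp: Basis_vec_def)
  have inj: "inj (\<lambda>j::'m. axis j (1::real))" by (auto simp: inj_def axis_eq_axis)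
  have eq: "gaussian_density v x * g (x $ i) = (\<Prod>b\<in>Basis. f b (x \<bullet> b))" for x :: "real ^ 'm"
  proof -
    have "(\<Prod>b\<in>Basis. f b (x \<bullet> b)) = (\<Prod>j\<in>UNIV. f (axis j 1) (x $ j))"
      unfolding Basis by (subst prod.reindex[OF inj]) (simp add: inner_axis)
    also have "\<dots> = (\<Prod>j\<in>UNIV. ennreal (normal_density 0 (sqrt v) (x $ j))) * (\<Prod>j\<in>UNIV. if j = i then g (x $ j) else 1)"
      by (simp add: f_def prod.distrib axis_eq_axis)
    also have "\<dots> = gaussian_density v x * g (x $ i)"
      by (simp add: gaussian_density_def prod_ennreal)
    finally show ?thesis ..
  qed
  have "(\<integral>\<^sup>+x. gaussian_density v (x :: real ^ 'm) * g (x $ i) \<partial>lborel)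
      = (\<Prod>b\<in>Basis. \<integral>\<^sup>+x. f (b :: real ^ 'm) x \<partial>lborel)"
    unfolding eq by (rule nn_integral_lborel_prod) (auto simp: f_def)
  also have "\<dots> = (\<Prod>j\<in>UNIV. \<integral>\<^sup>+x. f (axis j 1 :: real ^ 'm) x \<partial>lborel)"
    unfolding Basis by (subst prod.reindex[OF inj]) simp
  also have "\<dots> = (\<Prod>j\<in>UNIV. if j = i then \<integral>\<^sup>+x. ennreal (normal_density 0 (sqrt v) x) * g x \<partial>lborel else 1)"
    using v by (intro prod.cong refl) (auto simp: f_def axis_eq_axis nn_integral_eq_integral)
  finally show ?thesis by simp
qed

lemma integrable_mult_square:
  fixes f g :: "'a \<Rightarrow> real"
  assumes [measurable]: "f \<in> borel_measurable M" "g \<in> borel_measurable M"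
    and "integrable M (\<lambda>x. (f x)\<^sup>2)" "integrable M (\<lambda>x. (g x)\<^sup>2)"
  shows "integrable M (\<lambda>x. f x * g x)"
proof (rule Bochner_Integration.integrable_bound)
  show "integrable M (\<lambda>x. (f x)\<^sup>2 + (g x)\<^sup>2)" using assms by simp
  show "AE x in M. norm (f x * g x) \<le> norm ((f x)\<^sup>2 + (g x)\<^sup>2)"
  proof (intro AE_I2)
    fix x
    have "2 * \<bar>f x\<bar> * \<bar>g x\<bar> \<le> (f x)\<^sup>2 + (g x)\<^sup>2" using sum_squares_bound[of "\<bar>f x\<bar>" "\<bar>g x\<bar>"] by simp
    moreover have "0 \<le> \<bar>f x\<bar> * \<bar>g x\<bar>" by simp
    ultimately have "\<bar>f x\<bar> * \<bar>g x\<bar> \<le> (f x)\<^sup>2 + (g x)\<^sup>2" by linarith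
    then show "norm (f x * g x) \<le> norm ((f x)\<^sup>2 + (g x)\<^sup>2)"
      unfolding real_norm_def abs_mult by (rule order_trans) (rule abs_ge_self)
  qed
qed measurable

lemma integrable_add_square:
  fixes f g :: "'a \<Rightarrow> real"
  assumes [measurable]: "f \<in> borel_measurable M" "g \<in> borel_measurable M"
    and "integrable M (\<lambda>x. (f x)\<^sup>2)" "integrable M (\<lambda>x. (g x)\<^sup>2)"
  shows "integrable M (\<lambda>x. (f x + g x)\<^sup>2)"
  using assms integrable_mult_square[OF assms] by (simp add: power2_sum mult.assoc)

section \<open>Moments of Wiener increments and their independence of the past\<close>

context wiener_process
begin

lemma measurable_past: "0 \<le> t \<Longrightarrow> f \<in> measurable (F t) N \<Longrightarrow> f \<in> measurable P N"
  using filtration_subalgebra measurable_from_subalg by blast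

lemma measurable_later: "0 \<le> s \<Longrightarrow> s \<le> t \<Longrightarrow> f \<in> measurable (F s) N \<Longrightarrow> f \<in> measurable (F t) N"
  using filtration_mono measurable_from_subalg by blast

lemma space_filtration: "0 \<le> t \<Longrightarrow> space (F t) = space P"
  using filtration_subalgebra by (auto simp: subalgebra_def)

lemma wiener_measurable: "0 \<le> t \<Longrightarrow> W t \<in> borel_measurable P"
  using adapted measurable_past by blast

lemma increment_measurable: "0 \<le> s \<Longrightarrow> 0 \<le> t \<Longrightarrow> (\<lambda>\<omega>. W t \<omega> - W s \<omega>) \<in> borel_measurable P"
  using wiener_measurable by (intro borel_measurable_diff) auto

lemma increment_adapted: "0 \<le> s \<Longrightarrow> s \<le> t \<Longrightarrow> (\<lambda>\<omega>. W t \<omega> - W s \<omega>) \<in> borel_measurable (F t)"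
  using adapted measurable_later[of s t "W s"] by (intro borel_measurable_diff) auto

lemma distributed_increment_component:
  assumes st: "0 \<le> s" "s < t"
  shows "distributed P lborel (\<lambda>\<omega>. (W t \<omega> - W s \<omega>) $ i) (normal_density 0 (sqrt (t - s)))"
  unfolding distributed_def
proof (intro conjI)
  have [measurable]: "(\<lambda>\<omega>. W t \<omega> - W s \<omega>) \<in> borel_measurable P"
    using increment_measurable st by simp
  have X[measurable]: "(\<lambda>\<omega>. (W t \<omega> - W s \<omega>) $ i) \<in> borel_measurable P"
    by (rule measurable_compose[OF _ borel_measurable_vec_nth]) measurable
  show "(\<lambda>\<omega>. (W t \<omega> - W s \<omega>) $ i) \<in> measurable P lborel"
    by (subst measurable_cong_sets[OF refl sets_lborel]) (rule X)
  show "(\<lambda>x. ennreal (normal_density 0 (sqrt (t - s)) x)) \<in> borel_measurable lborel" by simp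
  show "distr P lborel (\<lambda>\<omega>. (W t \<omega> - W s \<omega>) $ i) = density lborel (\<lambda>x. ennreal (normal_density 0 (sqrt (t - s)) x))"
  proof (rule measure_eqI)
    fix A assume "A \<in> sets (distr P lborel (\<lambda>\<omega>. (W t \<omega> - W s \<omega>) $ i))"
    then have A[measurable]: "A \<in> sets borel" by simp
    have "emeasure (distr P lborel (\<lambda>\<omega>. (W t \<omega> - W s \<omega>) $ i)) A
        = (\<integral>\<^sup>+\<omega>. indicator A ((W t \<omega> - W s \<omega>) $ i) \<partial>P)"
      by (subst nn_integral_distr[symmetric, of _ P lborel "indicator A"]) (auto simp del: vector_minus_component)
    also have "\<dots> = (\<integral>\<^sup>+x. gaussian_density (t - s) x * indicator A (x $ i) \<partial>lborel)"
      by (subst distributed_nn_integral[OF increment_gaussian[OF st], of "\<lambda>x. indicator A (x $ i)"])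
        (auto intro: measurable_compose[OF borel_measurable_vec_nth])
    also have "\<dots> = (\<integral>\<^sup>+x. ennreal (normal_density 0 (sqrt (t - s)) x) * indicator A x \<partial>lborel)"
      using st by (intro nn_integral_gaussian_density_component) auto
    also have "\<dots> = emeasure (density lborel (\<lambda>x. ennreal (normal_density 0 (sqrt (t - s)) x))) A"
      by (simp add: emeasure_density)
    finally show "emeasure (distr P lborel (\<lambda>\<omega>. (W t \<omega> - W s \<omega>) $ i)) A
      = emeasure (density lborel (\<lambda>x. ennreal (normal_density 0 (sqrt (t - s)) x))) A" .
  qed simp
qed

lemma integrable_increment_component_power:
  assumes st: "0 \<le> s" "s < t"
  shows "integrable P (\<lambda>\<omega>. ((W t \<omega> - W s \<omega>) $ i) ^ k)"
  using distributed_integrable[OF distributed_increment_component[OF st], of "\<lambda>x. x ^ k" i]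
    integrable_normal_moment[of "sqrt (t - s)" 0 k] st by simp

lemma expectation_increment_component:
  assumes st: "0 \<le> s" "s < t"
  shows "expectation (\<lambda>\<omega>. (W t \<omega> - W s \<omega>) $ i) = 0"
  using distributed_integral[OF distributed_increment_component[OF st], of "\<lambda>x. x" i]
    integral_normal_moment_odd[of "sqrt (t - s)" 0 0] st by simp

lemma expectation_increment_component_even:
  assumes st: "0 \<le> s" "s < t"
  shows "expectation (\<lambda>\<omega>. ((W t \<omega> - W s \<omega>) $ i) ^ (2 * k)) = fact (2 * k) / (2 ^ k * fact k) * (t - s) ^ k"
  using distributed_integral[OF distributed_increment_component[OF st], of "\<lambda>x. x ^ (2 * k)" i]
    integral_normal_moment_even[of "sqrt (t - s)" 0 k] st by (simp add: power_divide)

text \<open>The quotient of factorials is the moment of order 2k of the standard normal law. Of the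
  powers of m, k come from comparing the norm with its components and one from summing over the
  components.\<close>

definition increment_moment :: "nat \<Rightarrow> real" where
  "increment_moment k = real CARD('m) ^ Suc k * (fact (2 * k) / (2 ^ k * fact k))"

lemma increment_moment_nonneg: "0 \<le> increment_moment k"
  by (simp add: increment_moment_def)

lemma integrable_increment_even_power:
  assumes st: "0 \<le> s" "s < t"
  shows "integrable P (\<lambda>\<omega>. norm (W t \<omega> - W s \<omega>) ^ (2 * k))"
proof (rule Bochner_Integration.integrable_bound)
  show "integrable P (\<lambda>\<omega>. real CARD('m) ^ k * (\<Sum>i\<in>UNIV. ((W t \<omega> - W s \<omega>) $ i) ^ (2 * k)))"
    using integrable_increment_component_power[OF st] by auto
  show "AE \<omega> in P. norm (norm (W t \<omega> - W s \<omega>) ^ (2 * k))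
      \<le> norm (real CARD('m) ^ k * (\<Sum>i\<in>UNIV. ((W t \<omega> - W s \<omega>) $ i) ^ (2 * k)))"
    unfolding real_norm_def abs_of_nonneg[OF zero_le_power[OF norm_ge_zero]]
    by (intro AE_I2 order_trans[OF norm_even_power_le_sum abs_ge_self])
  show "(\<lambda>\<omega>. norm (W t \<omega> - W s \<omega>) ^ (2 * k)) \<in> borel_measurable P"
    using increment_measurable[of s t] st by (intro borel_measurable_power borel_measurable_norm) auto
qed

lemma expectation_increment_even_power:
  assumes st: "0 \<le> s" "s < t"
  shows "expectation (\<lambda>\<omega>. norm (W t \<omega> - W s \<omega>) ^ (2 * k)) \<le> increment_moment k * (t - s) ^ k"
proof -
  have "expectation (\<lambda>\<omega>. norm (W t \<omega> - W s \<omega>) ^ (2 * k))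
      \<le> expectation (\<lambda>\<omega>. real CARD('m) ^ k * (\<Sum>i\<in>UNIV. ((W t \<omega> - W s \<omega>) $ i) ^ (2 * k)))"
    using integrable_increment_component_power[OF st] integrable_increment_even_power[OF st]
    by (intro integral_mono norm_even_power_le_sum) auto
  also have "\<dots> = real CARD('m) ^ k * (\<Sum>i\<in>(UNIV :: 'm set). fact (2 * k) / (2 ^ k * fact k) * (t - s) ^ k)"
    using integrable_increment_component_power[OF st] expectation_increment_component_even[OF st] by simp
  finally show ?thesis by (simp add: increment_moment_def ac_simps)
qed

text \<open>Turns independence of events into independence of random variables, so that product
  formulas for expectations become available for any h known at time s.\<close>

lemma indep_var_increment:
  assumes st: "0 \<le> s" "s < t" and h: "h \<in> measurable (F s) M" and f: "f \<in> measurable borel N"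
  shows "indep_var M h N (\<lambda>\<omega>. f (W t \<omega> - W s \<omega>))"
  unfolding indep_var_eq
proof (intro conjI indep_setI)
  have D[measurable]: "(\<lambda>\<omega>. W t \<omega> - W s \<omega>) \<in> borel_measurable P" using increment_measurable st by simp
  note f[measurable]
  show hP[measurable]: "random_variable M h" using measurable_past st h by blast
  show fD: "random_variable N (\<lambda>\<omega>. f (W t \<omega> - W s \<omega>))" by measurable
  \<comment> \<open>The preimages under a single map already form a sigma-algebra, so every
    generated event is such a preimage and \<open>increment_indep\<close> applies to it
    directly.\<close>
  have 1: "sigma_sets (space P) {h -` A \<inter> space P |A. A \<in> sets M} = {h -` A \<inter> space P |A. A \<in> sets M}"
    using sets_vimage_algebra2[of h "space P" M] measurable_space[OF hP] unfolding sets_vimage_algebra by blast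
  have 2: "sigma_sets (space P) {(\<lambda>\<omega>. f (W t \<omega> - W s \<omega>)) -` A \<inter> space P |A. A \<in> sets N}
      = {(\<lambda>\<omega>. f (W t \<omega> - W s \<omega>)) -` A \<inter> space P |A. A \<in> sets N}"
    using sets_vimage_algebra2[of "\<lambda>\<omega>. f (W t \<omega> - W s \<omega>)" "space P" N] measurable_space[OF fD]
    unfolding sets_vimage_algebra by blast
  show "sigma_sets (space P) {h -` A \<inter> space P |A. A \<in> sets M} \<subseteq> events"
    unfolding 1 using measurable_sets[OF hP] by auto
  show "sigma_sets (space P) {(\<lambda>\<omega>. f (W t \<omega> - W s \<omega>)) -` A \<inter> space P |A. A \<in> sets N} \<subseteq> events"
    unfolding 2 using measurable_sets[OF fD] by auto
  fix a c
  assume "a \<in> sigma_sets (space P) {h -` A \<inter> space P |A. A \<in> sets M}"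
    and "c \<in> sigma_sets (space P) {(\<lambda>\<omega>. f (W t \<omega> - W s \<omega>)) -` A \<inter> space P |A. A \<in> sets N}"
  then obtain A C where A: "A \<in> sets M" "a = h -` A \<inter> space P"
    and C: "C \<in> sets N" "c = (\<lambda>\<omega>. f (W t \<omega> - W s \<omega>)) -` C \<inter> space P"
    unfolding 1 2 by auto
  have "a \<in> sets (F s)"
    using measurable_sets[OF h A(1)] A(2) space_filtration[OF st(1)] by simp
  moreover have "c = (\<lambda>\<omega>. W t \<omega> - W s \<omega>) -` (f -` C) \<inter> space P" using C by auto
  moreover have "f -` C \<in> sets borel" using measurable_sets[OF f C(1)] by simp
  ultimately show "prob (a \<inter> c) = prob a * prob c"
    by (intro indep_setD[OF increment_indep[OF st]]) auto
qed

text \<open>The martingale property in tested form. Working by components, independence makes each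
  product integrable as soon as both factors are, so a first moment of h is enough.\<close>

lemma expectation_increment_inner:
  assumes st: "0 \<le> s" "s < t" and h: "h \<in> borel_measurable (F s)"
    and int: "integrable P (\<lambda>\<omega>. norm (h \<omega>))"
  shows "integrable P (\<lambda>\<omega>. h \<omega> \<bullet> (W t \<omega> - W s \<omega>))"
    and "expectation (\<lambda>\<omega>. h \<omega> \<bullet> (W t \<omega> - W s \<omega>)) = 0"
proof -
  have hP[measurable]: "h \<in> borel_measurable P" using measurable_past st h by blast
  have hi: "(\<lambda>\<omega>. h \<omega> $ i) \<in> borel_measurable (F s)" for i
    by (rule measurable_compose[OF h borel_measurable_vec_nth])
  have hint: "integrable P (\<lambda>\<omega>. h \<omega> $ i)" for i
  proof (rule Bochner_Integration.integrable_bound[OF int])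
    show "(\<lambda>\<omega>. h \<omega> $ i) \<in> borel_measurable P" by measurable
    show "AE \<omega> in P. norm (h \<omega> $ i) \<le> norm (norm (h \<omega>))"
      using component_le_norm_cart by (intro AE_I2) auto
  qed
  have ind: "indep_var borel (\<lambda>\<omega>. h \<omega> $ i) borel (\<lambda>\<omega>. (W t \<omega> - W s \<omega>) $ i)" for i
    by (rule indep_var_increment[OF st hi, where f = "\<lambda>x. x $ i"]) simp
  have Dint: "integrable P (\<lambda>\<omega>. (W t \<omega> - W s \<omega>) $ i)" for i
    using integrable_increment_component_power[OF st, of i 1] by simp
  have I: "integrable P (\<lambda>\<omega>. h \<omega> $ i * (W t \<omega> - W s \<omega>) $ i)" for i
    by (rule indep_var_integrable[OF ind hint Dint])
  have E: "expectation (\<lambda>\<omega>. h \<omega> $ i * (W t \<omega> - W s \<omega>) $ i) = 0" for i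
    using indep_var_lebesgue_integral[OF ind hint Dint, of i] expectation_increment_component[OF st] by simp
  have eq: "h \<omega> \<bullet> (W t \<omega> - W s \<omega>) = (\<Sum>i\<in>UNIV. h \<omega> $ i * (W t \<omega> - W s \<omega>) $ i)" for \<omega>
    by (simp add: inner_vec_def)
  show "integrable P (\<lambda>\<omega>. h \<omega> \<bullet> (W t \<omega> - W s \<omega>))" unfolding eq using I by auto
  show "expectation (\<lambda>\<omega>. h \<omega> \<bullet> (W t \<omega> - W s \<omega>)) = 0"
    unfolding eq using I E by (simp add: Bochner_Integration.integral_sum)
qed

lemma expectation_past_mult_increment:
  fixes f :: "real ^ 'm \<Rightarrow> real"
  assumes st: "0 \<le> s" "s < t" and h: "h \<in> borel_measurable (F s)" "integrable P h"
    and f: "f \<in> borel_measurable borel" "integrable P (\<lambda>\<omega>. f (W t \<omega> - W s \<omega>))"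
  shows "integrable P (\<lambda>\<omega>. h \<omega> * f (W t \<omega> - W s \<omega>))"
    and "expectation (\<lambda>\<omega>. h \<omega> * f (W t \<omega> - W s \<omega>)) = expectation h * expectation (\<lambda>\<omega>. f (W t \<omega> - W s \<omega>))"
  using indep_var_integrable[OF indep_var_increment[OF st h(1) f(1)] h(2) f(2)]
    indep_var_lebesgue_integral[OF indep_var_increment[OF st h(1) f(1)] h(2) f(2)] .

end

section \<open>Doob's and Gronwall's inequalities\<close>

text \<open>Recursion on the index, rather than a maximum over a finite set, lets measurability and
  the stochastic integral below be treated by induction.\<close>

primrec running_max :: "(nat \<Rightarrow> real) \<Rightarrow> nat \<Rightarrow> real" where
  "running_max x 0 = x 0"
| "running_max x (Suc n) = max (running_max x n) (x (Suc n))"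

lemma running_max_ge: "k \<le> n \<Longrightarrow> x k \<le> running_max x n"
  by (induction n) (auto simp: le_Suc_eq max_def)

lemma running_max_le: "(\<And>k. k \<le> n \<Longrightarrow> x k \<le> c) \<Longrightarrow> running_max x n \<le> c"
  by (induction n) auto

lemma borel_measurable_running_max:
  assumes "\<And>k. k \<le> n \<Longrightarrow> X k \<in> borel_measurable M"
  shows "(\<lambda>\<omega>. running_max (\<lambda>k. X k \<omega>) n) \<in> borel_measurable M"
  using assms by (induction n) auto

lemma integrable_running_max_square:
  assumes "\<And>k. k \<le> n \<Longrightarrow> X k \<in> borel_measurable M" "\<And>k. k \<le> n \<Longrightarrow> integrable M (\<lambda>\<omega>. (X k \<omega>)\<^sup>2)"
  shows "integrable M (\<lambda>\<omega>. (running_max (\<lambda>k. X k \<omega>) n)\<^sup>2)"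
  using assms
proof (induction n)
  case (Suc n)
  have m: "(\<lambda>\<omega>. running_max (\<lambda>k. X k \<omega>) n) \<in> borel_measurable M"
    using Suc.prems(1) by (intro borel_measurable_running_max) auto
  show ?case
  proof (rule Bochner_Integration.integrable_bound)
    show "integrable M (\<lambda>\<omega>. (running_max (\<lambda>k. X k \<omega>) n)\<^sup>2 + (X (Suc n) \<omega>)\<^sup>2)" using Suc by auto
    show "(\<lambda>\<omega>. (running_max (\<lambda>k. X k \<omega>) (Suc n))\<^sup>2) \<in> borel_measurable M"
      using Suc.prems(1)[of "Suc n"] m by simp
    show "AE \<omega> in M. norm ((running_max (\<lambda>k. X k \<omega>) (Suc n))\<^sup>2)
        \<le> norm ((running_max (\<lambda>k. X k \<omega>) n)\<^sup>2 + (X (Suc n) \<omega>)\<^sup>2)"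
      by (intro AE_I2) (auto simp: max_def)
  qed
qed simp

text \<open>Pathwise form of Doob's maximal inequality: the left-hand side is a discrete stochastic
  integral, whose expectation is non-negative for a submartingale.\<close>

lemma running_max_stochastic_integral:
  "(\<Sum>i<n. running_max x i * (x (Suc i) - x i)) \<le> running_max x n * x n - (running_max x n)\<^sup>2 / 2"
proof (induction n)
  case 0
  then show ?case by (simp add: power2_eq_square)
next
  case (Suc n)
  let ?S = "running_max x n" and ?y = "x (Suc n)"
  \<comment> \<open>As a function of s, the expression s y - s^2 / 2 increases up to s = y, so
    replacing the old maximum by the new one can only enlarge it.\<close>
  have "?S * ?y - ?S\<^sup>2 / 2 \<le> max ?S ?y * ?y - (max ?S ?y)\<^sup>2 / 2"
  proof (cases "?y \<le> ?S")
    case False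
    have "0 \<le> (?S - ?y)\<^sup>2" by simp
    then show ?thesis using False by (simp add: power2_eq_square algebra_simps max_def)
  qed (simp add: max_def)
  then show ?case using Suc by (simp add: algebra_simps)
qed

text \<open>The hypothesis \<open>sub\<close> is the only trace of the submartingale property: the
  increments, tested against the running maximum, have nonnegative expectation. Summed, it says that
  E (S X - S^2 / 2) is nonnegative for the final maximum S and the final value X.\<close>

lemma doob_L2:
  fixes X :: "nat \<Rightarrow> 'a \<Rightarrow> real"
  assumes meas: "\<And>k. k \<le> n \<Longrightarrow> X k \<in> borel_measurable M"
    and sq: "\<And>k. k \<le> n \<Longrightarrow> integrable M (\<lambda>\<omega>. (X k \<omega>)\<^sup>2)"
    and sub: "\<And>i. i < n \<Longrightarrow> 0 \<le> (\<integral>\<omega>. running_max (\<lambda>k. X k \<omega>) i * (X (Suc i) \<omega> - X i \<omega>) \<partial>M)"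
  shows "(\<integral>\<omega>. (running_max (\<lambda>k. X k \<omega>) n)\<^sup>2 \<partial>M) \<le> 4 * (\<integral>\<omega>. (X n \<omega>)\<^sup>2 \<partial>M)"
proof -
  let ?S = "\<lambda>i \<omega>. running_max (\<lambda>k. X k \<omega>) i"
  have mS: "?S i \<in> borel_measurable M" if "i \<le> n" for i
    using meas that by (intro borel_measurable_running_max) auto
  have sqS: "integrable M (\<lambda>\<omega>. (?S i \<omega>)\<^sup>2)" if "i \<le> n" for i
    using meas sq that by (intro integrable_running_max_square) auto
  have SX: "integrable M (\<lambda>\<omega>. ?S i \<omega> * X j \<omega>)" if "i \<le> n" "j \<le> n" for i j
    using meas mS sq sqS that by (intro integrable_mult_square) auto
  have int: "integrable M (\<lambda>\<omega>. ?S i \<omega> * (X (Suc i) \<omega> - X i \<omega>))" if "i < n" for i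
    using SX[of i "Suc i"] SX[of i i] that by (simp add: right_diff_distrib)
  have "0 \<le> (\<Sum>i<n. \<integral>\<omega>. ?S i \<omega> * (X (Suc i) \<omega> - X i \<omega>) \<partial>M)"
    using sub by (intro sum_nonneg) auto
  also have "\<dots> = (\<integral>\<omega>. (\<Sum>i<n. ?S i \<omega> * (X (Suc i) \<omega> - X i \<omega>)) \<partial>M)"
    using int by (subst Bochner_Integration.integral_sum) auto
  also have "\<dots> \<le> (\<integral>\<omega>. ?S n \<omega> * X n \<omega> - (?S n \<omega>)\<^sup>2 / 2 \<partial>M)"
    using int SX[of n n] sqS[of n] running_max_stochastic_integral
    by (intro integral_mono Bochner_Integration.integrable_sum Bochner_Integration.integrable_diff) auto
  also have "\<dots> \<le> (\<integral>\<omega>. (X n \<omega>)\<^sup>2 - (?S n \<omega>)\<^sup>2 / 4 \<partial>M)"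
  proof (intro integral_mono)
    fix \<omega>
    \<comment> \<open>Young's inequality with the weight that leaves S^2 / 4; this is the origin of
      the factor 4.\<close>
    have "0 \<le> (?S n \<omega> / 2 - X n \<omega>)\<^sup>2" by simp
    then show "?S n \<omega> * X n \<omega> - (?S n \<omega>)\<^sup>2 / 2 \<le> (X n \<omega>)\<^sup>2 - (?S n \<omega>)\<^sup>2 / 4"
      by (simp add: power2_diff power_divide algebra_simps)
  qed (use SX[of n n] sqS[of n] sq[of n] in auto)
  also have "\<dots> = (\<integral>\<omega>. (X n \<omega>)\<^sup>2 \<partial>M) - (\<integral>\<omega>. (?S n \<omega>)\<^sup>2 \<partial>M) / 4"
    using sqS[of n] sq[of n] by simp
  finally show ?thesis by simp
qed

lemma discrete_gronwall:
  fixes A :: "nat \<Rightarrow> real"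
  assumes bound: "\<And>k. k \<le> n \<Longrightarrow> A k \<le> \<alpha> + \<beta> * (\<Sum>i<k. A i)" and "0 \<le> \<beta>" and "k \<le> n"
  shows "A k \<le> \<alpha> * (1 + \<beta>) ^ k"
proof -
  \<comment> \<open>The induction runs on the right-hand side of the hypothesis, which grows by a
    factor of at most 1 + \<beta> per step.\<close>
  have sum: "\<alpha> + \<beta> * (\<Sum>i<k. A i) \<le> \<alpha> * (1 + \<beta>) ^ k" if "k \<le> n" for k
    using that
  proof (induction k)
    case (Suc k)
    have "\<alpha> + \<beta> * (\<Sum>i<Suc k. A i) \<le> (1 + \<beta>) * (\<alpha> + \<beta> * (\<Sum>i<k. A i))"
      using mult_left_mono[OF bound[of k], of \<beta>] Suc.prems \<open>0 \<le> \<beta>\<close> by (simp add: algebra_simps)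
    also have "\<dots> \<le> (1 + \<beta>) * (\<alpha> * (1 + \<beta>) ^ k)"
      using Suc \<open>0 \<le> \<beta>\<close> by (intro mult_left_mono) auto
    finally show ?case by (simp add: ac_simps)
  qed simp
  show ?thesis using bound[OF \<open>k \<le> n\<close>] sum[OF \<open>k \<le> n\<close>] by simp
qed

section \<open>Moments under multiplicative noise\<close>

text \<open>The probabilistic core, detached from the scheme. The orders in \<tau> are balanced:
  orthogonality lets the martingale part pay O(\<tau>) per step in second moment, whereas the
  remainder is summed by Cauchy-Schwarz at the cost of a factor k \<le> M and hence needs
  O(\<tau>^2).\<close>

lemma (in wiener_process) multiplicative_noise_bound:
  fixes u :: "nat \<Rightarrow> 'w \<Rightarrow> real" and g :: "nat \<Rightarrow> 'w \<Rightarrow> real ^ 'm" and \<phi> :: "real ^ 'm \<Rightarrow> real"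
    and T :: real and M :: nat
  defines "D \<equiv> \<lambda>k \<omega>. W (grid T M (Suc k)) \<omega> - W (grid T M k) \<omega>"
  assumes T: "0 < T" and M: "0 < M"
    and u_meas: "\<And>k. k \<le> M \<Longrightarrow> u k \<in> borel_measurable (F (grid T M k))"
    and g_meas: "\<And>k. k < M \<Longrightarrow> g k \<in> borel_measurable (F (grid T M k))"
    and u_nonneg: "\<And>k \<omega>. 0 \<le> u k \<omega>"
    and g_bound: "\<And>k \<omega>. norm (g k \<omega>) \<le> G"
    and \<phi>: "\<phi> \<in> borel_measurable borel" "\<And>z. 0 \<le> \<phi> z"
    and \<phi>_int: "\<And>k. k < M \<Longrightarrow> integrable P (\<lambda>\<omega>. (\<phi> (D k \<omega>))\<^sup>2)"
    and \<phi>_sq: "\<And>k. k < M \<Longrightarrow> expectation (\<lambda>\<omega>. (\<phi> (D k \<omega>))\<^sup>2) \<le> V * (T / real M)\<^sup>2"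
    and step: "\<And>k. k < M \<Longrightarrow>
      AE \<omega> in P. u (Suc k) \<omega> \<le> u k \<omega> + u k \<omega> * (g k \<omega> \<bullet> D k \<omega>) + u k \<omega> * \<phi> (D k \<omega>)"
    and u0: "integrable P (\<lambda>\<omega>. (u 0 \<omega>)\<^sup>2)"
  shows "\<And>k. k \<le> M \<Longrightarrow> integrable P (\<lambda>\<omega>. (u k \<omega>)\<^sup>2)"
    and "expectation (\<lambda>\<omega>. (running_max (\<lambda>k. u k \<omega>) M)\<^sup>2)
      \<le> 3 * expectation (\<lambda>\<omega>. (u 0 \<omega>)\<^sup>2) * exp (T * (12 * G\<^sup>2 * increment_moment 1 + 3 * T * V))"
proof -
  define \<tau> where "\<tau> = T / real M"
  have \<tau>: "0 < \<tau>" using T M by (simp add: \<tau>_def)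
  have G: "0 \<le> G" using g_bound norm_ge_zero order_trans by blast
  have V: "0 \<le> V"
  proof -
    have "0 \<le> expectation (\<lambda>\<omega>. (\<phi> (D 0 \<omega>))\<^sup>2)" by simp
    also have "\<dots> \<le> V * \<tau>\<^sup>2" using \<phi>_sq[of 0] M by (simp add: \<tau>_def)
    finally show ?thesis using \<tau> by (simp add: zero_le_mult_iff)
  qed
  have grid: "0 \<le> grid T M k" "grid T M k < grid T M (Suc k)" for k
    using T M by (auto simp: grid_def intro!: divide_strict_right_mono)
  have grid_mono: "grid T M j \<le> grid T M k" if "j \<le> k" for j k
    using T M that by (auto simp: grid_def intro!: divide_right_mono mult_right_mono)
  have dt: "grid T M (Suc k) - grid T M k = \<tau>" for k by (simp add: grid_def \<tau>_def add_divide_distrib algebra_simps)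
  have D_meas: "D k \<in> borel_measurable (F (grid T M (Suc k)))" for k
    unfolding D_def using grid by (intro increment_adapted) (auto intro: less_imp_le)
  have lift: "f \<in> borel_measurable (F (grid T M k))"
    if "f \<in> borel_measurable (F (grid T M j))" "j \<le> k" for f :: "'w \<Rightarrow> 'c::topological_space" and j k
    using measurable_later[OF grid(1) grid_mono[OF that(2)] that(1)] .
  have toP: "f \<in> borel_measurable P"
    if "f \<in> borel_measurable (F (grid T M j))" for f :: "'w \<Rightarrow> 'c::topological_space" and j
    using measurable_past[OF grid(1) that] .
  have uP[measurable]: "u k \<in> borel_measurable P" if "k \<le> M" for k using u_meas that toP by blast
  have gP[measurable]: "g k \<in> borel_measurable P" if "k < M" for k using g_meas that toP by blast
  have DP[measurable]: "D k \<in> borel_measurable P" for k using D_meas toP by blast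
  note \<phi>(1)[measurable]
  have D2: "integrable P (\<lambda>\<omega>. (norm (D k \<omega>))\<^sup>2)" for k
    unfolding D_def using integrable_increment_even_power[OF grid, of k 1] by simp
  have ED2: "expectation (\<lambda>\<omega>. (norm (D k \<omega>))\<^sup>2) \<le> increment_moment 1 * \<tau>" for k
    unfolding D_def using expectation_increment_even_power[OF grid, of k 1] by (simp add: dt)
  have past: "integrable P (\<lambda>\<omega>. h \<omega> * \<psi> (D k \<omega>))"
      "expectation (\<lambda>\<omega>. h \<omega> * \<psi> (D k \<omega>)) = expectation h * expectation (\<lambda>\<omega>. \<psi> (D k \<omega>))"
    if "h \<in> borel_measurable (F (grid T M k))" "integrable P h"
      "\<psi> \<in> borel_measurable borel" "integrable P (\<lambda>\<omega>. \<psi> (D k \<omega>))" for h k and \<psi> :: "real ^ 'm \<Rightarrow> real"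
    using expectation_past_mult_increment[OF grid that(1,2,3)] that(4) unfolding D_def by auto
  have noise: "\<bar>g k \<omega> \<bullet> D k \<omega>\<bar> \<le> G * norm (D k \<omega>)" for k \<omega>
    using Cauchy_Schwarz_ineq2[of "g k \<omega>" "D k \<omega>"] mult_right_mono[OF g_bound[of k \<omega>], of "norm (D k \<omega>)"]
    by simp
  have noise2: "(g k \<omega> \<bullet> D k \<omega>)\<^sup>2 \<le> G\<^sup>2 * (norm (D k \<omega>))\<^sup>2" for k \<omega>
    using power_mono[OF noise abs_ge_zero, of k \<omega> 2] by (simp add: power_mult_distrib)

  \<comment> \<open>Qualitative integrability first, by induction: the square of the next value is
    at most the square of the present one times a function of an independent increment. Without it
    the Gronwall argument could not be started; the resulting bounds are not uniform in M.\<close>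
  have uint: "integrable P (\<lambda>\<omega>. (u k \<omega>)\<^sup>2)" if "k \<le> M" for k
    using that
  proof (induction k)
    case (Suc k)
    then have k: "k < M" and IH: "integrable P (\<lambda>\<omega>. (u k \<omega>)\<^sup>2)" by auto
    let ?f = "\<lambda>z. 3 * (1 + G\<^sup>2 * (norm z)\<^sup>2 + (\<phi> z)\<^sup>2)"
    have u2: "(\<lambda>\<omega>. (u k \<omega>)\<^sup>2) \<in> borel_measurable (F (grid T M k))" using u_meas[of k] k by simp
    have dom: "integrable P (\<lambda>\<omega>. (u k \<omega>)\<^sup>2 * ?f (D k \<omega>))"
      using D2 \<phi>_int[OF k] by (intro past(1)[OF u2 IH]) auto
    show ?case
    proof (rule Bochner_Integration.integrable_bound[OF dom])
      show "(\<lambda>\<omega>. (u (Suc k) \<omega>)\<^sup>2) \<in> borel_measurable P" using Suc.prems by measurable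
      show "AE \<omega> in P. norm ((u (Suc k) \<omega>)\<^sup>2) \<le> norm ((u k \<omega>)\<^sup>2 * ?f (D k \<omega>))"
        using step[OF k]
      proof eventually_elim
        case (elim \<omega>)
        let ?x = "g k \<omega> \<bullet> D k \<omega>" and ?y = "\<phi> (D k \<omega>)"
        have "u (Suc k) \<omega> \<le> u k \<omega> * (1 + ?x + ?y)" using elim by (simp add: algebra_simps)
        then have "(u (Suc k) \<omega>)\<^sup>2 \<le> (u k \<omega> * (1 + ?x + ?y))\<^sup>2" using u_nonneg by (intro power_mono) auto
        also have "\<dots> = (u k \<omega>)\<^sup>2 * (1 + ?x + ?y)\<^sup>2" by (rule power_mult_distrib)
        also have "(1 + ?x + ?y)\<^sup>2 \<le> 3 * (1 + ?x\<^sup>2 + ?y\<^sup>2)"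
          using sum_squares_bound[of 1 ?x] sum_squares_bound[of 1 ?y] sum_squares_bound[of ?x ?y]
          by (simp add: power2_eq_square algebra_simps)
        also have "\<dots> \<le> ?f (D k \<omega>)" using noise2[of k \<omega>] by simp
        finally have "(u (Suc k) \<omega>)\<^sup>2 \<le> (u k \<omega>)\<^sup>2 * ?f (D k \<omega>)" by (simp add: mult_left_mono)
        then show ?case by (simp add: abs_mult)
      qed
    qed
  qed (use u0 in simp)
  then show "\<And>k. k \<le> M \<Longrightarrow> integrable P (\<lambda>\<omega>. (u k \<omega>)\<^sup>2)" .

  define m where "m k \<omega> = u k \<omega> * (g k \<omega> \<bullet> D k \<omega>)" for k \<omega>
  define N where "N k \<omega> = (\<Sum>i<k. m i \<omega>)" for k \<omega>
  have m_meas: "m k \<in> borel_measurable (F (grid T M (Suc k)))" if "k < M" for k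
    unfolding m_def using lift[OF u_meas, of k "Suc k"] lift[OF g_meas, of k "Suc k"] D_meas[of k] that
    by (intro borel_measurable_times borel_measurable_inner) auto
  have N_meas: "N k \<in> borel_measurable (F (grid T M k))" if "k \<le> M" for k
    unfolding N_def
  proof (intro borel_measurable_sum)
    fix i assume "i \<in> {..<k}"
    then show "m i \<in> borel_measurable (F (grid T M k))"
      using that by (intro lift[OF m_meas]) auto
  qed
  have mP[measurable]: "m k \<in> borel_measurable P" if "k < M" for k using m_meas that toP by blast
  have NP[measurable]: "N k \<in> borel_measurable P" if "k \<le> M" for k using N_meas that toP by blast
  have m2: "integrable P (\<lambda>\<omega>. (m k \<omega>)\<^sup>2)"
    "expectation (\<lambda>\<omega>. (m k \<omega>)\<^sup>2) \<le> G\<^sup>2 * increment_moment 1 * \<tau> * expectation (\<lambda>\<omega>. (u k \<omega>)\<^sup>2)" if k: "k < M" for k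
  proof -
    have u2: "(\<lambda>\<omega>. (u k \<omega>)\<^sup>2) \<in> borel_measurable (F (grid T M k))" using u_meas[of k] k by simp
    have dom: "integrable P (\<lambda>\<omega>. (u k \<omega>)\<^sup>2 * (G\<^sup>2 * (norm (D k \<omega>))\<^sup>2))"
      "expectation (\<lambda>\<omega>. (u k \<omega>)\<^sup>2 * (G\<^sup>2 * (norm (D k \<omega>))\<^sup>2))
        = expectation (\<lambda>\<omega>. (u k \<omega>)\<^sup>2) * expectation (\<lambda>\<omega>. G\<^sup>2 * (norm (D k \<omega>))\<^sup>2)"
      using D2[of k] uint[of k] k by (intro past(1)[OF u2] past(2)[OF u2]; simp)+
    have le: "(m k \<omega>)\<^sup>2 \<le> (u k \<omega>)\<^sup>2 * (G\<^sup>2 * (norm (D k \<omega>))\<^sup>2)" for \<omega>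
      unfolding m_def power_mult_distrib by (intro mult_left_mono noise2) auto
    show int: "integrable P (\<lambda>\<omega>. (m k \<omega>)\<^sup>2)"
    proof (rule Bochner_Integration.integrable_bound[OF dom(1)])
      show "(\<lambda>\<omega>. (m k \<omega>)\<^sup>2) \<in> borel_measurable P" using k by measurable
      show "AE \<omega> in P. norm ((m k \<omega>)\<^sup>2) \<le> norm ((u k \<omega>)\<^sup>2 * (G\<^sup>2 * (norm (D k \<omega>))\<^sup>2))"
        using le by (intro AE_I2) (simp add: abs_mult)
    qed
    have "expectation (\<lambda>\<omega>. (m k \<omega>)\<^sup>2) \<le> expectation (\<lambda>\<omega>. (u k \<omega>)\<^sup>2 * (G\<^sup>2 * (norm (D k \<omega>))\<^sup>2))"
      by (intro integral_mono int dom(1) le)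
    also have "\<dots> = expectation (\<lambda>\<omega>. (u k \<omega>)\<^sup>2) * (G\<^sup>2 * expectation (\<lambda>\<omega>. (norm (D k \<omega>))\<^sup>2))"
      by (simp add: dom(2))
    also have "\<dots> \<le> expectation (\<lambda>\<omega>. (u k \<omega>)\<^sup>2) * (G\<^sup>2 * (increment_moment 1 * \<tau>))"
      using ED2[of k] by (intro mult_left_mono) auto
    finally show "expectation (\<lambda>\<omega>. (m k \<omega>)\<^sup>2) \<le> G\<^sup>2 * increment_moment 1 * \<tau> * expectation (\<lambda>\<omega>. (u k \<omega>)\<^sup>2)"
      by (simp add: ac_simps)
  qed
  have N2: "integrable P (\<lambda>\<omega>. (N k \<omega>)\<^sup>2)" if "k \<le> M" for k
    using that
  proof (induction k)
    case (Suc k)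
    then show ?case using integrable_add_square[of "N k" P "m k"] m2(1)[of k] by (simp add: N_def)
  qed (simp add: N_def)
  \<comment> \<open>Used twice: with h = \<open>N k\<close> for the orthogonality of increments, and
    with h = \<open>S k\<close> for the hypothesis of Doob's inequality.\<close>
  have orthogonal: "integrable P (\<lambda>\<omega>. h \<omega> * m k \<omega>)" "expectation (\<lambda>\<omega>. h \<omega> * m k \<omega>) = 0"
    if k: "k < M" and h: "h \<in> borel_measurable (F (grid T M k))" "integrable P (\<lambda>\<omega>. (h \<omega>)\<^sup>2)" for h k
  proof -
    note hP[measurable] = toP[OF h(1)]
    let ?c = "\<lambda>\<omega>. (h \<omega> * u k \<omega>) *\<^sub>R g k \<omega>"
    have hu: "integrable P (\<lambda>\<omega>. h \<omega> * u k \<omega>)"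
      using k h uint by (intro integrable_mult_square) auto
    have cm: "?c \<in> borel_measurable (F (grid T M k))"
      using h(1) u_meas[of k] g_meas[of k] k by (intro borel_measurable_scaleR borel_measurable_times) auto
    have ci: "integrable P (\<lambda>\<omega>. norm (?c \<omega>))"
    proof (rule Bochner_Integration.integrable_bound)
      show "integrable P (\<lambda>\<omega>. G * \<bar>h \<omega> * u k \<omega>\<bar>)" using hu by simp
      show "(\<lambda>\<omega>. norm (?c \<omega>)) \<in> borel_measurable P" by (rule measurable_compose[OF toP[OF cm] borel_measurable_norm])
      show "AE \<omega> in P. norm (norm (?c \<omega>)) \<le> norm (G * \<bar>h \<omega> * u k \<omega>\<bar>)"
        using g_bound G by (intro AE_I2) (simp add: abs_mult mult.commute[of G] mult_left_mono)
    qed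
    have eq: "h \<omega> * m k \<omega> = ?c \<omega> \<bullet> D k \<omega>" for \<omega> by (simp add: m_def)
    show "integrable P (\<lambda>\<omega>. h \<omega> * m k \<omega>)" "expectation (\<lambda>\<omega>. h \<omega> * m k \<omega>) = 0"
      unfolding eq using expectation_increment_inner[OF grid cm ci] unfolding D_def by auto
  qed
  have EN2: "expectation (\<lambda>\<omega>. (N k \<omega>)\<^sup>2) = (\<Sum>i<k. expectation (\<lambda>\<omega>. (m i \<omega>)\<^sup>2))" if "k \<le> M" for k
    using that
  proof (induction k)
    case (Suc k)
    have eq: "(N (Suc k) \<omega>)\<^sup>2 = (N k \<omega>)\<^sup>2 + 2 * (N k \<omega> * m k \<omega>) + (m k \<omega>)\<^sup>2" for \<omega>
      by (simp add: N_def power2_sum)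
    have "expectation (\<lambda>\<omega>. (N (Suc k) \<omega>)\<^sup>2) = expectation (\<lambda>\<omega>. (N k \<omega>)\<^sup>2) + expectation (\<lambda>\<omega>. (m k \<omega>)\<^sup>2)"
      unfolding eq using Suc.prems N2[of k] m2(1)[of k] orthogonal[of k "N k"] N_meas[of k] by simp
    then show ?case using Suc by simp
  qed (simp add: N_def)

  define S where "S k \<omega> = running_max (\<lambda>j. N j \<omega>) k" for k \<omega>
  have S_meas: "S k \<in> borel_measurable (F (grid T M k))" if "k \<le> M" for k
    unfolding S_def using N_meas that by (intro borel_measurable_running_max lift[OF N_meas]) auto
  have S2: "integrable P (\<lambda>\<omega>. (S k \<omega>)\<^sup>2)" if "k \<le> M" for k
    unfolding S_def using N2 NP that by (intro integrable_running_max_square) auto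
  have ES2: "expectation (\<lambda>\<omega>. (S k \<omega>)\<^sup>2) \<le> 4 * (\<Sum>i<k. expectation (\<lambda>\<omega>. (m i \<omega>)\<^sup>2))" if "k \<le> M" for k
    unfolding S_def EN2[OF that, symmetric]
  proof (rule doob_L2)
    fix i assume "i < k"
    then show "0 \<le> expectation (\<lambda>\<omega>. running_max (\<lambda>k. N k \<omega>) i * (N (Suc i) \<omega> - N i \<omega>))"
      using orthogonal(2)[of i "S i"] S_meas[of i] S2[of i] that by (simp add: N_def S_def)
  qed (use NP N2 that in auto)

  define R where "R k \<omega> = (\<Sum>i<k. u i \<omega> * \<phi> (D i \<omega>))" for k \<omega>
  have r2: "integrable P (\<lambda>\<omega>. (u k \<omega> * \<phi> (D k \<omega>))\<^sup>2)"
    "expectation (\<lambda>\<omega>. (u k \<omega> * \<phi> (D k \<omega>))\<^sup>2) \<le> V * \<tau>\<^sup>2 * expectation (\<lambda>\<omega>. (u k \<omega>)\<^sup>2)" if k: "k < M" for k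
  proof -
    have u2: "(\<lambda>\<omega>. (u k \<omega>)\<^sup>2) \<in> borel_measurable (F (grid T M k))" using u_meas[of k] k by simp
    have *: "integrable P (\<lambda>\<omega>. (u k \<omega>)\<^sup>2 * (\<phi> (D k \<omega>))\<^sup>2)"
      "expectation (\<lambda>\<omega>. (u k \<omega>)\<^sup>2 * (\<phi> (D k \<omega>))\<^sup>2)
        = expectation (\<lambda>\<omega>. (u k \<omega>)\<^sup>2) * expectation (\<lambda>\<omega>. (\<phi> (D k \<omega>))\<^sup>2)"
      using uint[of k] k \<phi>_int[of k] by (intro past(1)[OF u2] past(2)[OF u2]; simp)+
    show "integrable P (\<lambda>\<omega>. (u k \<omega> * \<phi> (D k \<omega>))\<^sup>2)" unfolding power_mult_distrib by (rule *(1))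
    show "expectation (\<lambda>\<omega>. (u k \<omega> * \<phi> (D k \<omega>))\<^sup>2) \<le> V * \<tau>\<^sup>2 * expectation (\<lambda>\<omega>. (u k \<omega>)\<^sup>2)"
      unfolding power_mult_distrib *(2) \<tau>_def using \<phi>_sq[OF k]
      by (subst mult.commute) (intro mult_right_mono; simp)
  qed
  \<comment> \<open>Cauchy-Schwarz over the k summands.\<close>
  have R_le: "(R k \<omega>)\<^sup>2 \<le> real k * (\<Sum>i<k. (u i \<omega> * \<phi> (D i \<omega>))\<^sup>2)" for k \<omega>
    unfolding R_def using sum_squared_le_sum_of_squares[of "\<lambda>i. u i \<omega> * \<phi> (D i \<omega>)" "{..<k}"]
    by (simp add: mult.commute)
  have R_mono: "R j \<omega> \<le> R k \<omega>" if "j \<le> k" for j k \<omega>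
    unfolding R_def using that u_nonneg \<phi>(2) by (intro sum_mono2) auto

  define A where "A k = expectation (\<lambda>\<omega>. (running_max (\<lambda>j. u j \<omega>) k)\<^sup>2)" for k
  have max_int: "integrable P (\<lambda>\<omega>. (running_max (\<lambda>j. u j \<omega>) k)\<^sup>2)" if "k \<le> M" for k
    using uint uP that by (intro integrable_running_max_square) auto
  have u_le_A: "expectation (\<lambda>\<omega>. (u k \<omega>)\<^sup>2) \<le> A k" if "k \<le> M" for k
    unfolding A_def using u_nonneg
    by (intro integral_mono uint that max_int power_mono running_max_ge) auto
  \<comment> \<open>The 3 comes from squaring a sum of three terms and 12 = 3 * 4 contains Doob's
    constant. In the last term k \<tau> \<le> T has been used.\<close>
  define \<beta> where "\<beta> = \<tau> * (12 * G\<^sup>2 * increment_moment 1 + 3 * T * V)"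
  have \<beta>: "0 \<le> \<beta>" using \<tau> V T increment_moment_nonneg by (simp add: \<beta>_def)
  have AE_step: "AE \<omega> in P. \<forall>k<M. u (Suc k) \<omega> \<le> u k \<omega> + m k \<omega> + u k \<omega> * \<phi> (D k \<omega>)"
    unfolding m_def using step by (auto simp: AE_all_countable)
  have A_bound: "A k \<le> 3 * expectation (\<lambda>\<omega>. (u 0 \<omega>)\<^sup>2) + \<beta> * (\<Sum>i<k. A i)" if k: "k \<le> M" for k
  proof -
    let ?r = "\<lambda>\<omega>. real k * (\<Sum>i<k. (u i \<omega> * \<phi> (D i \<omega>))\<^sup>2)"
    have r_int: "integrable P (\<lambda>\<omega>. (u i \<omega> * \<phi> (D i \<omega>))\<^sup>2)" if "i \<in> {..<k}" for i
      using that k by (intro r2(1)) auto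
    have r_sum: "integrable P (\<lambda>\<omega>. \<Sum>i<k. (u i \<omega> * \<phi> (D i \<omega>))\<^sup>2)"
      by (rule Bochner_Integration.integrable_sum) (rule r_int)
    have Er_sum: "expectation (\<lambda>\<omega>. \<Sum>i<k. (u i \<omega> * \<phi> (D i \<omega>))\<^sup>2)
        = (\<Sum>i<k. expectation (\<lambda>\<omega>. (u i \<omega> * \<phi> (D i \<omega>))\<^sup>2))"
      by (rule Bochner_Integration.integral_sum) (rule r_int)
    have int: "integrable P (\<lambda>\<omega>. 3 * ((u 0 \<omega>)\<^sup>2 + (S k \<omega>)\<^sup>2 + ?r \<omega>))"
      using u0 S2[OF k] r_sum by simp
    have "A k \<le> expectation (\<lambda>\<omega>. 3 * ((u 0 \<omega>)\<^sup>2 + (S k \<omega>)\<^sup>2 + ?r \<omega>))"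
      unfolding A_def
    proof (rule integral_mono_AE[OF max_int[OF k] int])
      show "AE \<omega> in P. (running_max (\<lambda>j. u j \<omega>) k)\<^sup>2 \<le> 3 * ((u 0 \<omega>)\<^sup>2 + (S k \<omega>)\<^sup>2 + ?r \<omega>)"
        using AE_step
      proof eventually_elim
        case (elim \<omega>)
        have path: "u j \<omega> \<le> u 0 \<omega> + N j \<omega> + R j \<omega>" if "j \<le> M" for j
          using that
        proof (induction j)
          case (Suc j)
          then show ?case using elim[rule_format, of j] by (simp add: N_def R_def)
        qed (simp add: N_def R_def)
        \<comment> \<open>All indices j \<le> k are bounded at once: the martingale part by its
          running maximum, the remainder by monotonicity, its terms being nonnegative.\<close>
        have "u j \<omega> \<le> u 0 \<omega> + S k \<omega> + R k \<omega>" if "j \<le> k" for j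
          using path[OF order_trans[OF that k]] R_mono[OF that, of \<omega>] running_max_ge[OF that, of "\<lambda>j. N j \<omega>"]
          unfolding S_def by linarith
        then have "running_max (\<lambda>j. u j \<omega>) k \<le> u 0 \<omega> + S k \<omega> + R k \<omega>" by (rule running_max_le)
        moreover have "0 \<le> running_max (\<lambda>j. u j \<omega>) k"
          using running_max_ge[of 0 k "\<lambda>j. u j \<omega>"] u_nonneg[of 0 \<omega>] by simp
        ultimately have "(running_max (\<lambda>j. u j \<omega>) k)\<^sup>2 \<le> (u 0 \<omega> + S k \<omega> + R k \<omega>)\<^sup>2"
          by (intro power_mono)
        also have "\<dots> \<le> 3 * ((u 0 \<omega>)\<^sup>2 + (S k \<omega>)\<^sup>2 + (R k \<omega>)\<^sup>2)"
          using sum_squares_bound[of "u 0 \<omega>" "S k \<omega>"] sum_squares_bound[of "u 0 \<omega>" "R k \<omega>"]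
            sum_squares_bound[of "S k \<omega>" "R k \<omega>"]
          by (simp add: power2_eq_square algebra_simps)
        also have "\<dots> \<le> 3 * ((u 0 \<omega>)\<^sup>2 + (S k \<omega>)\<^sup>2 + ?r \<omega>)" using R_le[of k \<omega>] by simp
        finally show ?case .
      qed
    qed
    also have "\<dots> = 3 * (expectation (\<lambda>\<omega>. (u 0 \<omega>)\<^sup>2) + expectation (\<lambda>\<omega>. (S k \<omega>)\<^sup>2)
        + real k * (\<Sum>i<k. expectation (\<lambda>\<omega>. (u i \<omega> * \<phi> (D i \<omega>))\<^sup>2)))"
      using u0 S2[OF k] r_sum by (simp add: Er_sum)
    also have "\<dots> \<le> 3 * (expectation (\<lambda>\<omega>. (u 0 \<omega>)\<^sup>2) + 4 * (\<Sum>i<k. G\<^sup>2 * increment_moment 1 * \<tau> * A i)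
        + real k * (\<Sum>i<k. V * \<tau>\<^sup>2 * A i))"
    proof (intro mult_left_mono add_mono order_refl)
      show "expectation (\<lambda>\<omega>. (S k \<omega>)\<^sup>2) \<le> 4 * (\<Sum>i<k. G\<^sup>2 * increment_moment 1 * \<tau> * A i)"
      proof (rule order_trans[OF ES2[OF k]], intro mult_left_mono sum_mono)
        fix i assume "i \<in> {..<k}"
        then show "expectation (\<lambda>\<omega>. (m i \<omega>)\<^sup>2) \<le> G\<^sup>2 * increment_moment 1 * \<tau> * A i"
          using k \<tau> by (intro order_trans[OF m2(2) mult_left_mono[OF u_le_A]]) (auto simp: increment_moment_nonneg)
      qed simp
      show "(\<Sum>i<k. expectation (\<lambda>\<omega>. (u i \<omega> * \<phi> (D i \<omega>))\<^sup>2)) \<le> (\<Sum>i<k. V * \<tau>\<^sup>2 * A i)"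
      proof (rule sum_mono)
        fix i assume "i \<in> {..<k}"
        then show "expectation (\<lambda>\<omega>. (u i \<omega> * \<phi> (D i \<omega>))\<^sup>2) \<le> V * \<tau>\<^sup>2 * A i"
          using k V by (intro order_trans[OF r2(2) mult_left_mono[OF u_le_A]]) auto
      qed
    qed auto
    also have "\<dots> = 3 * expectation (\<lambda>\<omega>. (u 0 \<omega>)\<^sup>2)
        + (12 * G\<^sup>2 * increment_moment 1 * \<tau> + 3 * (real k * \<tau>) * V * \<tau>) * (\<Sum>i<k. A i)"
      unfolding sum_distrib_left[symmetric] by (simp add: power2_eq_square algebra_simps)
    also have "\<dots> \<le> 3 * expectation (\<lambda>\<omega>. (u 0 \<omega>)\<^sup>2) + \<beta> * (\<Sum>i<k. A i)"
    proof -
      have "real k * \<tau> \<le> real M * \<tau>" using k \<tau> by (intro mult_right_mono) auto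
      then have "real k * \<tau> \<le> T" using M by (simp add: \<tau>_def)
      then have "3 * (real k * \<tau>) * V * \<tau> \<le> 3 * T * V * \<tau>"
        using V \<tau> by (intro mult_right_mono) auto
      then have "12 * G\<^sup>2 * increment_moment 1 * \<tau> + 3 * (real k * \<tau>) * V * \<tau> \<le> \<beta>"
        by (simp add: \<beta>_def algebra_simps)
      moreover have "0 \<le> (\<Sum>i<k. A i)" by (intro sum_nonneg) (simp add: A_def)
      ultimately show ?thesis by (intro add_left_mono mult_right_mono)
    qed
    finally show ?thesis .
  qed
  have "A M \<le> 3 * expectation (\<lambda>\<omega>. (u 0 \<omega>)\<^sup>2) * (1 + \<beta>) ^ M"
    using discrete_gronwall[OF A_bound \<beta> order_refl] by simp
  \<comment> \<open>Since M \<tau> = T, the M-fold compounding of 1 + \<beta> is bounded by an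
    exponential independent of M.\<close>
  also have "\<dots> \<le> 3 * expectation (\<lambda>\<omega>. (u 0 \<omega>)\<^sup>2) * exp \<beta> ^ M"
    using \<beta> by (intro mult_left_mono power_mono) auto
  also have "exp \<beta> ^ M = exp (T * (12 * G\<^sup>2 * increment_moment 1 + 3 * T * V))"
    using M by (simp add: exp_of_nat_mult[symmetric] \<beta>_def \<tau>_def)
  finally show "expectation (\<lambda>\<omega>. (running_max (\<lambda>k. u k \<omega>) M)\<^sup>2)
      \<le> 3 * expectation (\<lambda>\<omega>. (u 0 \<omega>)\<^sup>2) * exp (T * (12 * G\<^sup>2 * increment_moment 1 + 3 * T * V))"
    unfolding A_def .
qed

section \<open>Suprema of Wiener increments\<close>

lemma powr_le_one_plus_power:
  fixes x q :: real
  assumes "0 \<le> x" "0 \<le> q" "q \<le> real n"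
  shows "x powr q \<le> 1 + x ^ n"
proof (cases "x \<le> 1")
  case True
  have "x powr q \<le> 1" using assms True by (simp add: powr_le1)
  then show ?thesis using assms by (simp add: add_increasing2)
next
  case False
  then have "x powr q \<le> x powr real n" using assms by (intro powr_mono) auto
  then show ?thesis using False by (simp add: powr_realpow)
qed

text \<open>Rounding down to the partition with n + 1 cells moves v by at most one mesh width.
  Approximating from the left keeps the points between s and v, hence inside the interval on which
  continuity is used.\<close>

lemma uniform_partition_approx:
  fixes s t v :: real
  assumes "s < t" "s \<le> v" "v \<le> t"
  defines "p \<equiv> \<lambda>n. s + real (nat \<lfloor>(v - s) * real (Suc n) / (t - s)\<rfloor>) * ((t - s) / real (Suc n))"
  shows "nat \<lfloor>(v - s) * real (Suc n) / (t - s)\<rfloor> \<le> Suc n" and "s \<le> p n" "p n \<le> v" "p \<longlonglongrightarrow> v"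
proof -
  define x where "x n = (v - s) * real (Suc n) / (t - s)" for n
  have x0: "0 \<le> x n" for n using assms by (simp add: x_def)
  have x1: "x n \<le> real (Suc n)" for n
  proof -
    have "(v - s) * real (Suc n) \<le> (t - s) * real (Suc n)" using assms by (intro mult_right_mono) auto
    then show ?thesis using assms by (simp add: x_def divide_le_eq mult.commute)
  qed
  have i: "real (nat \<lfloor>x n\<rfloor>) \<le> x n" "x n - 1 \<le> real (nat \<lfloor>x n\<rfloor>)" for n
    using x0[of n] by linarith+
  show "nat \<lfloor>(v - s) * real (Suc n) / (t - s)\<rfloor> \<le> Suc n"
    using i(1)[of n] x1[of n] unfolding x_def[symmetric] by linarith
  have p: "p n = s + real (nat \<lfloor>x n\<rfloor>) * ((t - s) / real (Suc n))" for n by (simp add: p_def x_def)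
  have xs: "x n * ((t - s) / real (Suc n)) = v - s" for n using assms by (simp add: x_def)
  show "s \<le> p n" for n using assms by (simp add: p)
  have le: "p n \<le> v" for n
  proof -
    have "real (nat \<lfloor>x n\<rfloor>) * ((t - s) / real (Suc n)) \<le> x n * ((t - s) / real (Suc n))"
      using i(1)[of n] assms by (intro mult_right_mono) auto
    then show ?thesis unfolding p xs by simp
  qed
  then show "p n \<le> v" .
  have ge: "v - (t - s) / real (Suc n) \<le> p n" for n
  proof -
    have "(x n - 1) * ((t - s) / real (Suc n)) \<le> real (nat \<lfloor>x n\<rfloor>) * ((t - s) / real (Suc n))"
      using i(2)[of n] assms by (intro mult_right_mono) auto
    then show ?thesis unfolding p left_diff_distrib xs by simp
  qed
  have "(\<lambda>n. v - (t - s) / real (Suc n)) \<longlonglongrightarrow> v - 0"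
    by (intro tendsto_diff tendsto_const LIMSEQ_Suc[OF lim_const_over_n])
  then show "p \<longlonglongrightarrow> v"
    using ge le by (intro tendsto_sandwich[of "\<lambda>n. v - (t - s) / real (Suc n)" p _ "\<lambda>_. v"]) auto
qed

section \<open>Maximal inequality for weighted increments on one time interval\<close>

context wiener_process
begin

lemma integrable_increment_powr:
  assumes st: "0 \<le> s" "s < t" and q: "0 \<le> q"
  shows "integrable P (\<lambda>\<omega>. norm (W t \<omega> - W s \<omega>) powr q)"
proof (rule Bochner_Integration.integrable_bound)
  define n where "n = nat \<lceil>q\<rceil>"
  have n: "q \<le> real (2 * n)" using q unfolding n_def by linarith
  show "integrable P (\<lambda>\<omega>. 1 + norm (W t \<omega> - W s \<omega>) ^ (2 * n))"
    using integrable_increment_even_power[OF st] by simp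
  show "AE \<omega> in P. norm (norm (W t \<omega> - W s \<omega>) powr q) \<le> norm (1 + norm (W t \<omega> - W s \<omega>) ^ (2 * n))"
    using powr_le_one_plus_power[OF norm_ge_zero q n] by (intro AE_I2) (simp add: abs_of_nonneg)
  have [measurable]: "(\<lambda>\<omega>. norm (W t \<omega> - W s \<omega>)) \<in> borel_measurable P"
    using st by (intro measurable_compose[OF increment_measurable borel_measurable_norm]) auto
  show "(\<lambda>\<omega>. norm (W t \<omega> - W s \<omega>) powr q) \<in> borel_measurable P" by measurable
qed

text \<open>For 4 \<le> q \<le> 2 n the q-th power lies below the sum of the powers 4 and 2 n, and
  the fourth moment already has order (t - s)^2. Compared with the order t - s there is one power to
  spare, which later compensates for summing over all subintervals.\<close>

lemma expectation_increment_powr: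
  assumes st: "0 \<le> s" "s < t" "t - s \<le> 1" and q: "4 \<le> q" "q \<le> 2 * real n"
  shows "expectation (\<lambda>\<omega>. norm (W t \<omega> - W s \<omega>) powr q) \<le> (increment_moment 2 + increment_moment n) * (t - s)\<^sup>2"
proof -
  have n: "2 \<le> n" using q by linarith
  have le: "x powr q \<le> x ^ (2 * 2) + x ^ (2 * n)" if x: "0 \<le> x" for x :: real
  proof (cases "x = 0")
    case False
    have "x powr q = x powr 4 * x powr (q - 4)" by (simp add: powr_add[symmetric])
    also have "\<dots> \<le> x powr 4 * (1 + x ^ (2 * n - 4))"
      using x q n by (intro mult_left_mono powr_le_one_plus_power) auto
    also have "x powr 4 = x ^ 4" using x False powr_realpow[of x 4] by simp
    also have "x ^ 4 * (1 + x ^ (2 * n - 4)) = x ^ (2 * 2) + x ^ (2 * n)"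
      using n by (simp add: distrib_left power_add[symmetric] del: power_Suc)
    finally show ?thesis .
  qed (use q in simp)
  have "expectation (\<lambda>\<omega>. norm (W t \<omega> - W s \<omega>) powr q)
      \<le> expectation (\<lambda>\<omega>. norm (W t \<omega> - W s \<omega>) ^ (2 * 2) + norm (W t \<omega> - W s \<omega>) ^ (2 * n))"
    using q by (intro integral_mono le Bochner_Integration.integrable_add integrable_increment_powr
        integrable_increment_even_power st) auto
  also have "\<dots> = expectation (\<lambda>\<omega>. norm (W t \<omega> - W s \<omega>) ^ (2 * 2))
      + expectation (\<lambda>\<omega>. norm (W t \<omega> - W s \<omega>) ^ (2 * n))"
    by (intro Bochner_Integration.integral_add integrable_increment_even_power st)
  also have "\<dots> \<le> increment_moment 2 * (t - s)\<^sup>2 + increment_moment n * (t - s) ^ n"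
    by (intro add_mono expectation_increment_even_power st)
  also have "\<dots> \<le> increment_moment 2 * (t - s)\<^sup>2 + increment_moment n * (t - s)\<^sup>2"
    using st n by (intro add_mono mult_left_mono power_decreasing) (auto simp: increment_moment_nonneg)
  finally show ?thesis by (simp add: algebra_simps)
qed

lemma weighted_increment_square:
  assumes st: "0 \<le> s" "s < t" and q: "0 \<le> q"
    and h: "h \<in> borel_measurable (F s)" "integrable P (\<lambda>\<omega>. (h \<omega>)\<^sup>2)"
  shows "integrable P (\<lambda>\<omega>. (h \<omega> * norm (W t \<omega> - W s \<omega>) powr q)\<^sup>2)"
    and "expectation (\<lambda>\<omega>. (h \<omega> * norm (W t \<omega> - W s \<omega>) powr q)\<^sup>2)
      = expectation (\<lambda>\<omega>. (h \<omega>)\<^sup>2) * expectation (\<lambda>\<omega>. norm (W t \<omega> - W s \<omega>) powr (2 * q))"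
proof -
  have eq: "(h \<omega> * norm (W t \<omega> - W s \<omega>) powr q)\<^sup>2 = (h \<omega>)\<^sup>2 * norm (W t \<omega> - W s \<omega>) powr (2 * q)" for \<omega>
    by (simp add: power_mult_distrib power2_eq_square powr_add[symmetric])
  have h2: "(\<lambda>\<omega>. (h \<omega>)\<^sup>2) \<in> borel_measurable (F s)" using h(1) by simp
  show "integrable P (\<lambda>\<omega>. (h \<omega> * norm (W t \<omega> - W s \<omega>) powr q)\<^sup>2)"
    unfolding eq using q
    by (intro expectation_past_mult_increment(1)[OF st h2 h(2), where f = "\<lambda>z. norm z powr (2 * q)"]
        integrable_increment_powr st) auto
  show "expectation (\<lambda>\<omega>. (h \<omega> * norm (W t \<omega> - W s \<omega>) powr q)\<^sup>2)
      = expectation (\<lambda>\<omega>. (h \<omega>)\<^sup>2) * expectation (\<lambda>\<omega>. norm (W t \<omega> - W s \<omega>) powr (2 * q))"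
    unfolding eq using q
    by (intro expectation_past_mult_increment(2)[OF st h2 h(2), where f = "\<lambda>z. norm z powr (2 * q)"]
        integrable_increment_powr st) auto
qed

text \<open>The weight h is known at time s and |.|^r is convex, so X is a submartingale along the
  partition. Concretely, the subgradient inequality bounds each increment of X below by a linear
  function of the Wiener increment with coefficient from the past, and this function has mean
  zero.\<close>

lemma weighted_increment_partition_max:
  assumes st: "0 \<le> s" "s < t" and r: "2 \<le> r"
    and h: "h \<in> borel_measurable (F s)" "integrable P (\<lambda>\<omega>. (h \<omega>)\<^sup>2)" "\<And>\<omega>. 0 \<le> h \<omega>"
    and n: "0 < n"
  defines "X \<equiv> \<lambda>i \<omega>. h \<omega> * norm (W (s + real i * ((t - s) / real n)) \<omega> - W s \<omega>) powr r"
  shows "\<And>i. X i \<in> borel_measurable P"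
    and "integrable P (\<lambda>\<omega>. (running_max (\<lambda>i. X i \<omega>) n)\<^sup>2)"
    and "expectation (\<lambda>\<omega>. (running_max (\<lambda>i. X i \<omega>) n)\<^sup>2)
      \<le> 4 * (expectation (\<lambda>\<omega>. (h \<omega>)\<^sup>2) * expectation (\<lambda>\<omega>. norm (W t \<omega> - W s \<omega>) powr (2 * r)))"
proof -
  define p where "p i = s + real i * ((t - s) / real n)" for i
  have p0: "p 0 = s" by (simp add: p_def)
  have pn: "p n = t" using n by (simp add: p_def)
  have p_less: "p i < p (Suc i)" for i using st n by (simp add: p_def divide_strict_right_mono)
  have p_mono: "p i \<le> p j" if "i \<le> j" for i j
    using lift_Suc_mono_le[of p] p_less that by (simp add: less_imp_le)
  have sp: "s \<le> p i" for i using p_mono[of 0 i] p0 by simp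
  have sp': "s < p (Suc i)" for i using sp[of i] p_less[of i] by linarith
  have p_nonneg: "0 \<le> p i" for i using st sp[of i] by linarith
  have X: "X i \<omega> = h \<omega> * norm (W (p i) \<omega> - W s \<omega>) powr r" for i \<omega> by (simp add: X_def p_def)
  have norm_meas: "(\<lambda>\<omega>. norm (W (p i) \<omega> - W s \<omega>)) \<in> borel_measurable (F (p i))" for i
    by (rule measurable_compose[OF increment_adapted[OF st(1) sp] borel_measurable_norm])
  have weighted_meas: "(\<lambda>\<omega>. h \<omega> * norm (W (p i) \<omega> - W s \<omega>) powr q) \<in> borel_measurable (F (p i))" for i q
    using norm_meas[of i] measurable_later[OF st(1) sp h(1), of i] by measurable
  have X_meas: "X i \<in> borel_measurable (F (p i))" for i
    unfolding X by (rule weighted_meas)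
  show XP: "X i \<in> borel_measurable P" for i
    using measurable_past[OF p_nonneg X_meas] .
  \<comment> \<open>The point i = 0 is separate because the law of increments is given on
    nondegenerate intervals; there the increment vanishes.\<close>
  have weighted_sq: "integrable P (\<lambda>\<omega>. (h \<omega> * norm (W (p i) \<omega> - W s \<omega>) powr q)\<^sup>2)" if "0 \<le> q" for i q
  proof (cases i)
    case 0
    then show ?thesis by (simp add: p0)
  next
    case (Suc j)
    then show ?thesis using weighted_increment_square(1)[OF st(1) sp' that h(1,2)] by simp
  qed
  have X2: "integrable P (\<lambda>\<omega>. (X i \<omega>)\<^sup>2)" for i
    unfolding X using r by (intro weighted_sq) auto
  show "integrable P (\<lambda>\<omega>. (running_max (\<lambda>i. X i \<omega>) n)\<^sup>2)"
    using XP X2 by (intro integrable_running_max_square) auto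
  have X_nonneg: "0 \<le> X i \<omega>" for i \<omega> using h(3) by (simp add: X)
  define S where "S i \<omega> = running_max (\<lambda>i. X i \<omega>) i" for i \<omega>
  have S_meas: "S i \<in> borel_measurable (F (p i))" for i
    unfolding S_def by (intro borel_measurable_running_max measurable_later[OF p_nonneg p_mono X_meas])
  have S2: "integrable P (\<lambda>\<omega>. (S i \<omega>)\<^sup>2)" for i
    unfolding S_def using XP X2 by (intro integrable_running_max_square) auto
  have SP: "S i \<in> borel_measurable P" for i using measurable_past[OF p_nonneg S_meas] .
  have S_nonneg: "0 \<le> S i \<omega>" for i \<omega>
    unfolding S_def using running_max_ge[of 0 i "\<lambda>i. X i \<omega>"] X_nonneg[of 0 \<omega>] by simp
  have "expectation (\<lambda>\<omega>. (running_max (\<lambda>i. X i \<omega>) n)\<^sup>2) \<le> 4 * expectation (\<lambda>\<omega>. (X n \<omega>)\<^sup>2)"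
  proof (rule doob_L2[OF XP X2])
    fix i
    define v where "v \<omega> = W (p i) \<omega> - W s \<omega>" for \<omega>
    define d where "d \<omega> = W (p (Suc i)) \<omega> - W (p i) \<omega>" for \<omega>
    \<comment> \<open>The gradient of h |.|^r at v, multiplied by the running maximum. Its norm is a
      product of two square-integrable factors, the second having exponent r - 1, so c is
      integrable.\<close>
    define c where "c \<omega> = (S i \<omega> * (r * (h \<omega> * norm (v \<omega>) powr (r - 2)))) *\<^sub>R v \<omega>" for \<omega>
    have c_meas: "c \<in> borel_measurable (F (p i))"
      unfolding c_def v_def
      by (intro borel_measurable_scaleR increment_adapted[OF st(1) sp]
          borel_measurable_times[OF S_meas borel_measurable_times[OF borel_measurable_const weighted_meas]])
    have norm_c: "norm (c \<omega>) = r * (S i \<omega> * (h \<omega> * norm (v \<omega>) powr (r - 1)))" for \<omega>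
    proof -
      have "norm (v \<omega>) powr (r - 2) * norm (v \<omega>) = norm (v \<omega>) powr (r - 1)"
      proof (cases "v \<omega> = 0")
        case False
        then have "norm (v \<omega>) powr (r - 2) * norm (v \<omega>) powr 1 = norm (v \<omega>) powr (r - 1)"
          by (simp add: powr_add[symmetric] del: powr_one powr_one')
        then show ?thesis using False by simp
      qed simp
      then show ?thesis using S_nonneg[of i \<omega>] h(3)[of \<omega>] r by (simp add: c_def abs_mult mult.assoc)
    qed
    have c_int: "integrable P (\<lambda>\<omega>. norm (c \<omega>))"
      unfolding norm_c v_def using r
      by (intro integrable_mult_right integrable_mult_square SP S2 weighted_sq
          measurable_past[OF p_nonneg weighted_meas]) auto
    have "0 = expectation (\<lambda>\<omega>. c \<omega> \<bullet> d \<omega>)"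
      unfolding d_def using expectation_increment_inner(2)[OF p_nonneg p_less c_meas c_int] by simp
    also have "\<dots> \<le> expectation (\<lambda>\<omega>. S i \<omega> * (X (Suc i) \<omega> - X i \<omega>))"
    proof (rule integral_mono)
      show "integrable P (\<lambda>\<omega>. c \<omega> \<bullet> d \<omega>)"
        unfolding d_def by (rule expectation_increment_inner(1)[OF p_nonneg p_less c_meas c_int])
      show "integrable P (\<lambda>\<omega>. S i \<omega> * (X (Suc i) \<omega> - X i \<omega>))"
        unfolding right_diff_distrib
        by (intro Bochner_Integration.integrable_diff integrable_mult_square SP S2 XP X2)
      fix \<omega>
      have "W (p (Suc i)) \<omega> - W s \<omega> = v \<omega> + d \<omega>" by (simp add: v_def d_def)
      then have "norm (v \<omega>) powr r + r * norm (v \<omega>) powr (r - 2) * (v \<omega> \<bullet> d \<omega>)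
          \<le> norm (W (p (Suc i)) \<omega> - W s \<omega>) powr r"
        using norm_add_powr_ge[of r "v \<omega>" "d \<omega>"] r by simp
      then have "h \<omega> * (r * norm (v \<omega>) powr (r - 2) * (v \<omega> \<bullet> d \<omega>))
          \<le> h \<omega> * (norm (W (p (Suc i)) \<omega> - W s \<omega>) powr r - norm (v \<omega>) powr r)"
        using h(3) by (intro mult_left_mono) auto
      also have "\<dots> = X (Suc i) \<omega> - X i \<omega>" by (simp add: X v_def right_diff_distrib)
      finally have "S i \<omega> * (h \<omega> * (r * norm (v \<omega>) powr (r - 2) * (v \<omega> \<bullet> d \<omega>)))
          \<le> S i \<omega> * (X (Suc i) \<omega> - X i \<omega>)"
        using S_nonneg by (intro mult_left_mono)
      then show "c \<omega> \<bullet> d \<omega> \<le> S i \<omega> * (X (Suc i) \<omega> - X i \<omega>)" by (simp add: c_def ac_simps)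
    qed
    finally show "0 \<le> expectation (\<lambda>\<omega>. running_max (\<lambda>k. X k \<omega>) i * (X (Suc i) \<omega> - X i \<omega>))"
      by (simp add: S_def)
  qed
  also have "expectation (\<lambda>\<omega>. (X n \<omega>)\<^sup>2)
      = expectation (\<lambda>\<omega>. (h \<omega>)\<^sup>2) * expectation (\<lambda>\<omega>. norm (W t \<omega> - W s \<omega>) powr (2 * r))"
    unfolding X pn using r by (intro weighted_increment_square st h(1,2)) auto
  finally show "expectation (\<lambda>\<omega>. (running_max (\<lambda>i. X i \<omega>) n)\<^sup>2)
      \<le> 4 * (expectation (\<lambda>\<omega>. (h \<omega>)\<^sup>2) * expectation (\<lambda>\<omega>. norm (W t \<omega> - W s \<omega>) powr (2 * r)))" .
qed

text \<open>The supremum over the uncountable interval is approached along uniform partitions, which are not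
  nested; hence Fatou's lemma instead of monotone convergence.\<close>

lemma weighted_increment_sup:
  assumes st: "0 \<le> s" "s < t" and r: "2 \<le> r"
    and h: "h \<in> borel_measurable (F s)" "integrable P (\<lambda>\<omega>. (h \<omega>)\<^sup>2)" "\<And>\<omega>. 0 \<le> h \<omega>"
  obtains H :: "'w \<Rightarrow> ennreal" where "H \<in> borel_measurable P"
    and "AE \<omega> in P. \<forall>v\<in>{s..t}. ennreal ((h \<omega> * norm (W v \<omega> - W s \<omega>) powr r)\<^sup>2) \<le> H \<omega>"
    and "(\<integral>\<^sup>+\<omega>. H \<omega> \<partial>P)
      \<le> ennreal (4 * (expectation (\<lambda>\<omega>. (h \<omega>)\<^sup>2) * expectation (\<lambda>\<omega>. norm (W t \<omega> - W s \<omega>) powr (2 * r))))"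
proof -
  define X where "X n i \<omega> = h \<omega> * norm (W (s + real i * ((t - s) / real (Suc n))) \<omega> - W s \<omega>) powr r" for n i \<omega>
  define S where "S n \<omega> = ennreal ((running_max (\<lambda>i. X n i \<omega>) (Suc n))\<^sup>2)" for n \<omega>
  let ?C = "4 * (expectation (\<lambda>\<omega>. (h \<omega>)\<^sup>2) * expectation (\<lambda>\<omega>. norm (W t \<omega> - W s \<omega>) powr (2 * r)))"
  have S_meas: "S n \<in> borel_measurable P" for n
  proof -
    have "(\<lambda>\<omega>. running_max (\<lambda>i. X n i \<omega>) (Suc n)) \<in> borel_measurable P"
      unfolding X_def by (intro borel_measurable_running_max weighted_increment_partition_max(1)[OF st r h]) simp
    then show ?thesis unfolding S_def by measurable
  qed
  have "(\<integral>\<^sup>+\<omega>. liminf (\<lambda>n. S n \<omega>) \<partial>P) \<le> liminf (\<lambda>n. \<integral>\<^sup>+\<omega>. S n \<omega> \<partial>P)"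
    by (rule nn_integral_liminf[OF S_meas])
  also have "\<dots> \<le> liminf (\<lambda>n::nat. ennreal ?C)"
  proof (intro Liminf_mono always_eventually allI)
    fix n
    have "(\<integral>\<^sup>+\<omega>. S n \<omega> \<partial>P) = ennreal (expectation (\<lambda>\<omega>. (running_max (\<lambda>i. X n i \<omega>) (Suc n))\<^sup>2))"
      unfolding S_def using weighted_increment_partition_max(2)[OF st r h, of "Suc n", folded X_def]
      by (intro nn_integral_eq_integral) auto
    also have "\<dots> \<le> ennreal ?C"
      using weighted_increment_partition_max(3)[OF st r h, of "Suc n", folded X_def] by (intro ennreal_leI) auto
    finally show "(\<integral>\<^sup>+\<omega>. S n \<omega> \<partial>P) \<le> ennreal ?C" .
  qed
  also have "\<dots> = ennreal ?C" by (simp add: Liminf_const)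
  finally have int: "(\<integral>\<^sup>+\<omega>. liminf (\<lambda>n. S n \<omega>) \<partial>P) \<le> ennreal ?C" .
  show thesis
  \<comment> \<open>The majorant is the liminf of the squared maxima over the partitions. It is
    measurable by construction, and it dominates every v because the partition points p n tend to v
    along a continuous path.\<close>
  proof (rule that[OF _ _ int])
    show "(\<lambda>\<omega>. liminf (\<lambda>n. S n \<omega>)) \<in> borel_measurable P" using S_meas by measurable
    show "AE \<omega> in P. \<forall>v\<in>{s..t}. ennreal ((h \<omega> * norm (W v \<omega> - W s \<omega>) powr r)\<^sup>2) \<le> liminf (\<lambda>n. S n \<omega>)"
      using continuous_paths
    proof eventually_elim
      case (elim \<omega>)
      show ?case
      proof
        fix v assume v: "v \<in> {s..t}"
        define i where "i n = nat \<lfloor>(v - s) * real (Suc n) / (t - s)\<rfloor>" for n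
        define p where "p n = s + real (i n) * ((t - s) / real (Suc n))" for n
        have i_le: "i n \<le> Suc n" and p_bounds: "s \<le> p n" "p n \<le> v" and p_lim: "p \<longlonglongrightarrow> v" for n
          using uniform_partition_approx[OF st(2), of v] v unfolding i_def p_def by auto
        have cont: "continuous_on {s..t} (\<lambda>x. (h \<omega> * norm (W x \<omega> - W s \<omega>) powr r)\<^sup>2)"
          using st r continuous_on_subset[OF elim, of "{s..t}"]
          by (intro continuous_intros continuous_on_powr') auto
        have "(\<lambda>n. (h \<omega> * norm (W (p n) \<omega> - W s \<omega>) powr r)\<^sup>2) \<longlonglongrightarrow> (h \<omega> * norm (W v \<omega> - W s \<omega>) powr r)\<^sup>2"
          using p_bounds v by (intro continuous_on_tendsto_compose[OF cont p_lim v] always_eventually) (auto intro: order_trans)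
        then have "(\<lambda>n. ennreal ((h \<omega> * norm (W (p n) \<omega> - W s \<omega>) powr r)\<^sup>2))
            \<longlonglongrightarrow> ennreal ((h \<omega> * norm (W v \<omega> - W s \<omega>) powr r)\<^sup>2)"
          by (rule tendsto_ennrealI)
        then have "ennreal ((h \<omega> * norm (W v \<omega> - W s \<omega>) powr r)\<^sup>2)
            = liminf (\<lambda>n. ennreal ((h \<omega> * norm (W (p n) \<omega> - W s \<omega>) powr r)\<^sup>2))"
          by (intro lim_imp_Liminf[symmetric]) auto
        also have "\<dots> \<le> liminf (\<lambda>n. S n \<omega>)"
        proof (intro Liminf_mono always_eventually allI)
          fix n
          have "X n (i n) \<omega> \<le> running_max (\<lambda>i. X n i \<omega>) (Suc n)"
            by (rule running_max_ge[OF i_le])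
          moreover have "0 \<le> X n (i n) \<omega>" using h(3) by (simp add: X_def)
          ultimately show "ennreal ((h \<omega> * norm (W (p n) \<omega> - W s \<omega>) powr r)\<^sup>2) \<le> S n \<omega>"
            unfolding S_def X_def p_def by (intro ennreal_leI power_mono) auto
        qed
        finally show "ennreal ((h \<omega> * norm (W v \<omega> - W s \<omega>) powr r)\<^sup>2) \<le> liminf (\<lambda>n. S n \<omega>)" .
      qed
    qed
  qed
qed

end

section \<open>Adapted solutions\<close>

text \<open>An expansive map is injective and its inverse is Lipschitz on the range. Continuity of G
  makes the range closed, so extending the inverse by 0 gives a Borel map.\<close>

lemma expansive_left_inverse:
  fixes G :: "'a::euclidean_space \<Rightarrow> 'a"
  assumes cont: "continuous_on UNIV G" and c: "0 < c"
    and expansive: "\<And>x y. c * norm (x - y) \<le> norm (G x - G y)"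
  obtains R where "R \<in> borel_measurable borel" "\<And>x. R (G x) = x"
proof -
  have inj: "inj G"
  proof (rule injI)
    fix x y assume "G x = G y"
    then have "c * norm (x - y) \<le> 0" using expansive[of x y] by simp
    then show "x = y" using c by (simp add: mult_le_0_iff)
  qed
  have "closed (range G)"
    unfolding closed_sequential_limits
  proof (intro allI impI, elim conjE)
    fix z l assume "\<forall>n::nat. z n \<in> range G" and lim: "z \<longlonglongrightarrow> l"
    then have "\<forall>n. \<exists>x. z n = G x" by blast
    then obtain x where "\<forall>n. z n = G (x n)" by (rule choice[THEN exE])
    then have x: "z n = G (x n)" for n by simp
    \<comment> \<open>Expansiveness carries the Cauchy property from the images back to the
      preimages.\<close>
    have "Cauchy x"
    proof (rule CauchyI)
      fix e :: real assume e: "0 < e"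
      obtain N where N: "\<And>m n. N \<le> m \<Longrightarrow> N \<le> n \<Longrightarrow> norm (z m - z n) < c * e"
        using CauchyD[OF LIMSEQ_imp_Cauchy[OF lim], of "c * e"] c e by auto
      show "\<exists>N. \<forall>m\<ge>N. \<forall>n\<ge>N. norm (x m - x n) < e"
      proof (intro exI allI impI)
        fix m n assume "N \<le> m" "N \<le> n"
        then have "c * norm (x m - x n) < c * e"
          using order_le_less_trans[OF expansive[of "x m" "x n"]] N[of m n] by (simp add: x)
        then show "norm (x m - x n) < e" using c by simp
      qed
    qed
    then obtain y where y: "x \<longlonglongrightarrow> y" using Cauchy_convergent_iff convergent_def by blast
    have "isCont G y" using cont by (simp add: continuous_on_eq_continuous_at)
    then have "(\<lambda>n. G (x n)) \<longlonglongrightarrow> G y" using y by (rule isCont_tendsto_compose)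
    then have "l = G y" using lim LIMSEQ_unique unfolding x by blast
    then show "l \<in> range G" by simp
  qed
  moreover have "continuous_on (range G) (inv G)"
  proof (rule continuous_on_iff[THEN iffD2], intro ballI allI impI)
    fix z e assume "z \<in> range G" and e: "(0::real) < e"
    then obtain x where x: "z = G x" by auto
    show "\<exists>d>0. \<forall>z'\<in>range G. dist z' z < d \<longrightarrow> dist (inv G z') (inv G z) < e"
    proof (intro exI conjI ballI impI)
      show "0 < c * e" using c e by simp
      fix z' assume "z' \<in> range G" and d: "dist z' z < c * e"
      then obtain x' where x': "z' = G x'" by auto
      have "c * norm (x' - x) < c * e" using expansive[of x' x] d by (simp add: x x' dist_norm)
      then show "dist (inv G z') (inv G z) < e" using c inj by (simp add: x x' dist_norm)
    qed
  qed
  ultimately have "(\<lambda>z. if z \<in> range G then inv G z else 0) \<in> borel_measurable borel"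
    by (intro borel_measurable_continuous_on_if) auto
  then show thesis
    by (rule that) (use inj in simp)
qed

text \<open>Testing the difference of two images against x - y shows that the implicit map is
  strongly monotone with constant 1 - L \<tau>; by Cauchy-Schwarz it is then expansive with the same
  constant.\<close>

lemma implicit_map_left_inverse:
  fixes b :: "'a::euclidean_space \<Rightarrow> 'a"
  assumes onesided: "\<And>x y. (b x - b y) \<bullet> (x - y) \<le> L * (norm (x - y))\<^sup>2"
    and cont: "continuous_on UNIV b" and \<tau>: "0 \<le> \<tau>" "L * \<tau> < 1"
  obtains R where "R \<in> borel_measurable borel" "\<And>x. R (x - \<tau> *\<^sub>R b x) = x"
proof (rule expansive_left_inverse)
  show "continuous_on UNIV (\<lambda>x. x - \<tau> *\<^sub>R b x)" using cont by (intro continuous_intros)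
  show "0 < 1 - L * \<tau>" using \<tau> by simp
  fix x y
  let ?d = "(x - \<tau> *\<^sub>R b x) - (y - \<tau> *\<^sub>R b y)"
  have "?d \<bullet> (x - y) = (norm (x - y))\<^sup>2 - \<tau> * ((b x - b y) \<bullet> (x - y))"
    by (simp add: power2_norm_eq_inner inner_diff_left algebra_simps)
  moreover have "\<tau> * ((b x - b y) \<bullet> (x - y)) \<le> \<tau> * (L * (norm (x - y))\<^sup>2)"
    using onesided \<tau> by (intro mult_left_mono) auto
  moreover have "?d \<bullet> (x - y) \<le> norm ?d * norm (x - y)" by (rule norm_cauchy_schwarz)
  ultimately have "((1 - L * \<tau>) * norm (x - y)) * norm (x - y) \<le> norm ?d * norm (x - y)"
    by (simp add: power2_eq_square algebra_simps)
  then show "(1 - L * \<tau>) * norm (x - y) \<le> norm ?d"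
    by (cases "x = y") auto
qed (use that in blast)

lemma continuous_on_matrix_vector [continuous_intros]:
  fixes A :: "'a::topological_space \<Rightarrow> real ^ 'm ^ 'n"
  assumes "continuous_on S A" "continuous_on S x"
  shows "continuous_on S (\<lambda>z. A z *v x z)"
  unfolding matrix_vector_mult_def using assms by (intro continuous_intros)

lemma continuous_on_vector_matrix [continuous_intros]:
  fixes A :: "'a::topological_space \<Rightarrow> real ^ 'm ^ 'n"
  assumes "continuous_on S A" "continuous_on S x"
  shows "continuous_on S (\<lambda>z. x z v* A z)"
  unfolding vector_matrix_mult_def using assms by (intro continuous_intros)

lemma borel_measurable_continuous2:
  fixes f :: "'b::second_countable_topology \<Rightarrow> 'c::second_countable_topology \<Rightarrow> 'd::topological_space"
  assumes "continuous_on UNIV (\<lambda>p. f (fst p) (snd p))"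
    and "g \<in> borel_measurable M" "h \<in> borel_measurable M"
  shows "(\<lambda>x. f (g x) (h x)) \<in> borel_measurable M"
  using borel_measurable_continuous_on[OF assms(1) borel_measurable_Pair[OF assms(2,3)]] by simp

text \<open>A solution of the scheme is only assumed measurable. Since the implicit map is injective with Borel
  left inverse, it agrees almost surely with an adapted one.\<close>

lemma (in wiener_process) backward_euler_adapted_version:
  fixes b :: "real ^ 'n \<Rightarrow> real ^ 'n" and \<sigma> :: "real ^ 'n \<Rightarrow> real ^ 'm ^ 'n"
  assumes onesided: "\<And>x y. (b x - b y) \<bullet> (x - y) \<le> L * (norm (x - y))\<^sup>2"
    and cont: "continuous_on UNIV b" "continuous_on UNIV \<sigma>"
    and T: "0 < T" and M: "0 < M" and small: "L * (T / real M) < 1"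
    and X0: "X0 \<in> borel_measurable (F 0)"
    and scheme: "backward_euler_scheme P W b \<sigma> T M X0 Y"
  obtains Z where "Z 0 = X0" "\<And>k. Z k \<in> borel_measurable (F (grid T M k))"
    "AE \<omega> in P. \<forall>k\<le>M. Y k \<omega> = Z k \<omega>"
proof -
  obtain R where R: "R \<in> borel_measurable borel" "\<And>x. R (x - (T / real M) *\<^sub>R b x) = x"
    using implicit_map_left_inverse[OF onesided cont(1) _ small] T by auto
  define D where "D k \<omega> = W (grid T M (Suc k)) \<omega> - W (grid T M k) \<omega>" for k \<omega>
  \<comment> \<open>Solving the recursion explicitly with R makes Z adapted by construction and
    defined for every k and at every sample point, also where Y violates the scheme.\<close>
  define Z where "Z = rec_nat X0 (\<lambda>k z \<omega>. R (z \<omega> + \<sigma> (z \<omega>) *v D k \<omega>))"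
  have Z0: "Z 0 = X0" and Z_Suc: "Z (Suc k) = (\<lambda>\<omega>. R (Z k \<omega> + \<sigma> (Z k \<omega>) *v D k \<omega>))" for k
    by (simp_all add: Z_def)
  have grid: "0 \<le> grid T M k" "grid T M k \<le> grid T M (Suc k)" for k
    using T by (auto simp: grid_def intro!: divide_right_mono)
  have meas: "Z k \<in> borel_measurable (F (grid T M k))" for k
  proof (induction k)
    case 0
    then show ?case using X0 by (simp add: Z0 grid_def)
  next
    case (Suc k)
    have Zk: "Z k \<in> borel_measurable (F (grid T M (Suc k)))" by (rule measurable_later[OF grid Suc])
    have Dk: "D k \<in> borel_measurable (F (grid T M (Suc k)))"
      unfolding D_def by (rule increment_adapted[OF grid])
    have "continuous_on UNIV (\<lambda>p :: (real ^ 'n) \<times> (real ^ 'm). fst p + \<sigma> (fst p) *v snd p)"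
      by (intro continuous_intros continuous_on_compose2[OF cont(2)]) auto
    from borel_measurable_continuous2[OF this Zk Dk]
    show ?case unfolding Z_Suc by (rule measurable_compose[OF _ R(1)])
  qed
  have move: "x = y + d + e \<Longrightarrow> x - d = y + e" for x y d e :: "real ^ 'n" by simp
  have "AE \<omega> in P. Y 0 \<omega> = X0 \<omega> \<and> (\<forall>k<M. Y (Suc k) \<omega> = Y k \<omega> + (T / real M) *\<^sub>R b (Y (Suc k) \<omega>)
      + \<sigma> (Y k \<omega>) *v D k \<omega>)"
    using scheme unfolding backward_euler_scheme_def D_def by blast
  then have "AE \<omega> in P. \<forall>k\<le>M. Y k \<omega> = Z k \<omega>"
  proof eventually_elim
    case (elim \<omega>)
    show ?case
    proof (intro allI impI)
      fix k assume "k \<le> M"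
      then show "Y k \<omega> = Z k \<omega>"
      proof (induction k)
        case (Suc k)
        then have "Y (Suc k) \<omega> - (T / real M) *\<^sub>R b (Y (Suc k) \<omega>) = Y k \<omega> + \<sigma> (Y k \<omega>) *v D k \<omega>"
          using conjunct2[OF elim, rule_format, of k] by (intro move) simp
        then have "Y (Suc k) \<omega> = R (Y k \<omega> + \<sigma> (Y k \<omega>) *v D k \<omega>)" using R(2)[of "Y (Suc k) \<omega>"] by simp
        then show ?case using Suc by (simp add: Z_Suc)
      qed (use elim in \<open>simp add: Z0\<close>)
    qed
  qed
  then show thesis using that Z0 meas by blast
qed

section \<open>Uniform moments of the scheme\<close>

lemma lyap_square: "(lyap s y)\<^sup>2 = (1 + (norm y)\<^sup>2) powr (2 * s)"
  by (simp add: lyap_def power2_eq_square powr_add[symmetric])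

lemma norm_powr_le_lyap_square:
  assumes "0 \<le> p"
  shows "norm y powr p \<le> (lyap (p / 4) y)\<^sup>2"
proof -
  have "norm y powr p = ((norm y)\<^sup>2) powr (p / 2)"
    by (cases "y = 0") (simp_all add: powr_powr powr_numeral[symmetric] del: powr_numeral)
  also have "\<dots> \<le> (1 + (norm y)\<^sup>2) powr (p / 2)" using assms by (intro powr_mono2) auto
  finally show ?thesis by (simp add: lyap_square)
qed

lemma lyap_square_le:
  assumes "0 \<le> p"
  shows "(lyap (p / 4) y)\<^sup>2 \<le> 2 powr (p / 2) * (1 + norm y powr p)"
proof -
  have "(1 + (norm y)\<^sup>2) powr (p / 2) \<le> (2 * max 1 ((norm y)\<^sup>2)) powr (p / 2)"
    using assms by (intro powr_mono2) auto
  also have "\<dots> = 2 powr (p / 2) * max 1 ((norm y)\<^sup>2) powr (p / 2)" by (simp add: powr_mult)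
  also have "max 1 ((norm y)\<^sup>2) powr (p / 2) \<le> 1 + norm y powr p"
  proof -
    have "((norm y)\<^sup>2) powr (p / 2) = norm y powr p"
      by (cases "y = 0") (simp_all add: powr_powr powr_numeral[symmetric] del: powr_numeral)
    then show ?thesis by (auto simp: max_def)
  qed
  finally show ?thesis by (simp add: lyap_square)
qed

lemma borel_measurable_lyap:
  assumes "f \<in> borel_measurable M"
  shows "(\<lambda>x. lyap s (f x)) \<in> borel_measurable M"
proof -
  have "(\<lambda>x. norm (f x)) \<in> borel_measurable M" by (rule measurable_compose[OF assms borel_measurable_norm])
  then show ?thesis unfolding lyap_def by measurable
qed

lemma add4_powr_le:
  fixes a b c d p :: real
  assumes "0 \<le> a" "0 \<le> b" "0 \<le> c" "0 \<le> d" "0 \<le> p"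
  shows "(a + b + c + d) powr p \<le> 4 powr p * (a powr p + b powr p + c powr p + d powr p)"
proof -
  define m where "m = max a (max b (max c d))"
  have m: "a \<le> m" "b \<le> m" "c \<le> m" "d \<le> m" "m \<in> {a, b, c, d}"
    unfolding m_def by (auto simp: max_def)
  have "(a + b + c + d) powr p \<le> (4 * m) powr p" using assms m by (intro powr_mono2) auto
  also have "\<dots> = 4 powr p * m powr p" using assms m by (simp add: powr_mult)
  also have "m powr p \<le> a powr p + b powr p + c powr p + d powr p" using m(5) by auto
  finally show ?thesis by simp
qed

text \<open>Integrality of M is essential: 2 L T < M forces M to be at least the next integer K
  above 2 L T, and the margin at K serves for all larger M.\<close>

lemma uniform_step_margin:
  fixes L T :: real
  assumes "0 \<le> L" "0 < T"
  obtains \<delta> where "0 < \<delta>" "\<delta> \<le> 1" "\<And>M::nat. 0 < M \<Longrightarrow> 2 * L * (T / real M) < 1 \<Longrightarrow> \<delta> \<le> 1 - 2 * L * (T / real M)"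
proof
  define K where "K = nat \<lfloor>2 * L * T\<rfloor> + 1"
  have K: "2 * L * T < real K" using assms by (simp add: K_def) linarith
  have K0: "0 < real K" by (simp add: K_def)
  show "0 < 1 - 2 * L * T / real K" "1 - 2 * L * T / real K \<le> 1" using K K0 assms by auto
  fix M :: nat assume M: "0 < M" "2 * L * (T / real M) < 1"
  then have "2 * L * T < real M" by (simp add: divide_less_eq)
  then have "K \<le> M" using assms M unfolding K_def by linarith
  then have "2 * L * T / real M \<le> 2 * L * T / real K"
    using assms K0 M by (intro divide_left_mono) auto
  then show "1 - 2 * L * T / real K \<le> 1 - 2 * L * (T / real M)" by simp
qed

context wiener_process
begin

text \<open>Squaring leaves moments of orders 4 and 4 N of the increment, hence the powers 2 and 2 N
  of its length; as t - s \<le> 1, both are O((t - s)^2), the order demanded of the remainder in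
  \<open>multiplicative_noise_bound\<close>.\<close>

lemma expectation_step_remainder:
  fixes B :: real
  assumes st: "0 \<le> s" "s < t" "t - s \<le> 1" and N: "1 \<le> N"
  defines "\<phi> \<equiv> \<lambda>z :: real ^ 'm. B * (t - s + (norm z)\<^sup>2 + norm z ^ (2 * N))"
  shows "integrable P (\<lambda>\<omega>. (\<phi> (W t \<omega> - W s \<omega>))\<^sup>2)"
    and "expectation (\<lambda>\<omega>. (\<phi> (W t \<omega> - W s \<omega>))\<^sup>2)
      \<le> 3 * B\<^sup>2 * (1 + increment_moment 2 + increment_moment (2 * N)) * (t - s)\<^sup>2"
proof -
  let ?n = "\<lambda>\<omega>. norm (W t \<omega> - W s \<omega>)"
  let ?f = "\<lambda>\<omega>. 3 * B\<^sup>2 * ((t - s)\<^sup>2 + ?n \<omega> ^ (2 * 2) + ?n \<omega> ^ (2 * (2 * N)))"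
  have int: "integrable P ?f"
    using integrable_increment_even_power[OF st(1,2), of 2] integrable_increment_even_power[OF st(1,2), of "2 * N"]
    by simp
  have le: "(\<phi> (W t \<omega> - W s \<omega>))\<^sup>2 \<le> ?f \<omega>" for \<omega>
  proof -
    define a c e where "a = t - s" and "c = (?n \<omega>)\<^sup>2" and "e = ?n \<omega> ^ (2 * N)"
    have "(a + c + e)\<^sup>2 \<le> 3 * (a\<^sup>2 + c\<^sup>2 + e\<^sup>2)"
      using sum_squares_bound[of a c] sum_squares_bound[of a e] sum_squares_bound[of c e]
      by (simp add: power2_eq_square algebra_simps)
    then have "B\<^sup>2 * (a + c + e)\<^sup>2 \<le> B\<^sup>2 * (3 * (a\<^sup>2 + c\<^sup>2 + e\<^sup>2))" by (intro mult_left_mono) auto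
    moreover have "c\<^sup>2 = ?n \<omega> ^ (2 * 2)" "e\<^sup>2 = ?n \<omega> ^ (2 * (2 * N))"
      by (simp_all add: c_def e_def power_mult[symmetric] mult.commute)
    moreover have "(\<phi> (W t \<omega> - W s \<omega>))\<^sup>2 = B\<^sup>2 * (a + c + e)\<^sup>2"
      by (simp only: \<phi>_def a_def c_def e_def power_mult_distrib)
    ultimately show ?thesis by (simp only: a_def mult.assoc mult.left_commute[of 3])
  qed
  show sq: "integrable P (\<lambda>\<omega>. (\<phi> (W t \<omega> - W s \<omega>))\<^sup>2)"
  proof (rule Bochner_Integration.integrable_bound[OF int])
    have [measurable]: "(\<lambda>\<omega>. norm (W t \<omega> - W s \<omega>)) \<in> borel_measurable P"
      using st by (intro measurable_compose[OF increment_measurable borel_measurable_norm]) auto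
    show "(\<lambda>\<omega>. (\<phi> (W t \<omega> - W s \<omega>))\<^sup>2) \<in> borel_measurable P" unfolding \<phi>_def by measurable
    show "AE \<omega> in P. norm ((\<phi> (W t \<omega> - W s \<omega>))\<^sup>2) \<le> norm (?f \<omega>)"
    proof (rule AE_I2)
      fix \<omega>
      show "norm ((\<phi> (W t \<omega> - W s \<omega>))\<^sup>2) \<le> norm (?f \<omega>)"
        unfolding real_norm_def abs_of_nonneg[OF zero_le_power2]
        by (rule order_trans[OF le abs_ge_self])
    qed
  qed
  have "expectation (\<lambda>\<omega>. (\<phi> (W t \<omega> - W s \<omega>))\<^sup>2) \<le> expectation ?f"
    by (rule integral_mono[OF sq int le])
  also have "\<dots> = 3 * B\<^sup>2 * ((t - s)\<^sup>2 + expectation (\<lambda>\<omega>. ?n \<omega> ^ (2 * 2)) + expectation (\<lambda>\<omega>. ?n \<omega> ^ (2 * (2 * N))))"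
    using integrable_increment_even_power[OF st(1,2), of 2] integrable_increment_even_power[OF st(1,2), of "2 * N"]
    by (simp add: prob_space)
  also have "\<dots> \<le> 3 * B\<^sup>2 * ((t - s)\<^sup>2 + increment_moment 2 * (t - s)\<^sup>2 + increment_moment (2 * N) * (t - s)\<^sup>2)"
  proof (intro mult_left_mono add_mono order_refl)
    show "expectation (\<lambda>\<omega>. ?n \<omega> ^ (2 * 2)) \<le> increment_moment 2 * (t - s)\<^sup>2"
      by (rule expectation_increment_even_power[OF st(1,2)])
    have "(t - s) ^ (2 * N) \<le> (t - s)\<^sup>2" using st N by (intro power_decreasing) auto
    then show "expectation (\<lambda>\<omega>. ?n \<omega> ^ (2 * (2 * N))) \<le> increment_moment (2 * N) * (t - s)\<^sup>2"
      by (intro order_trans[OF expectation_increment_even_power[OF st(1,2)] mult_left_mono] increment_moment_nonneg)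
  qed simp
  finally show "expectation (\<lambda>\<omega>. (\<phi> (W t \<omega> - W s \<omega>))\<^sup>2)
      \<le> 3 * B\<^sup>2 * (1 + increment_moment 2 + increment_moment (2 * N)) * (t - s)\<^sup>2"
    by (simp add: algebra_simps)
qed

text \<open>The constant depends on the margin \<delta> and not on M. The adapted version Z is
  returned with its integrability because the interpolation estimate needs weights known at the grid
  times.\<close>

lemma backward_euler_moment_bound:
  fixes b :: "real ^ 'n \<Rightarrow> real ^ 'n" and \<sigma> :: "real ^ 'n \<Rightarrow> real ^ 'm ^ 'n"
  assumes onesided: "\<And>x y. (b x - b y) \<bullet> (x - y) \<le> L * (norm (x - y))\<^sup>2"
    and lipschitz: "\<And>x y. norm (\<sigma> x - \<sigma> y) \<le> L' * norm (x - y)"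
    and cont: "continuous_on UNIV b" "continuous_on UNIV \<sigma>"
    and L: "0 \<le> L" and L': "0 \<le> L'" and p: "4 \<le> p" and T: "0 < T" and \<delta>: "0 < \<delta>" "\<delta> \<le> 1"
  obtains C where "0 \<le> C"
    "\<And>X0 M Y. X0 \<in> borel_measurable (F 0) \<Longrightarrow> integrable P (\<lambda>\<omega>. norm (X0 \<omega>) powr p) \<Longrightarrow>
      0 < M \<Longrightarrow> T < real M \<Longrightarrow> \<delta> \<le> 1 - 2 * L * (T / real M) \<Longrightarrow>
      backward_euler_scheme P W b \<sigma> T M X0 Y \<Longrightarrow>
      \<exists>Z. (\<forall>k. Z k \<in> borel_measurable (F (grid T M k))) \<and> (AE \<omega> in P. \<forall>k\<le>M. Y k \<omega> = Z k \<omega>) \<and>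
        (\<forall>k\<le>M. integrable P (\<lambda>\<omega>. (lyap (p / 4) (Z k \<omega>))\<^sup>2)) \<and>
        expectation (\<lambda>\<omega>. (running_max (\<lambda>k. lyap (p / 4) (Z k \<omega>)) M)\<^sup>2)
          \<le> C * (1 + expectation (\<lambda>\<omega>. norm (X0 \<omega>) powr p))"
proof -
  have s: "1 \<le> p / 4" using p by simp
  obtain G B N where G: "0 \<le> G" and B: "0 \<le> B" and N: "1 \<le> N"
    and one_step: "\<And>\<tau>. 0 < \<tau> \<Longrightarrow> \<tau> \<le> 1 \<Longrightarrow> \<delta> \<le> 1 - 2 * L * \<tau> \<Longrightarrow>
      \<exists>c. (\<forall>y. norm ((c / (1 + (norm y)\<^sup>2)) *\<^sub>R (y v* \<sigma> y)) \<le> G) \<and>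
        (\<forall>y y' z. y' = y + \<tau> *\<^sub>R b y' + \<sigma> y *v z \<longrightarrow>
          lyap (p / 4) y' \<le> lyap (p / 4) y + lyap (p / 4) y * (((c / (1 + (norm y)\<^sup>2)) *\<^sub>R (y v* \<sigma> y)) \<bullet> z)
            + lyap (p / 4) y * (B * (\<tau> + (norm z)\<^sup>2 + norm z ^ (2 * N))))"
    using backward_euler_step[OF onesided lipschitz L L' s \<delta>] by blast
  define V where "V = 3 * B\<^sup>2 * (1 + increment_moment 2 + increment_moment (2 * N))"
  define E where "E = exp (T * (12 * G\<^sup>2 * increment_moment 1 + 3 * T * V))"
  \<comment> \<open>The factor 2^(p/2) compares the squared Lyapunov function of X0 with 1 + |X0|^p;
    the rest is the constant of the abstract noise bound.\<close>
  define C where "C = 3 * 2 powr (p / 2) * E"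
  show thesis
  proof (rule that[of C])
    show "0 \<le> C" by (simp add: C_def E_def)
    fix X0 M Y
    assume X0: "X0 \<in> borel_measurable (F 0)" "integrable P (\<lambda>\<omega>. norm (X0 \<omega>) powr p)"
      and M: "0 < M" "T < real M" "\<delta> \<le> 1 - 2 * L * (T / real M)"
      and scheme: "backward_euler_scheme P W b \<sigma> T M X0 Y"
    define \<tau> where "\<tau> = T / real M"
    have \<tau>: "0 < \<tau>" "\<tau> \<le> 1" "\<delta> \<le> 1 - 2 * L * \<tau>" using T M by (auto simp: \<tau>_def)
    have "0 \<le> L * \<tau>" using L \<tau> by simp
    then have small: "L * (T / real M) < 1" using \<tau>(3) \<delta> by (simp add: \<tau>_def)
    obtain Z where Z0: "Z 0 = X0" and Z_meas: "\<And>k. Z k \<in> borel_measurable (F (grid T M k))"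
      and YZ: "AE \<omega> in P. \<forall>k\<le>M. Y k \<omega> = Z k \<omega>"
      using backward_euler_adapted_version[OF onesided cont T M(1) small X0(1) scheme] by blast
    obtain c where c: "\<And>y. norm ((c / (1 + (norm y)\<^sup>2)) *\<^sub>R (y v* \<sigma> y)) \<le> G"
      and c_step: "\<And>y y' z. y' = y + \<tau> *\<^sub>R b y' + \<sigma> y *v z \<Longrightarrow>
          lyap (p / 4) y' \<le> lyap (p / 4) y + lyap (p / 4) y * (((c / (1 + (norm y)\<^sup>2)) *\<^sub>R (y v* \<sigma> y)) \<bullet> z)
            + lyap (p / 4) y * (B * (\<tau> + (norm z)\<^sup>2 + norm z ^ (2 * N)))"
      using one_step[OF \<tau>] by blast
    define u where "u k \<omega> = lyap (p / 4) (Z k \<omega>)" for k \<omega>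
    define g where "g k \<omega> = (c / (1 + (norm (Z k \<omega>))\<^sup>2)) *\<^sub>R (Z k \<omega> v* \<sigma> (Z k \<omega>))" for k \<omega>
    define \<phi> where "\<phi> z = B * (\<tau> + (norm z)\<^sup>2 + norm z ^ (2 * N))" for z :: "real ^ 'm"
    have grid: "0 \<le> grid T M k" "grid T M k < grid T M (Suc k)" for k
      using T M by (auto simp: grid_def intro!: divide_strict_right_mono)
    have dt: "grid T M (Suc k) - grid T M k = \<tau>" for k
      by (simp add: grid_def \<tau>_def add_divide_distrib algebra_simps)
    have u0: "integrable P (\<lambda>\<omega>. (u 0 \<omega>)\<^sup>2)"
      "expectation (\<lambda>\<omega>. (u 0 \<omega>)\<^sup>2) \<le> 2 powr (p / 2) * (1 + expectation (\<lambda>\<omega>. norm (X0 \<omega>) powr p))"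
    proof -
      have int: "integrable P (\<lambda>\<omega>. 2 powr (p / 2) * (1 + norm (X0 \<omega>) powr p))" using X0(2) by simp
      have le: "(u 0 \<omega>)\<^sup>2 \<le> 2 powr (p / 2) * (1 + norm (X0 \<omega>) powr p)" for \<omega>
        unfolding u_def Z0 using p by (intro lyap_square_le) simp
      show sq: "integrable P (\<lambda>\<omega>. (u 0 \<omega>)\<^sup>2)"
      proof (rule Bochner_Integration.integrable_bound[OF int])
        have "u 0 \<in> borel_measurable P"
          unfolding u_def Z0 using measurable_past[OF _ X0(1)] by (intro borel_measurable_lyap) simp
        then show "(\<lambda>\<omega>. (u 0 \<omega>)\<^sup>2) \<in> borel_measurable P" by measurable
        show "AE \<omega> in P. norm ((u 0 \<omega>)\<^sup>2) \<le> norm (2 powr (p / 2) * (1 + norm (X0 \<omega>) powr p))"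
          unfolding real_norm_def abs_of_nonneg[OF zero_le_power2]
          by (intro AE_I2 order_trans[OF le abs_ge_self])
      qed
      have "expectation (\<lambda>\<omega>. (u 0 \<omega>)\<^sup>2) \<le> expectation (\<lambda>\<omega>. 2 powr (p / 2) * (1 + norm (X0 \<omega>) powr p))"
        by (rule integral_mono[OF sq int le])
      then show "expectation (\<lambda>\<omega>. (u 0 \<omega>)\<^sup>2) \<le> 2 powr (p / 2) * (1 + expectation (\<lambda>\<omega>. norm (X0 \<omega>) powr p))"
        using X0(2) by (simp add: prob_space)
    qed
    have g_cont: "continuous_on UNIV (\<lambda>y. (c / (1 + (norm y)\<^sup>2)) *\<^sub>R (y v* \<sigma> y))"
    proof -
      have "1 + (norm y)\<^sup>2 \<noteq> 0" for y :: "real ^ 'n" using zero_le_power2[of "norm y"] by linarith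
      then show ?thesis using cont by (intro continuous_intros) auto
    qed
    have u_meas: "u k \<in> borel_measurable (F (grid T M k))" for k
      unfolding u_def by (intro borel_measurable_lyap Z_meas)
    have g_meas: "g k \<in> borel_measurable (F (grid T M k))" for k
      unfolding g_def by (rule borel_measurable_continuous_on[OF g_cont Z_meas])
    have \<phi>_meas: "\<phi> \<in> borel_measurable borel" unfolding \<phi>_def by measurable
    have \<phi>_nonneg: "0 \<le> \<phi> z" for z using B \<tau> by (simp add: \<phi>_def)
    have \<phi>2: "integrable P (\<lambda>\<omega>. (\<phi> (W (grid T M (Suc k)) \<omega> - W (grid T M k) \<omega>))\<^sup>2)"
      "expectation (\<lambda>\<omega>. (\<phi> (W (grid T M (Suc k)) \<omega> - W (grid T M k) \<omega>))\<^sup>2) \<le> V * (T / real M)\<^sup>2" for k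
      using expectation_step_remainder[OF grid, of k N B] \<tau> N unfolding dt \<phi>_def V_def \<tau>_def by auto
    have "AE \<omega> in P. \<forall>k<M. Y (Suc k) \<omega> = Y k \<omega> + \<tau> *\<^sub>R b (Y (Suc k) \<omega>)
        + \<sigma> (Y k \<omega>) *v (W (grid T M (Suc k)) \<omega> - W (grid T M k) \<omega>)"
      using scheme unfolding backward_euler_scheme_def \<tau>_def by (auto elim: AE_mp)
    then have step: "AE \<omega> in P. u (Suc k) \<omega> \<le> u k \<omega>
        + u k \<omega> * (g k \<omega> \<bullet> (W (grid T M (Suc k)) \<omega> - W (grid T M k) \<omega>))
        + u k \<omega> * \<phi> (W (grid T M (Suc k)) \<omega> - W (grid T M k) \<omega>)" if k: "k < M" for k
      using YZ
    proof eventually_elim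
      case (elim \<omega>)
      have "Z (Suc k) \<omega> = Z k \<omega> + \<tau> *\<^sub>R b (Z (Suc k) \<omega>)
          + \<sigma> (Z k \<omega>) *v (W (grid T M (Suc k)) \<omega> - W (grid T M k) \<omega>)"
      proof -
        have "Y (Suc k) \<omega> = Y k \<omega> + \<tau> *\<^sub>R b (Y (Suc k) \<omega>)
            + \<sigma> (Y k \<omega>) *v (W (grid T M (Suc k)) \<omega> - W (grid T M k) \<omega>)"
          using elim(1) k by blast
        moreover have "Y k \<omega> = Z k \<omega>" "Y (Suc k) \<omega> = Z (Suc k) \<omega>" using elim(2) k by auto
        ultimately show ?thesis by metis
      qed
      from c_step[OF this] show ?case by (simp only: u_def g_def \<phi>_def)
    qed
    note bound = multiplicative_noise_bound[OF T M(1) u_meas g_meas _ _ \<phi>_meas \<phi>_nonneg \<phi>2 step u0(1)]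
    have u_nonneg: "0 \<le> u k \<omega>" for k \<omega> using lyap_pos[of "p / 4" "Z k \<omega>"] by (simp add: u_def)
    have g_bound: "norm (g k \<omega>) \<le> G" for k \<omega> unfolding g_def by (rule c)
    have "expectation (\<lambda>\<omega>. (running_max (\<lambda>k. u k \<omega>) M)\<^sup>2) \<le> 3 * expectation (\<lambda>\<omega>. (u 0 \<omega>)\<^sup>2) * E"
      unfolding E_def by (rule bound(2)[OF u_nonneg g_bound])
    also have "\<dots> \<le> 3 * (2 powr (p / 2) * (1 + expectation (\<lambda>\<omega>. norm (X0 \<omega>) powr p))) * E"
      using u0(2) by (intro mult_right_mono mult_left_mono) (auto simp: E_def)
    finally have "expectation (\<lambda>\<omega>. (running_max (\<lambda>k. u k \<omega>) M)\<^sup>2)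
        \<le> C * (1 + expectation (\<lambda>\<omega>. norm (X0 \<omega>) powr p))" by (simp add: C_def ac_simps)
    moreover have "\<forall>k\<le>M. integrable P (\<lambda>\<omega>. (u k \<omega>)\<^sup>2)"
      using bound(1)[OF u_nonneg g_bound] by blast
    ultimately show "\<exists>Z. (\<forall>k. Z k \<in> borel_measurable (F (grid T M k))) \<and> (AE \<omega> in P. \<forall>k\<le>M. Y k \<omega> = Z k \<omega>) \<and>
        (\<forall>k\<le>M. integrable P (\<lambda>\<omega>. (lyap (p / 4) (Z k \<omega>))\<^sup>2)) \<and>
        expectation (\<lambda>\<omega>. (running_max (\<lambda>k. lyap (p / 4) (Z k \<omega>)) M)\<^sup>2)
          \<le> C * (1 + expectation (\<lambda>\<omega>. norm (X0 \<omega>) powr p))"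
      using Z_meas YZ unfolding u_def by (intro exI[of _ Z] conjI) auto
  qed
qed

end

section \<open>The interpolation process\<close>

text \<open>With \<theta> the elapsed fraction of the step, the drift is eliminated and a convex
  combination of two neighbouring grid values plus two noise terms remains: four terms, hence 4^p.
  The closed interval for t lets both noise terms be evaluated at points of the same
  interval.\<close>

lemma interpolation_norm_le:
  fixes Y :: "nat \<Rightarrow> 'w \<Rightarrow> real ^ 'n" and \<sigma> :: "real ^ 'n \<Rightarrow> real ^ 'm ^ 'n"
  assumes T: "0 < T" and M: "0 < M" and p: "0 \<le> p" and t: "0 \<le> t" "t < T"
    and rec: "\<And>k. k < M \<Longrightarrow> Y (Suc k) \<omega> = Y k \<omega> + (T / real M) *\<^sub>R b (Y (Suc k) \<omega>)
      + \<sigma> (Y k \<omega>) *v (W (grid T M (Suc k)) \<omega> - W (grid T M k) \<omega>)"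
    and growth: "\<And>y. norm (\<sigma> y) \<le> \<kappa> * sqrt (1 + (norm y)\<^sup>2)" and \<kappa>: "0 \<le> \<kappa>"
  obtains k where "k < M" "t \<in> {grid T M k..grid T M (Suc k)}"
    "norm (interpolation W b \<sigma> T M Y t \<omega>) powr p \<le> 4 powr p * (norm (Y k \<omega>) powr p + norm (Y (Suc k) \<omega>) powr p
      + \<kappa> powr p * (lyap (p / 4) (Y k \<omega>) * norm (W (grid T M (Suc k)) \<omega> - W (grid T M k) \<omega>) powr (p / 2))\<^sup>2
      + \<kappa> powr p * (lyap (p / 4) (Y k \<omega>) * norm (W t \<omega> - W (grid T M k) \<omega>) powr (p / 2))\<^sup>2)"
proof -
  define \<tau> where "\<tau> = T / real M"
  have \<tau>: "0 < \<tau>" using T M by (simp add: \<tau>_def)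
  define k where "k = nat \<lfloor>t / \<tau>\<rfloor>"
  have x0: "0 \<le> t / \<tau>" using t \<tau> by simp
  have k_bounds: "real k \<le> t / \<tau>" "t / \<tau> < real k + 1" using x0 unfolding k_def by linarith+
  have "t / \<tau> < real M" using t T M by (simp add: \<tau>_def field_simps)
  then have kM: "k < M" using k_bounds(1) by linarith
  have tk: "grid T M k \<le> t" "t < grid T M (Suc k)"
    using k_bounds \<tau> by (simp_all add: grid_def \<tau>_def[symmetric] pos_le_divide_eq pos_divide_less_eq add.commute)
  define \<theta> where "\<theta> = (t - grid T M k) / \<tau>"
  have dt: "grid T M (Suc k) - grid T M k = \<tau>"
    by (simp add: grid_def \<tau>_def add_divide_distrib algebra_simps)
  have \<theta>: "0 \<le> \<theta>" "\<theta> \<le> 1" using tk dt \<tau> by (simp_all add: \<theta>_def divide_le_eq)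
  define y y' d e where "y = Y k \<omega>" and "y' = Y (Suc k) \<omega>"
    and "d = W (grid T M (Suc k)) \<omega> - W (grid T M k) \<omega>" and "e = W t \<omega> - W (grid T M k) \<omega>"
  have step: "\<tau> *\<^sub>R b y' = y' - y - \<sigma> y *v d"
  proof -
    have "u = v + r + z \<Longrightarrow> r = u - v - z" for u v r z :: "real ^ 'n" by simp
    then show ?thesis using rec[OF kM] unfolding \<tau>_def y_def y'_def d_def .
  qed
  have noise_powr: "(\<kappa> * sqrt (1 + (norm y)\<^sup>2) * norm z) powr p
      = \<kappa> powr p * (lyap (p / 4) y * norm z powr (p / 2))\<^sup>2" for z :: "real ^ 'm"
  proof -
    have "sqrt (1 + (norm y)\<^sup>2) powr p = (1 + (norm y)\<^sup>2) powr (p / 2)"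
      by (subst powr_half_sqrt[symmetric]) (simp_all add: powr_powr)
    moreover have "(norm z powr (p / 2))\<^sup>2 = norm z powr p" by (simp add: power2_eq_square powr_add[symmetric])
    ultimately show ?thesis using \<kappa> by (simp add: powr_mult power_mult_distrib lyap_square)
  qed
  have "interpolation W b \<sigma> T M Y t \<omega> = y + (t - grid T M k) *\<^sub>R b y' + \<sigma> y *v e"
    unfolding y_def y'_def e_def using tk by (intro interpolation_on_subinterval T kM) auto
  also have "(t - grid T M k) *\<^sub>R b y' = \<theta> *\<^sub>R (y' - y - \<sigma> y *v d)"
    using \<tau> unfolding step[symmetric] by (simp add: \<theta>_def)
  also have "y + \<theta> *\<^sub>R (y' - y - \<sigma> y *v d) + \<sigma> y *v e
      = (1 - \<theta>) *\<^sub>R y + \<theta> *\<^sub>R y' - \<theta> *\<^sub>R (\<sigma> y *v d) + \<sigma> y *v e"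
    by (simp add: algebra_simps)
  also have "norm \<dots> \<le> norm ((1 - \<theta>) *\<^sub>R y) + norm (\<theta> *\<^sub>R y') + norm (\<theta> *\<^sub>R (\<sigma> y *v d)) + norm (\<sigma> y *v e)"
    by (intro order_trans[OF norm_triangle_ineq] order_trans[OF norm_triangle_ineq4] add_mono order_refl)
  also have "\<dots> \<le> norm y + norm y' + \<kappa> * sqrt (1 + (norm y)\<^sup>2) * norm d + \<kappa> * sqrt (1 + (norm y)\<^sup>2) * norm e"
  proof (intro add_mono)
    have noise: "norm (\<sigma> y *v z) \<le> \<kappa> * sqrt (1 + (norm y)\<^sup>2) * norm z" for z
      by (rule order_trans[OF norm_matrix_vector_le mult_right_mono[OF growth]]) simp
    then show "norm (\<sigma> y *v e) \<le> \<kappa> * sqrt (1 + (norm y)\<^sup>2) * norm e" .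
    have shrink: "norm (r *\<^sub>R z) \<le> norm z" if "0 \<le> r" "r \<le> 1" for r and z :: "real ^ 'n"
      using that by (simp add: mult_left_le_one_le)
    then show "norm ((1 - \<theta>) *\<^sub>R y) \<le> norm y" "norm (\<theta> *\<^sub>R y') \<le> norm y'" using \<theta> by auto
    show "norm (\<theta> *\<^sub>R (\<sigma> y *v d)) \<le> \<kappa> * sqrt (1 + (norm y)\<^sup>2) * norm d"
      using shrink[OF \<theta>] noise by (rule order_trans)
  qed
  finally have "norm (interpolation W b \<sigma> T M Y t \<omega>) powr p
      \<le> (norm y + norm y' + \<kappa> * sqrt (1 + (norm y)\<^sup>2) * norm d + \<kappa> * sqrt (1 + (norm y)\<^sup>2) * norm e) powr p"
    using p by (intro powr_mono2) auto
  also have "\<dots> \<le> 4 powr p * (norm y powr p + norm y' powr p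
      + (\<kappa> * sqrt (1 + (norm y)\<^sup>2) * norm d) powr p + (\<kappa> * sqrt (1 + (norm y)\<^sup>2) * norm e) powr p)"
    using p \<kappa> by (intro add4_powr_le) auto
  finally show thesis
    using that[OF kM] tk unfolding noise_powr unfolding y_def y'_def d_def e_def by auto
qed

theorem proposition2p1:
  fixes P :: "'w measure"
    and F :: "real \<Rightarrow> 'w measure"
    and W :: "real \<Rightarrow> 'w \<Rightarrow> real ^ 'm"
    and b :: "real ^ 'n \<Rightarrow> real ^ 'n"
    and \<sigma> :: "real ^ 'n \<Rightarrow> real ^ 'm ^ 'n"
    and T L\<^sub>b L\<^sub>\<sigma> p :: real
  assumes "wiener_process P F W"
    and "0 < T"
    and "continuous_on UNIV b"
    and "continuous_on UNIV \<sigma>"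
    and "\<And>x y. (b x - b y) \<bullet> (x - y) \<le> L\<^sub>b * (norm (x - y))\<^sup>2"
    and "0 \<le> L\<^sub>\<sigma>"
    and "\<And>x y. hs_norm (\<sigma> x - \<sigma> y) \<le> L\<^sub>\<sigma> * norm (x - y)"
    and "4 \<le> p"
  shows "\<exists>C::real. 0 \<le> C \<and>
    (\<forall>(X0 :: 'w \<Rightarrow> real ^ 'n) (M :: nat) (Y :: nat \<Rightarrow> 'w \<Rightarrow> real ^ 'n).
      X0 \<in> borel_measurable (F 0) \<longrightarrow>
      (\<integral>\<^sup>+ \<omega>. ennreal (norm (X0 \<omega>) powr p) \<partial>P) < \<infinity> \<longrightarrow>
      0 < M \<longrightarrow> T < real M \<longrightarrow> 2 * L\<^sub>b * (T / real M) < 1 \<longrightarrow>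
      backward_euler_scheme P W b \<sigma> T M X0 Y \<longrightarrow>
      (\<integral>\<^sup>+ \<omega>. (SUP k\<in>{0..M}. ennreal (norm (Y k \<omega>) powr p)) \<partial>P)
        \<le> ennreal C * (1 + (\<integral>\<^sup>+ \<omega>. ennreal (norm (X0 \<omega>) powr p) \<partial>P)) \<and>
      ((SUP k\<in>{0..M}. \<integral>\<^sup>+ \<omega>. ennreal (norm (b (Y k \<omega>)) powr p) \<partial>P) < \<infinity> \<longrightarrow>
       (\<integral>\<^sup>+ \<omega>. (SUP t\<in>{0..T}. ennreal (norm (interpolation W b \<sigma> T M Y t \<omega>) powr p)) \<partial>P)
        \<le> ennreal C * (1 + (\<integral>\<^sup>+ \<omega>. ennreal (norm (X0 \<omega>) powr p) \<partial>P)
            + (SUP k\<in>{0..M}. \<integral>\<^sup>+ \<omega>. ennreal (norm (b (Y k \<omega>)) powr p) \<partial>P))))"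
proof -
  interpret wiener_process P F W by fact
  note T = \<open>0 < T\<close> and cont = \<open>continuous_on UNIV b\<close> \<open>continuous_on UNIV \<sigma>\<close> and p = \<open>4 \<le> p\<close>
  have lipschitz: "norm (\<sigma> x - \<sigma> y) \<le> L\<^sub>\<sigma> * norm (x - y)" for x y
    using assms(7)[of x y] by (simp add: hs_norm_eq_norm)
  \<comment> \<open>\<open>L\<^sub>b\<close> may be negative. Enlarging it to 0 keeps the one-sided
    condition, and the step condition becomes trivial in that case.\<close>
  define L where "L = max L\<^sub>b 0"
  have L: "0 \<le> L" by (simp add: L_def)
  have onesided: "(b x - b y) \<bullet> (x - y) \<le> L * (norm (x - y))\<^sup>2" for x y
    by (rule order_trans[OF assms(5)]) (intro mult_right_mono; simp add: L_def)
  obtain \<delta> where \<delta>: "0 < \<delta>" "\<delta> \<le> 1"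
    and margin: "\<And>M::nat. 0 < M \<Longrightarrow> 2 * L * (T / real M) < 1 \<Longrightarrow> \<delta> \<le> 1 - 2 * L * (T / real M)"
    using uniform_step_margin[OF L T] by blast
  obtain C1 where C1: "0 \<le> C1" and moments: "\<And>X0 M Y. X0 \<in> borel_measurable (F 0) \<Longrightarrow>
      integrable P (\<lambda>\<omega>. norm (X0 \<omega>) powr p) \<Longrightarrow>
      0 < M \<Longrightarrow> T < real M \<Longrightarrow> \<delta> \<le> 1 - 2 * L * (T / real M) \<Longrightarrow>
      backward_euler_scheme P W b \<sigma> T M X0 Y \<Longrightarrow>
      \<exists>Z. (\<forall>k. Z k \<in> borel_measurable (F (grid T M k))) \<and> (AE \<omega> in P. \<forall>k\<le>M. Y k \<omega> = Z k \<omega>) \<and>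
        (\<forall>k\<le>M. integrable P (\<lambda>\<omega>. (lyap (p / 4) (Z k \<omega>))\<^sup>2)) \<and>
        expectation (\<lambda>\<omega>. (running_max (\<lambda>k. lyap (p / 4) (Z k \<omega>)) M)\<^sup>2)
          \<le> C1 * (1 + expectation (\<lambda>\<omega>. norm (X0 \<omega>) powr p))"
    using backward_euler_moment_bound[OF onesided lipschitz cont L \<open>0 \<le> L\<^sub>\<sigma>\<close> p T \<delta>] by blast
  define \<kappa> where "\<kappa> = norm (\<sigma> 0) + L\<^sub>\<sigma>"
  have \<kappa>: "0 \<le> \<kappa>" using \<open>0 \<le> L\<^sub>\<sigma>\<close> by (simp add: \<kappa>_def)
  have growth: "norm (\<sigma> y) \<le> \<kappa> * sqrt (1 + (norm y)\<^sup>2)" for y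
    unfolding \<kappa>_def by (rule lipschitz_imp_linear_growth[OF lipschitz \<open>0 \<le> L\<^sub>\<sigma>\<close>])
  define n where "n = nat \<lceil>p\<rceil>"
  have n: "p \<le> 2 * real n" using p unfolding n_def by linarith
  define c where "c = increment_moment 2 + increment_moment n"
  have c: "0 \<le> c" by (simp add: c_def increment_moment_nonneg)
  \<comment> \<open>Two grid values contribute \<open>C1\<close> each; each of the two noise terms
    contributes \<kappa>^p times the bound 4 C1 c T for the sum of all majorants.\<close>
  define C2 where "C2 = 4 powr p * (2 * C1 + 2 * \<kappa> powr p * (4 * C1 * c * T))"
  have C2: "0 \<le> C2" using C1 c T by (simp add: C2_def)
  show ?thesis
  proof (intro exI[of _ "C1 + C2"] conjI allI impI)
    show "0 \<le> C1 + C2" using C1 C2 by simp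
    fix X0 :: "'w \<Rightarrow> real ^ 'n" and M :: nat and Y :: "nat \<Rightarrow> 'w \<Rightarrow> real ^ 'n"
    assume X0: "X0 \<in> borel_measurable (F 0)"
      and fin: "(\<integral>\<^sup>+ \<omega>. ennreal (norm (X0 \<omega>) powr p) \<partial>P) < \<infinity>"
      and M: "0 < M" "T < real M" "2 * L\<^sub>b * (T / real M) < 1"
      and scheme: "backward_euler_scheme P W b \<sigma> T M X0 Y"
    define \<tau> where "\<tau> = T / real M"
    have \<tau>: "0 < \<tau>" "\<tau> \<le> 1" using T M by (auto simp: \<tau>_def)
    have "(\<lambda>\<omega>. norm (X0 \<omega>)) \<in> borel_measurable P"
      by (rule measurable_compose[OF measurable_past[OF order_refl X0] borel_measurable_norm])
    then have X0_int: "integrable P (\<lambda>\<omega>. norm (X0 \<omega>) powr p)"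
      using fin by (intro integrableI_nonneg) auto
    define m where "m = expectation (\<lambda>\<omega>. norm (X0 \<omega>) powr p)"
    have m: "0 \<le> m" by (simp add: m_def)
    have X0_eq: "(\<integral>\<^sup>+ \<omega>. ennreal (norm (X0 \<omega>) powr p) \<partial>P) = ennreal m"
      unfolding m_def by (intro nn_integral_eq_integral X0_int) auto
    have "2 * L * (T / real M) < 1" using M by (auto simp: L_def max_def)
    from moments[OF X0 X0_int M(1,2) margin[OF M(1) this] scheme]
    obtain Z where Z_meas: "\<And>k. Z k \<in> borel_measurable (F (grid T M k))"
      and YZ: "AE \<omega> in P. \<forall>k\<le>M. Y k \<omega> = Z k \<omega>"
      and Z_int: "\<And>k. k \<le> M \<Longrightarrow> integrable P (\<lambda>\<omega>. (lyap (p / 4) (Z k \<omega>))\<^sup>2)"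
      and Z_bound: "expectation (\<lambda>\<omega>. (running_max (\<lambda>k. lyap (p / 4) (Z k \<omega>)) M)\<^sup>2) \<le> C1 * (1 + m)"
      unfolding m_def by blast
    define u where "u k \<omega> = lyap (p / 4) (Z k \<omega>)" for k \<omega>
    \<comment> \<open>One integrable random variable that dominates all grid values at once.\<close>
    define U where "U \<omega> = (running_max (\<lambda>k. u k \<omega>) M)\<^sup>2" for \<omega>
    have grid: "0 \<le> grid T M k" "grid T M k < grid T M (Suc k)" for k
      using T M by (auto simp: grid_def intro!: divide_strict_right_mono)
    have dt: "grid T M (Suc k) - grid T M k = \<tau>" for k
      by (simp add: grid_def \<tau>_def add_divide_distrib algebra_simps)
    have u_meas: "u k \<in> borel_measurable (F (grid T M k))" for k
      unfolding u_def by (intro borel_measurable_lyap Z_meas)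
    have uP: "u k \<in> borel_measurable P" for k using measurable_past[OF grid(1) u_meas] .
    have u_int: "integrable P (\<lambda>\<omega>. (u k \<omega>)\<^sup>2)" if "k \<le> M" for k using Z_int[OF that] by (simp add: u_def)
    have u_nonneg: "0 \<le> u k \<omega>" for k \<omega> using lyap_pos[of "p / 4" "Z k \<omega>"] by (simp add: u_def)
    have U_int: "integrable P U"
      unfolding U_def using uP u_int by (intro integrable_running_max_square) auto
    have EU: "expectation U \<le> C1 * (1 + m)" using Z_bound by (simp add: U_def[abs_def] u_def)
    have uU: "(u k \<omega>)\<^sup>2 \<le> U \<omega>" if "k \<le> M" for k \<omega>
      unfolding U_def using that u_nonneg by (intro power_mono running_max_ge) auto
    have U_nonneg: "0 \<le> U \<omega>" for \<omega> by (simp add: U_def)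
    have ZU: "norm (Z k \<omega>) powr p \<le> U \<omega>" if "k \<le> M" for k \<omega>
      using norm_powr_le_lyap_square[of p "Z k \<omega>"] uU[OF that, of \<omega>] p by (simp add: u_def)
    have nnU: "(\<integral>\<^sup>+ \<omega>. ennreal (U \<omega>) \<partial>P) = ennreal (expectation U)"
      by (intro nn_integral_eq_integral U_int) (simp add: U_nonneg)
    show "(\<integral>\<^sup>+ \<omega>. (SUP k\<in>{0..M}. ennreal (norm (Y k \<omega>) powr p)) \<partial>P)
        \<le> ennreal (C1 + C2) * (1 + (\<integral>\<^sup>+ \<omega>. ennreal (norm (X0 \<omega>) powr p) \<partial>P))"
    proof -
      have "(\<integral>\<^sup>+ \<omega>. (SUP k\<in>{0..M}. ennreal (norm (Y k \<omega>) powr p)) \<partial>P) \<le> (\<integral>\<^sup>+ \<omega>. ennreal (U \<omega>) \<partial>P)"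
      proof (rule nn_integral_mono_AE)
        show "AE \<omega> in P. (SUP k\<in>{0..M}. ennreal (norm (Y k \<omega>) powr p)) \<le> ennreal (U \<omega>)"
          using YZ
        proof eventually_elim
          case (elim \<omega>)
          then show ?case using ZU by (intro SUP_least ennreal_leI) auto
        qed
      qed
      also have "\<dots> \<le> ennreal (C1 * (1 + m))" unfolding nnU by (intro ennreal_leI EU)
      also have "\<dots> \<le> ennreal ((C1 + C2) * (1 + m))" using C2 m by (intro ennreal_leI mult_right_mono) auto
      also have "\<dots> = ennreal (C1 + C2) * (1 + ennreal m)" using C1 C2 m by (simp add: ennreal_mult)
      finally show ?thesis unfolding X0_eq .
    qed
    \<comment> \<open>On each subinterval: 4 is Doob's constant, C1 (1 + m) bounds the second moment
      of the weight and c \<tau>^2 the p-th moment of the increment.\<close>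
    have "\<exists>H. H \<in> borel_measurable P \<and>
        (AE \<omega> in P. \<forall>v\<in>{grid T M k..grid T M (Suc k)}.
          ennreal ((u k \<omega> * norm (W v \<omega> - W (grid T M k) \<omega>) powr (p / 2))\<^sup>2) \<le> H \<omega>) \<and>
        (\<integral>\<^sup>+\<omega>. H \<omega> \<partial>P) \<le> ennreal (4 * (C1 * (1 + m) * (c * \<tau>\<^sup>2)))" if k: "k \<in> {..<M}" for k
    proof -
      have r: "2 \<le> p / 2" using p by simp
      have uk: "integrable P (\<lambda>\<omega>. (u k \<omega>)\<^sup>2)" using u_int k by simp
      obtain H :: "'w \<Rightarrow> ennreal" where H: "H \<in> borel_measurable P"
        "AE \<omega> in P. \<forall>v\<in>{grid T M k..grid T M (Suc k)}.
          ennreal ((u k \<omega> * norm (W v \<omega> - W (grid T M k) \<omega>) powr (p / 2))\<^sup>2) \<le> H \<omega>"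
        "(\<integral>\<^sup>+\<omega>. H \<omega> \<partial>P) \<le> ennreal (4 * (expectation (\<lambda>\<omega>. (u k \<omega>)\<^sup>2)
          * expectation (\<lambda>\<omega>. norm (W (grid T M (Suc k)) \<omega> - W (grid T M k) \<omega>) powr (2 * (p / 2)))))"
        by (rule weighted_increment_sup[OF grid r u_meas uk u_nonneg])
      have "expectation (\<lambda>\<omega>. norm (W (grid T M (Suc k)) \<omega> - W (grid T M k) \<omega>) powr (2 * (p / 2))) \<le> c * \<tau>\<^sup>2"
        using expectation_increment_powr[OF grid, of k p n] \<tau> p n unfolding dt c_def by simp
      moreover have "expectation (\<lambda>\<omega>. (u k \<omega>)\<^sup>2) \<le> C1 * (1 + m)"
        using k by (intro order_trans[OF integral_mono EU] uk U_int uU) auto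
      ultimately have "4 * (expectation (\<lambda>\<omega>. (u k \<omega>)\<^sup>2)
          * expectation (\<lambda>\<omega>. norm (W (grid T M (Suc k)) \<omega> - W (grid T M k) \<omega>) powr (2 * (p / 2))))
          \<le> 4 * (C1 * (1 + m) * (c * \<tau>\<^sup>2))"
        using C1 m by (intro mult_left_mono mult_mono) auto
      then show ?thesis using H order_trans[OF H(3) ennreal_leI] by blast
    qed
    then have "\<forall>k\<in>{..<M}. \<exists>H. H \<in> borel_measurable P \<and>
        (AE \<omega> in P. \<forall>v\<in>{grid T M k..grid T M (Suc k)}.
          ennreal ((u k \<omega> * norm (W v \<omega> - W (grid T M k) \<omega>) powr (p / 2))\<^sup>2) \<le> H \<omega>) \<and>
        (\<integral>\<^sup>+\<omega>. H \<omega> \<partial>P) \<le> ennreal (4 * (C1 * (1 + m) * (c * \<tau>\<^sup>2)))" by blast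
    from bchoice[OF this] obtain H :: "nat \<Rightarrow> 'w \<Rightarrow> ennreal" where
      H_all: "\<forall>k\<in>{..<M}. H k \<in> borel_measurable P \<and>
        (AE \<omega> in P. \<forall>v\<in>{grid T M k..grid T M (Suc k)}.
          ennreal ((u k \<omega> * norm (W v \<omega> - W (grid T M k) \<omega>) powr (p / 2))\<^sup>2) \<le> H k \<omega>) \<and>
        (\<integral>\<^sup>+\<omega>. H k \<omega> \<partial>P) \<le> ennreal (4 * (C1 * (1 + m) * (c * \<tau>\<^sup>2)))" by (rule exE)
    have H_meas: "H k \<in> borel_measurable P" if "k \<in> {..<M}" for k using H_all that by blast
    have H_int: "(\<integral>\<^sup>+\<omega>. H k \<omega> \<partial>P) \<le> ennreal (4 * (C1 * (1 + m) * (c * \<tau>\<^sup>2)))" if "k \<in> {..<M}" for k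
      using H_all that by blast
    have H_AE: "AE \<omega> in P. \<forall>k\<in>{..<M}. \<forall>v\<in>{grid T M k..grid T M (Suc k)}.
        ennreal ((u k \<omega> * norm (W v \<omega> - W (grid T M k) \<omega>) powr (p / 2))\<^sup>2) \<le> H k \<omega>"
      using H_all by (subst AE_ball_countable) auto
    \<comment> \<open>The maximum over the subintervals is replaced by the sum. This is affordable
      since M \<tau>^2 = T \<tau> \<le> T.\<close>
    define I where "I \<omega> = (\<Sum>k<M. H k \<omega>)" for \<omega>
    have I_meas: "I \<in> borel_measurable P" unfolding I_def using H_meas by (intro borel_measurable_sum)
    have I_int: "(\<integral>\<^sup>+\<omega>. I \<omega> \<partial>P) \<le> ennreal (4 * C1 * c * T * (1 + m))"
    proof -
      have "(\<integral>\<^sup>+\<omega>. I \<omega> \<partial>P) = (\<Sum>k<M. \<integral>\<^sup>+\<omega>. H k \<omega> \<partial>P)"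
        unfolding I_def using H_meas by (intro nn_integral_sum)
      also have "\<dots> \<le> (\<Sum>k<M. ennreal (4 * (C1 * (1 + m) * (c * \<tau>\<^sup>2))))"
        using H_int by (intro sum_mono)
      also have "\<dots> = ennreal (real M * (4 * (C1 * (1 + m) * (c * \<tau>\<^sup>2))))"
        using C1 c m by (simp add: ennreal_mult ennreal_of_nat_eq_real_of_nat)
      also have "\<dots> \<le> ennreal (4 * C1 * c * T * (1 + m))"
      proof (rule ennreal_leI)
        have "real M * (4 * (C1 * (1 + m) * (c * \<tau>\<^sup>2))) = (4 * C1 * c * T * (1 + m)) * \<tau>"
          using M(1) by (simp add: \<tau>_def power2_eq_square)
        also have "\<dots> \<le> (4 * C1 * c * T * (1 + m)) * 1"
          using C1 c T m \<tau> by (intro mult_left_mono) auto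
        finally show "real M * (4 * (C1 * (1 + m) * (c * \<tau>\<^sup>2))) \<le> 4 * C1 * c * T * (1 + m)" by simp
      qed
      finally show ?thesis .
    qed
    have rec: "AE \<omega> in P. \<forall>k<M. Y (Suc k) \<omega> = Y k \<omega> + (T / real M) *\<^sub>R b (Y (Suc k) \<omega>)
        + \<sigma> (Y k \<omega>) *v (W (grid T M (Suc k)) \<omega> - W (grid T M k) \<omega>)"
      using scheme unfolding backward_euler_scheme_def by (auto elim: AE_mp)
    \<comment> \<open>A measurable majorant of the supremum over the time interval; monotonicity of
      the nonnegative integral then applies to the supremum as it stands.\<close>
    define K where "K \<omega> = ennreal (4 powr p) * (2 * ennreal (U \<omega>) + 2 * ennreal (\<kappa> powr p) * I \<omega>)" for \<omega>
    have path: "AE \<omega> in P. (SUP t\<in>{0..T}. ennreal (norm (interpolation W b \<sigma> T M Y t \<omega>) powr p)) \<le> K \<omega>"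
      using rec YZ H_AE
    proof eventually_elim
      case (elim \<omega>)
      have YU: "ennreal (norm (Y k \<omega>) powr p) \<le> ennreal (U \<omega>)" if "k \<le> M" for k
        using ZU[OF that, of \<omega>] elim(2) that by (intro ennreal_leI) auto
      have four: "1 \<le> (4::real) powr p" using p by (intro ge_one_powr_ge_zero) auto
      show ?case
      proof (rule SUP_least)
        fix t assume t: "t \<in> {0..T}"
        show "ennreal (norm (interpolation W b \<sigma> T M Y t \<omega>) powr p) \<le> K \<omega>"
        proof (cases "t = T")
          \<comment> \<open>The endpoint lies in no half-open subinterval; the value there is
            \<open>Y M\<close>, and 4^p \<ge> 1 makes the same majorant suffice.\<close>
          case True
          have "ennreal (norm (interpolation W b \<sigma> T M Y t \<omega>) powr p) \<le> 1 * ennreal (U \<omega>)"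
            using YU[of M] by (simp add: True interpolation_end)
          also have "\<dots> \<le> ennreal (4 powr p) * (2 * ennreal (U \<omega>) + 2 * ennreal (\<kappa> powr p) * I \<omega>)"
          proof (rule mult_mono)
            show "1 \<le> ennreal (4 powr p)" using ennreal_leI[OF four] by simp
            show "ennreal (U \<omega>) \<le> 2 * ennreal (U \<omega>) + 2 * ennreal (\<kappa> powr p) * I \<omega>"
              by (simp add: mult_2 add.assoc add_increasing2)
          qed auto
          finally show ?thesis by (simp add: K_def)
        next
          case False
          then have t': "0 \<le> t" "t < T" using t by auto
          define J where "J k v = (u k \<omega> * norm (W v \<omega> - W (grid T M k) \<omega>) powr (p / 2))\<^sup>2" for k v
          have p0: "0 \<le> p" using p by simp
          have recY: "Y (Suc k) \<omega> = Y k \<omega> + (T / real M) *\<^sub>R b (Y (Suc k) \<omega>)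
              + \<sigma> (Y k \<omega>) *v (W (grid T M (Suc k)) \<omega> - W (grid T M k) \<omega>)" if "k < M" for k
            using elim(1) that by blast
          obtain k where k: "k < M" "t \<in> {grid T M k..grid T M (Suc k)}"
            and le: "norm (interpolation W b \<sigma> T M Y t \<omega>) powr p
              \<le> 4 powr p * (norm (Y k \<omega>) powr p + norm (Y (Suc k) \<omega>) powr p
              + \<kappa> powr p * (lyap (p / 4) (Y k \<omega>) * norm (W (grid T M (Suc k)) \<omega> - W (grid T M k) \<omega>) powr (p / 2))\<^sup>2
              + \<kappa> powr p * (lyap (p / 4) (Y k \<omega>) * norm (W t \<omega> - W (grid T M k) \<omega>) powr (p / 2))\<^sup>2)"
            by (rule interpolation_norm_le[where W = W and Y = Y and \<omega> = \<omega>, OF T M(1) p0 t' recY growth \<kappa>])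
          have Yk: "lyap (p / 4) (Y k \<omega>) = u k \<omega>" using elim(2) k by (simp add: u_def)
          have JH: "ennreal (J k v) \<le> I \<omega>" if "v \<in> {grid T M k..grid T M (Suc k)}" for v
          proof -
            have "ennreal (J k v) \<le> H k \<omega>" using elim(3) k that unfolding J_def by blast
            also have "\<dots> \<le> I \<omega>" unfolding I_def using k by (intro member_le_sum) auto
            finally show ?thesis .
          qed
          have "ennreal (norm (interpolation W b \<sigma> T M Y t \<omega>) powr p)
              \<le> ennreal (4 powr p * (norm (Y k \<omega>) powr p + norm (Y (Suc k) \<omega>) powr p
                + \<kappa> powr p * J k (grid T M (Suc k)) + \<kappa> powr p * J k t))"
            using le unfolding Yk J_def by (rule ennreal_leI)
          also have "\<dots> = ennreal (4 powr p) * (ennreal (norm (Y k \<omega>) powr p) + ennreal (norm (Y (Suc k) \<omega>) powr p)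
                + ennreal (\<kappa> powr p) * ennreal (J k (grid T M (Suc k))) + ennreal (\<kappa> powr p) * ennreal (J k t))"
            by (simp add: J_def ennreal_mult)
          also have "\<dots> \<le> ennreal (4 powr p) * (ennreal (U \<omega>) + ennreal (U \<omega>)
                + ennreal (\<kappa> powr p) * I \<omega> + ennreal (\<kappa> powr p) * I \<omega>)"
            using k grid(2)[of k] by (intro mult_left_mono add_mono YU JH) auto
          also have "\<dots> = K \<omega>" by (simp add: K_def mult_2 distrib_right add.assoc)
          finally show ?thesis .
        qed
      qed
    qed
    have "(\<integral>\<^sup>+ \<omega>. (SUP t\<in>{0..T}. ennreal (norm (interpolation W b \<sigma> T M Y t \<omega>) powr p)) \<partial>P) \<le> (\<integral>\<^sup>+ \<omega>. K \<omega> \<partial>P)"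
      by (rule nn_integral_mono_AE[OF path])
    also have "\<dots> = ennreal (4 powr p) * (2 * ennreal (expectation U) + 2 * ennreal (\<kappa> powr p) * (\<integral>\<^sup>+\<omega>. I \<omega> \<partial>P))"
      unfolding K_def nnU[symmetric] using I_meas borel_measurable_integrable[OF U_int]
      by (simp add: nn_integral_cmult nn_integral_add)
    also have "\<dots> \<le> ennreal (4 powr p) * (2 * ennreal (C1 * (1 + m)) + 2 * ennreal (\<kappa> powr p) * ennreal (4 * C1 * c * T * (1 + m)))"
      by (intro mult_left_mono add_mono I_int ennreal_leI EU) auto
    also have "\<dots> = ennreal (C2 * (1 + m))"
    proof -
      have "ennreal a * (2 * ennreal x + 2 * ennreal d * ennreal y) = ennreal (a * (2 * x + 2 * d * y))"
        if "0 \<le> a" "0 \<le> x" "0 \<le> d" "0 \<le> y" for a x d y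
        using that by (simp add: ennreal_mult)
      moreover have "4 powr p * (2 * (C1 * (1 + m)) + 2 * \<kappa> powr p * (4 * C1 * c * T * (1 + m))) = C2 * (1 + m)"
        by (simp add: C2_def algebra_simps)
      ultimately show ?thesis using C1 c T m by simp
    qed
    also have "\<dots> \<le> ennreal ((C1 + C2) * (1 + m))" using C1 m by (intro ennreal_leI mult_right_mono) auto
    also have "\<dots> = ennreal (C1 + C2) * (1 + ennreal m)" using C1 C2 m by (simp add: ennreal_mult)
    finally have interp: "(\<integral>\<^sup>+ \<omega>. (SUP t\<in>{0..T}. ennreal (norm (interpolation W b \<sigma> T M Y t \<omega>) powr p)) \<partial>P)
        \<le> ennreal (C1 + C2) * (1 + ennreal m)" .
    show "(\<integral>\<^sup>+ \<omega>. (SUP t\<in>{0..T}. ennreal (norm (interpolation W b \<sigma> T M Y t \<omega>) powr p)) \<partial>P)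
        \<le> ennreal (C1 + C2) * (1 + (\<integral>\<^sup>+ \<omega>. ennreal (norm (X0 \<omega>) powr p) \<partial>P)
            + (SUP k\<in>{0..M}. \<integral>\<^sup>+ \<omega>. ennreal (norm (b (Y k \<omega>)) powr p) \<partial>P))"
      unfolding X0_eq by (rule order_trans[OF interp]) (intro mult_left_mono; simp)
  qed
qed

end
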